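(* Let $\mathcal{U}_5\subset G(5,\bigwedge^2V_6)$ be the set of $5$-dimensional vector subspaces $W_5^\vee\subset \bigwedge^2 V_6$ such that the intersection of $\mathbb{P}(W_5^\vee)$ with $G(2,V_6)$ consists of $5$ distinct linearly independent points. Let $W_4^\vee$ be a general $4$-dimensional subspace of $\bigwedge^2V_6$. Then there is a unique element of $\mathcal{U}_5$ containing $W_4^\vee$.
   Context: $V_6$ is a $6$-dimensional complex vector space. For a vector space $U$, $\mathbb{P}(U)$ is the space of lines in $U$ and $G(k,U)$ is the Grassmannian of $k$-dimensional subspaces. $G(2,V_6)\subset\mathbb{P}(\bigwedge^2V_6)$ is embedded by the Plücker embedding (classes of decomposable bivectors). $W_4^\vee$ and $W_5^\vee$ are just names for subspaces of dimension $4$ and $5$. "General" means in a nonempty Zariski open subset of $G(4,\bigwedge^2V_6)$. *)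

theory Defs
  imports Complex_Main "Jordan_Normal_Form.Determinant"
begin

text \<open>
  Complex vector spaces are types carrying a scalar multiplication \<open>s\<close> with
  \<^term>\<open>vector_space s\<close>; the space is the whole type.
\<close>

definition alternating_bilinear ::
  "(complex \<Rightarrow> 'v::ab_group_add \<Rightarrow> 'v) \<Rightarrow> (complex \<Rightarrow> 'x::ab_group_add \<Rightarrow> 'x) \<Rightarrow>
    ('v \<Rightarrow> 'v \<Rightarrow> 'x) \<Rightarrow> bool" where
  "alternating_bilinear sV sX f \<longleftrightarrow>
     (\<forall>v. Vector_Spaces.linear sV sX (f v)) \<and>
     (\<forall>w. Vector_Spaces.linear sV sX (\<lambda>v. f v w)) \<and>
     (\<forall>v. f v v = 0)"

text \<open>
  The exterior square, given by its universal property. HOL cannot quantify over all target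
  spaces inside a definition, so only the target \<open>\<complex>\<close> is required here;
  \<open>exterior_square_universal\<close> below derives the property for an arbitrary target.
\<close>

definition exterior_square ::
  "(complex \<Rightarrow> 'v::ab_group_add \<Rightarrow> 'v) \<Rightarrow> (complex \<Rightarrow> 'e::ab_group_add \<Rightarrow> 'e) \<Rightarrow>
    ('v \<Rightarrow> 'v \<Rightarrow> 'e) \<Rightarrow> bool" where
  "exterior_square sV sE wedge \<longleftrightarrow>
     alternating_bilinear sV sE wedge \<and>
     (\<forall>\<beta> :: 'v \<Rightarrow> 'v \<Rightarrow> complex. alternating_bilinear sV (*) \<beta> \<longrightarrow>
        (\<exists>!h. Vector_Spaces.linear sE (*) h \<and> (\<forall>v w. h (wedge v w) = \<beta> v w)))"

lemma alternating_bilinear_compose: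
  assumes f: "alternating_bilinear sV sX f" and q: "Vector_Spaces.linear sX sY q"
  shows "alternating_bilinear sV sY (\<lambda>v w. q (f v w))"
  unfolding alternating_bilinear_def
proof (intro conjI allI)
  fix v
  have "Vector_Spaces.linear sV sX (f v)" using f by (simp add: alternating_bilinear_def)
  from Vector_Spaces.linear_compose[OF this q]
  show "Vector_Spaces.linear sV sY (\<lambda>w. q (f v w))" by (simp add: o_def)
next
  fix w
  have "Vector_Spaces.linear sV sX (\<lambda>v. f v w)" using f by (simp add: alternating_bilinear_def)
  from Vector_Spaces.linear_compose[OF this q]
  show "Vector_Spaces.linear sV sY (\<lambda>v. q (f v w))" by (simp add: o_def)
next
  fix v
  interpret q: Vector_Spaces.linear sX sY q by (fact q)
  show "q (f v v) = 0" using f q.zero by (simp add: alternating_bilinear_def)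
qed

lemma exterior_square_universal:
  fixes sV :: "complex \<Rightarrow> 'v::ab_group_add \<Rightarrow> 'v"
    and sE :: "complex \<Rightarrow> 'e::ab_group_add \<Rightarrow> 'e"
    and sX :: "complex \<Rightarrow> 'x::ab_group_add \<Rightarrow> 'x"
  assumes ext: "exterior_square sV sE wedge"
    and f: "alternating_bilinear sV sX f"
  shows "\<exists>!g. Vector_Spaces.linear sE sX g \<and> (\<forall>v w. g (wedge v w) = f v w)"
proof -
  interpret E: Vector_Spaces.linear sV sE "wedge 0"
    using ext by (auto simp: exterior_square_def alternating_bilinear_def)
  interpret X: Vector_Spaces.linear sV sX "f 0"
    using f by (auto simp: alternating_bilinear_def)
  interpret C: vector_space "(*) :: complex \<Rightarrow> complex \<Rightarrow> complex"
    by unfold_locales (auto simp: algebra_simps)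
  interpret EX: vector_space_pair sE sX ..
  interpret EC: vector_space_pair sE "(*) :: complex \<Rightarrow> complex \<Rightarrow> complex" ..
  interpret XC: vector_space_pair sX "(*) :: complex \<Rightarrow> complex \<Rightarrow> complex" ..
  define D where "D = {wedge v w | v w. True}"
  have uniq: "h = h'"
    if "Vector_Spaces.linear sE (*) h" "Vector_Spaces.linear sE (*) h'" "\<forall>x\<in>D. h x = h' x"
    for h h' :: "'e \<Rightarrow> complex"
  proof -
    have "alternating_bilinear sV (*) (\<lambda>v w. h (wedge v w))"
      using ext that(1) by (auto simp: exterior_square_def intro: alternating_bilinear_compose[where f = wedge])
    then have "\<exists>!k. Vector_Spaces.linear sE (*) k \<and> (\<forall>v w. k (wedge v w) = h (wedge v w))"
      using ext by (simp add: exterior_square_def)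
    moreover have "\<forall>v w. h' (wedge v w) = h (wedge v w)"
      using that(3) unfolding D_def by (metis (mono_tags, lifting) mem_Collect_eq)
    ultimately show ?thesis using that(1,2) by blast
  qed
  obtain B where B: "B \<subseteq> D" "E.vs2.independent B" "D \<subseteq> E.vs2.span B"
    using E.vs2.maximal_independent_subset by blast
  have span: "E.vs2.span B = UNIV"
  proof (rule ccontr)
    assume "E.vs2.span B \<noteq> UNIV"
    then obtain x where x: "x \<notin> E.vs2.span B" by blast
    then have "E.vs2.independent (insert x B)"
      using B(2) E.vs2.independent_insert by auto
    from EC.linear_independent_extend[OF this, of "\<lambda>y. if y = x then 1 else 0"]
    obtain h where h: "Vector_Spaces.linear sE (*) h"
      "\<forall>y\<in>insert x B. h y = (if y = x then 1 else 0)" by blast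
    have z: "Vector_Spaces.linear sE (*) (\<lambda>_. 0::complex)"
      by (rule EC.linear_zero)
    have "h b = 0" if "b \<in> B" for b
      using h(2) x that E.vs2.span_base by auto
    then have "h y = 0" if "y \<in> E.vs2.span B" for y
      using EC.linear_eq_on[OF h(1) z that] by blast
    then have "\<forall>y\<in>D. h y = 0" using B(3) by auto
    then have "h = (\<lambda>_. 0)" using uniq[OF h(1) z] by auto
    then show False using h(2) by auto
  qed
  define c where "c b = (SOME p. b = wedge (fst p) (snd p))" for b
  have c: "b = wedge (fst (c b)) (snd (c b))" if "b \<in> B" for b
  proof -
    obtain v w where "b = wedge v w" using \<open>b \<in> B\<close> B(1) unfolding D_def by blast
    then have "\<exists>p. b = wedge (fst p) (snd p)" by (intro exI[of _ "(v, w)"]) simp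
    then show ?thesis unfolding c_def by (rule someI_ex)
  qed
  obtain g where g: "Vector_Spaces.linear sE sX g" "\<forall>b\<in>B. g b = f (fst (c b)) (snd (c b))"
    using EX.linear_independent_extend[OF B(2), of "\<lambda>b. f (fst (c b)) (snd (c b))"] by blast
  have gf: "g (wedge v w) = f v w" for v w
  proof (rule ccontr)
    define x where "x = g (wedge v w) - f v w"
    assume "g (wedge v w) \<noteq> f v w"
    then have "X.vs2.independent {x}" by (simp add: x_def)
    from XC.linear_independent_extend[OF this, of "\<lambda>_. 1"]
    obtain q where q: "Vector_Spaces.linear sX (*) q" "q x = 1" by auto
    interpret q: Vector_Spaces.linear sX "(*)" q by (fact q(1))
    have "alternating_bilinear sV (*) (\<lambda>v w. q (f v w))"
      by (rule alternating_bilinear_compose[OF f q(1)])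
    then obtain h where h: "Vector_Spaces.linear sE (*) h" "\<forall>v w. h (wedge v w) = q (f v w)"
      using ext unfolding exterior_square_def by blast
    have "Vector_Spaces.linear sE (*) (q \<circ> g)"
      by (rule Vector_Spaces.linear_compose[OF g(1) q(1)])
    moreover have "h b = (q \<circ> g) b" if "b \<in> B" for b
      using g(2) h(2) c[OF that] that by (metis comp_apply)
    ultimately have "h (wedge v w) = (q \<circ> g) (wedge v w)"
      using EC.linear_eq_on[OF h(1), of "q \<circ> g" _ B] span by auto
    then have "q x = 0" using h(2) q.diff by (simp add: x_def)
    then show False using q(2) by simp
  qed
  show ?thesis
  proof (rule ex1I[of _ g])
    show "Vector_Spaces.linear sE sX g \<and> (\<forall>v w. g (wedge v w) = f v w)"
      using g(1) gf by blast
  next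
    fix g' assume g': "Vector_Spaces.linear sE sX g' \<and> (\<forall>v w. g' (wedge v w) = f v w)"
    have "g' b = g b" if "b \<in> B" for b
      using c[OF that] g' gf by metis
    then show "g' = g"
      using EX.linear_eq_on[of g' g _ B] g' g(1) span by auto
  qed
qed

definition grassmannian ::
  "(complex \<Rightarrow> 'e::ab_group_add \<Rightarrow> 'e) \<Rightarrow> nat \<Rightarrow> 'e set set" where
  "grassmannian s k =
     {module.span s B | B. \<not> module.dependent s B \<and> finite B \<and> card B = k}"

text \<open>The lines contained in the subspace \<open>U\<close>.\<close>

definition proj_space ::
  "(complex \<Rightarrow> 'e::ab_group_add \<Rightarrow> 'e) \<Rightarrow> 'e set \<Rightarrow> 'e set set" where
  "proj_space s U = {L \<in> grassmannian s 1. L \<subseteq> U}"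

text \<open>
  The image of \<open>G(2,V)\<close> under the Pluecker embedding: the plane spanned by \<open>v\<close> and \<open>w\<close> is sent to
  the line spanned by \<open>v \<and> w\<close>.
\<close>

definition pluecker_embedding ::
  "(complex \<Rightarrow> 'e::ab_group_add \<Rightarrow> 'e) \<Rightarrow> ('v \<Rightarrow> 'v \<Rightarrow> 'e) \<Rightarrow> 'v set \<Rightarrow> 'e set" where
  "pluecker_embedding sE wedge U = module.span sE {wedge v w | v w. v \<in> U \<and> w \<in> U}"

definition G2 ::
  "(complex \<Rightarrow> 'v::ab_group_add \<Rightarrow> 'v) \<Rightarrow> (complex \<Rightarrow> 'e::ab_group_add \<Rightarrow> 'e) \<Rightarrow>
    ('v \<Rightarrow> 'v \<Rightarrow> 'e) \<Rightarrow> 'e set set" where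
  "G2 sV sE wedge = pluecker_embedding sE wedge ` grassmannian sV 2"

text \<open>
  Points of a projective space (lines through the origin) are linearly independent if vectors
  representing them are. Distinct lines have distinct representatives \<open>r L\<close>, so nothing is lost in
  passing to the set \<open>r ` S\<close>.
\<close>

definition independent_points ::
  "(complex \<Rightarrow> 'e::ab_group_add \<Rightarrow> 'e) \<Rightarrow> 'e set set \<Rightarrow> bool" where
  "independent_points s S \<longleftrightarrow>
     (\<exists>r. (\<forall>L\<in>S. L = module.span s {r L}) \<and> \<not> module.dependent s (r ` S))"

definition U5 ::
  "(complex \<Rightarrow> 'v::ab_group_add \<Rightarrow> 'v) \<Rightarrow> (complex \<Rightarrow> 'e::ab_group_add \<Rightarrow> 'e) \<Rightarrow>
    ('v \<Rightarrow> 'v \<Rightarrow> 'e) \<Rightarrow> 'e set set" where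
  "U5 sV sE wedge =
     {W \<in> grassmannian sE 5.
        card (proj_space sE W \<inter> G2 sV sE wedge) = 5 \<and>
        independent_points sE (proj_space sE W \<inter> G2 sV sE wedge)}"

text \<open>
  The Zariski topology on \<open>G(k,E)\<close> is induced from its Pluecker embedding. A point is
  given by a basis \<open>w 0, \<dots>, w (k - 1)\<close> of the subspace (values of \<open>w\<close> beyond \<open>k\<close> are irrelevant).
  The linear forms on the \<open>k\<close>-th exterior power of \<open>E\<close> are the linear combinations of
  \<open>\<phi> 0 \<and> \<dots> \<and> \<phi> (k - 1)\<close> with \<open>\<phi> i\<close> linear forms on \<open>E\<close>, whose value at \<open>w 0 \<and> \<dots> \<and> w (k - 1)\<close> is
  the minor \<open>det (\<phi> i (w j))\<close>. Hence \<open>pluecker_form s k d F\<close> says that \<open>F\<close> is a homogeneous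
  polynomial of degree \<open>d\<close> in the Pluecker coordinates, written as a function of \<open>w\<close>.
\<close>

inductive pluecker_form ::
  "(complex \<Rightarrow> 'e::ab_group_add \<Rightarrow> 'e) \<Rightarrow> nat \<Rightarrow> nat \<Rightarrow> ((nat \<Rightarrow> 'e) \<Rightarrow> complex) \<Rightarrow> bool"
  for s k where
  const: "pluecker_form s k 0 (\<lambda>w. c)"
| coordinate: "(\<And>i. i < k \<Longrightarrow> Vector_Spaces.linear s (*) (\<phi> i)) \<Longrightarrow>
    pluecker_form s k 1 (\<lambda>w. det (mat k k (\<lambda>(i, j). \<phi> i (w j))))"
| add: "pluecker_form s k d F \<Longrightarrow> pluecker_form s k d G \<Longrightarrow> pluecker_form s k d (\<lambda>w. F w + G w)"
| mult: "pluecker_form s k d F \<Longrightarrow> pluecker_form s k e G \<Longrightarrow>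
    pluecker_form s k (d + e) (\<lambda>w. F w * G w)"

definition is_frame ::
  "(complex \<Rightarrow> 'e::ab_group_add \<Rightarrow> 'e) \<Rightarrow> nat \<Rightarrow> (nat \<Rightarrow> 'e) \<Rightarrow> 'e set \<Rightarrow> bool" where
  "is_frame s k w W \<longleftrightarrow>
     inj_on w {..<k} \<and> \<not> module.dependent s (w ` {..<k}) \<and> module.span s (w ` {..<k}) = W"

text \<open>
  A change of basis multiplies the value of a form of degree \<open>d\<close> by the \<open>d\<close>-th power of a nonzero
  determinant, so whether it vanishes depends only on the subspace \<open>W\<close>.
\<close>

definition zariski_closed ::
  "(complex \<Rightarrow> 'e::ab_group_add \<Rightarrow> 'e) \<Rightarrow> nat \<Rightarrow> 'e set set \<Rightarrow> bool" where
  "zariski_closed s k Z \<longleftrightarrow>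
     (\<exists>P. (\<forall>F\<in>P. \<exists>d. pluecker_form s k d F) \<and>
          Z = {W \<in> grassmannian s k. \<forall>F\<in>P. \<forall>w. is_frame s k w W \<longrightarrow> F w = 0})"

definition zariski_open ::
  "(complex \<Rightarrow> 'e::ab_group_add \<Rightarrow> 'e) \<Rightarrow> nat \<Rightarrow> 'e set set \<Rightarrow> bool" where
  "zariski_open s k Om \<longleftrightarrow>
     Om \<subseteq> grassmannian s k \<and> zariski_closed s k (grassmannian s k - Om)"

end

theory Submission
  imports Defs "HOL-Analysis.Analysis" "Subresultants.Subresultant_Gcd"
    "HOL-Computational_Algebra.Field_as_Ring" "HOL-Computational_Algebra.Fundamental_Theorem_Algebra"
    "Jordan_Normal_Form.Char_Poly"
begin

text \<open>
  Suppose that \<open>W\<^sub>4\<close> lies in the span \<open>W\<^sub>5\<close> of five decomposable bivectors \<open>\<omega> 0, \<dots>, \<omega> 4\<close>. Since \<open>\<omega> i \<and> \<omega> i = 0\<close>,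
  the products \<open>W\<^sub>4 \<and> W\<^sub>5\<close> lie in the span of the ten bivector products \<open>\<omega> i \<and> \<omega> l\<close>, \<open>i < l\<close>, and generically the ten
  products of two vectors of \<open>W\<^sub>4\<close> already form a basis of that span. Hence \<open>W\<^sub>5\<close> is contained in the
  stabilizer \<open>{\<eta>. \<eta> \<and> W\<^sub>4 \<subseteq> W\<^sub>4 \<and> W\<^sub>4}\<close>, which is generically of dimension five; this gives uniqueness.

  The stabilizer has a basis \<open>w 0, \<dots>, w 3, \<eta>\<close> with \<open>\<eta>\<close> a rational function of \<open>w\<close> (Cramer's rule), and
  its decomposable elements are the common eigenvectors of four matrices depending rationally on \<open>w\<close>.
  These matrices commute, because they do so whenever \<open>w\<close> is of the form
  \<open>w j = (\<Sum>i<5. u i j * \<omega> i)\<close> with decomposable \<open>\<omega> i\<close>, and such frames fill an open set: the differential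
  of this parametrization is surjective at an explicit base point. Commuting matrices,
  a linear combination of which has five distinct eigenvalues (a generic condition, checked at the
  base point), have exactly five common eigenlines.
\<close>

hide_const (open) Determinants.det Finite_Cartesian_Product.mat
no_notation Matrix.vec_index (infixl "$" 100)

section \<open>Polynomial and rational functions\<close>

text \<open>Five points of G(2, V_6) and a hyperplane in their span depend on 5 * 8 + 4 = 44
  parameters, and G(4, 15) has dimension 4 * 11 = 44. So finitely many solutions are to be expected,
  and the stabilizer shows that there is one. The obstacle is existence: that some suitable W_5
  contains W_4 is not visibly a polynomial condition on W_4, so it cannot be carried directly from
  the image of a parametrization to a Zariski open set. It is therefore split into identities
  between rational functions of a frame, which extend from the parametrized frames to all others,
  and the nonvanishing of one polynomial, which has to be tested at a single point only. The base
  bivectors are e0 \<and> e1, e2 \<and> e3, e4 \<and> e5, (e0 + e2 + e4) \<and> (e1 + e3 + e5) and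
  (e0 + e2 + e5) \<and> (e1 - e3 + e4). Three coordinate planes keep the equations short; the other
  two planes are general enough for the differential to be surjective, for the ten products to be
  independent and for the stabilizer to be no larger than W_5.\<close>

inductive polyfun :: "('x \<Rightarrow> complex) set \<Rightarrow> ('x \<Rightarrow> complex) \<Rightarrow> bool" for L where
  polyfun_const: "polyfun L (\<lambda>x. c)"
| polyfun_base: "l \<in> L \<Longrightarrow> polyfun L l"
| polyfun_add: "polyfun L f \<Longrightarrow> polyfun L g \<Longrightarrow> polyfun L (\<lambda>x. f x + g x)"
| polyfun_mult: "polyfun L f \<Longrightarrow> polyfun L g \<Longrightarrow> polyfun L (\<lambda>x. f x * g x)"

lemma polyfun_power: "polyfun L f \<Longrightarrow> polyfun L (\<lambda>x. f x ^ n)"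
  by (induction n) (auto intro: polyfun.intros)

text \<open>Functions of the form \<open>p / D ^ n\<close> on the set where \<open>D\<close> does not vanish.\<close>

definition rat :: "('x \<Rightarrow> complex) set \<Rightarrow> ('x \<Rightarrow> complex) \<Rightarrow> ('x \<Rightarrow> complex) \<Rightarrow> bool" where
  "rat L D f \<longleftrightarrow> (\<exists>n p. polyfun L p \<and> (\<forall>x. D x \<noteq> 0 \<longrightarrow> D x ^ n * f x = p x))"

lemma ratI: "polyfun L p \<Longrightarrow> (\<And>x. D x \<noteq> 0 \<Longrightarrow> D x ^ n * f x = p x) \<Longrightarrow> rat L D f"
  unfolding rat_def by blast

lemma rat_polyfun: "polyfun L f \<Longrightarrow> rat L D f"
  by (rule ratI[of _ f _ 0]) auto

lemma rat_const: "rat L D (\<lambda>x. c)"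
  by (intro rat_polyfun polyfun_const)

lemma rat_mult:
  assumes "rat L D f" "rat L D g" shows "rat L D (\<lambda>x. f x * g x)"
proof -
  obtain m p n q where "polyfun L p" "polyfun L q"
    "\<And>x. D x \<noteq> 0 \<Longrightarrow> D x ^ m * f x = p x" "\<And>x. D x \<noteq> 0 \<Longrightarrow> D x ^ n * g x = q x"
    using assms unfolding rat_def by metis
  then show ?thesis
    by (intro ratI[of L "\<lambda>x. p x * q x" _ "m + n"] polyfun_mult)
      (auto simp: power_add mult_ac)
qed

lemma rat_add:
  assumes D: "polyfun L D" and "rat L D f" "rat L D g" shows "rat L D (\<lambda>x. f x + g x)"
proof -
  obtain m p n q where "polyfun L p" "polyfun L q"
    "\<And>x. D x \<noteq> 0 \<Longrightarrow> D x ^ m * f x = p x" "\<And>x. D x \<noteq> 0 \<Longrightarrow> D x ^ n * g x = q x"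
    using assms unfolding rat_def by metis
  then show ?thesis
    by (intro ratI[of L "\<lambda>x. D x ^ n * p x + D x ^ m * q x" _ "m + n"] polyfun_mult polyfun_add
        polyfun_power D) (auto simp: power_add algebra_simps)
qed

lemma rat_uminus: "rat L D f \<Longrightarrow> rat L D (\<lambda>x. - f x)"
  using rat_mult[OF rat_const[of L D "-1"]] by simp

lemma rat_diff: "polyfun L D \<Longrightarrow> rat L D f \<Longrightarrow> rat L D g \<Longrightarrow> rat L D (\<lambda>x. f x - g x)"
  using rat_add[of L D f "\<lambda>x. - g x"] rat_uminus[of L D g] by simp

lemma rat_sum:
  assumes "polyfun L D" "\<And>i. i \<in> I \<Longrightarrow> rat L D (f i)"
  shows "rat L D (\<lambda>x. \<Sum>i\<in>I. f i x)"
  using assms(2)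
proof (induction I rule: infinite_finite_induct)
  case (insert i I)
  then show ?case using rat_add[OF assms(1), of "f i" "\<lambda>x. \<Sum>i\<in>I. f i x"] by simp
qed (auto intro: rat_const)

lemma rat_prod:
  assumes "\<And>i. i \<in> I \<Longrightarrow> rat L D (f i)"
  shows "rat L D (\<lambda>x. \<Prod>i\<in>I. f i x)"
  using assms
proof (induction I rule: infinite_finite_induct)
  case (insert i I)
  then show ?case using rat_mult[of L D "f i" "\<lambda>x. \<Prod>i\<in>I. f i x"] by simp
qed (auto intro: rat_const)

text \<open>Each further genericity condition multiplies the common denominator by a polynomial;
  functions built over the old denominator stay rational over the new one.\<close>

lemma rat_refine:
  assumes "polyfun L q" "rat L D f" "\<And>x. D' x = D x * q x" shows "rat L D' f"
proof -
  obtain n p where "polyfun L p" "\<And>x. D x \<noteq> 0 \<Longrightarrow> D x ^ n * f x = p x"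
    using assms(2) unfolding rat_def by metis
  then show ?thesis
    by (intro ratI[of L "\<lambda>x. q x ^ n * p x" _ n] polyfun_mult polyfun_power assms(1))
      (auto simp: power_mult_distrib assms(3) mult_ac)
qed

section \<open>Determinants and linear systems with rational coefficients\<close>

lemma rat_det:
  assumes D: "polyfun L D" and f: "\<And>i j. i < n \<Longrightarrow> j < n \<Longrightarrow> rat L D (\<lambda>x. f x i j)"
  shows "rat L D (\<lambda>x. Determinant.det (Matrix.mat n n (\<lambda>(i, j). f x i j)))"
proof -
  have "rat L D (\<lambda>x. \<Sum>p\<in>{p. p permutes {0..<n}}. signof p * (\<Prod>i = 0..<n. f x i (p i)))"
  proof (intro rat_sum D rat_mult rat_const rat_prod f)
    fix p i assume "p \<in> {p. p permutes {0..<n}}" and i: "i \<in> {0..<n}"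
    then show "p i < n" using permutes_in_image[of p "{0..<n}" i] by auto
    show "i < n" using i by simp
  qed
  also have "(\<lambda>x. \<Sum>p\<in>{p. p permutes {0..<n}}. signof p * (\<Prod>i = 0..<n. f x i (p i))) =
    (\<lambda>x. Determinant.det (Matrix.mat n n (\<lambda>(i, j). f x i j)))"
    by (intro ext) (auto simp: Determinant.det_def intro!: sum.cong prod.cong)
  finally show ?thesis .
qed

lemma rat_adj:
  assumes D: "polyfun L D" and f: "\<And>i j. i < n \<Longrightarrow> j < n \<Longrightarrow> rat L D (\<lambda>x. f x i j)"
    and ab: "a < n" "b < n"
  shows "rat L D (\<lambda>x. adj_mat (Matrix.mat n n (\<lambda>(i, j). f x i j)) $$ (a, b))"
proof -
  \<comment> \<open>The adjugate transposes, so its entry \<open>(a, b)\<close> is, up to sign, the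
    minor that skips row \<open>b\<close> and column \<open>a\<close>.\<close>
  define g where "g x i j = f x (if i < b then i else Suc i) (if j < a then j else Suc j)" for x i j
  have "rat L D (\<lambda>x. (-1) ^ (b + a) * Determinant.det (Matrix.mat (n - 1) (n - 1) (\<lambda>(i, j). g x i j)))"
    by (intro rat_mult rat_const rat_det D) (auto simp: g_def intro!: f)
  also have "(\<lambda>x. (-1) ^ (b + a) * Determinant.det (Matrix.mat (n - 1) (n - 1) (\<lambda>(i, j). g x i j))) =
    (\<lambda>x. adj_mat (Matrix.mat n n (\<lambda>(i, j). f x i j)) $$ (a, b))"
  proof
    fix x
    have "mat_delete (Matrix.mat n n (\<lambda>(i, j). f x i j)) b a =
        Matrix.mat (n - 1) (n - 1) (\<lambda>(i, j). g x i j)"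
      unfolding mat_delete_def by (intro eq_matI) (auto simp: g_def)
    then show "(-1) ^ (b + a) * Determinant.det (Matrix.mat (n - 1) (n - 1) (\<lambda>(i, j). g x i j)) =
      adj_mat (Matrix.mat n n (\<lambda>(i, j). f x i j)) $$ (a, b)"
      using ab by (simp add: adj_mat_def cofactor_def)
  qed
  finally show ?thesis .
qed

lemma adj_mat_sum:
  assumes "M \<in> carrier_mat n n" "a < n" "c < n"
  shows "(\<Sum>b<n. adj_mat M $$ (a, b) * M $$ (b, c)) = (if a = c then Determinant.det M else 0)"
    and "(\<Sum>b<n. M $$ (a, b) * adj_mat M $$ (b, c)) = (if a = c then Determinant.det M else 0)"
proof -
  note adj = adj_mat[OF assms(1)]
  have "(adj_mat M * M) $$ (a, c) = (if a = c then Determinant.det M else 0)"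
    using adj(3) assms by simp
  then show "(\<Sum>b<n. adj_mat M $$ (a, b) * M $$ (b, c)) = (if a = c then Determinant.det M else 0)"
    using assms adj(1) by (simp add: scalar_prod_def lessThan_atLeast0)
  have "(M * adj_mat M) $$ (a, c) = (if a = c then Determinant.det M else 0)"
    using adj(2) assms by simp
  then show "(\<Sum>b<n. M $$ (a, b) * adj_mat M $$ (b, c)) = (if a = c then Determinant.det M else 0)"
    using assms adj(1) by (simp add: scalar_prod_def lessThan_atLeast0)
qed

lemma det_nonzeroI:
  fixes f :: "nat \<Rightarrow> nat \<Rightarrow> complex"
  assumes "\<And>v. (\<And>i. i < n \<Longrightarrow> (\<Sum>j<n. f i j * v j) = 0) \<Longrightarrow> \<forall>j<n. v j = 0"
  shows "Determinant.det (Matrix.mat n n (\<lambda>(i, j). f i j)) \<noteq> 0"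
proof
  let ?M = "Matrix.mat n n (\<lambda>(i, j). f i j)"
  assume "Determinant.det ?M = 0"
  then obtain v where v: "v \<in> carrier_vec n" "v \<noteq> 0\<^sub>v n" "?M *\<^sub>v v = 0\<^sub>v n"
    using det_0_iff_vec_prod_zero[of ?M n] by auto
  have "(\<Sum>j<n. f i j * vec_index v j) = 0" if "i < n" for i
  proof -
    have "vec_index (?M *\<^sub>v v) i = 0" using v(3) that by simp
    then show ?thesis using that v(1) by (simp add: scalar_prod_def lessThan_atLeast0)
  qed
  with assms[of "vec_index v"] have "\<forall>j<n. vec_index v j = 0" by simp
  with v(1) have "v = 0\<^sub>v n" by (intro eq_vecI) auto
  with v(2) show False by simp
qed

text \<open>Injectivity makes the determinant nonzero, and the inverse is the adjugate divided by
  it. The index sets are arbitrary because some of the matrices to be inverted are indexed by pairs;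
  \<open>h\<close> and \<open>k\<close> enumerate rows and columns.\<close>

lemma square_inverse:
  fixes C :: "'i \<Rightarrow> 'j \<Rightarrow> complex"
  assumes fin: "finite I" "finite J" "card I = card J"
    and inj: "\<forall>c. (\<forall>i\<in>I. (\<Sum>j\<in>J. C i j * c j) = 0) \<longrightarrow> (\<forall>j\<in>J. c j = 0)"
  shows "\<exists>B. (\<forall>i\<in>I. \<forall>i'\<in>I. (\<Sum>j\<in>J. C i j * B j i') = (if i = i' then 1 else 0)) \<and>
    (\<forall>j\<in>J. \<forall>j'\<in>J. (\<Sum>i\<in>I. B j i * C i j') = (if j = j' then 1 else 0))"
proof -
  define n where "n = card I"
  obtain h where h: "bij_betw h {..<n} I"
    using ex_bij_betw_nat_finite[OF fin(1)] n_def by (metis lessThan_atLeast0)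
  obtain k where k: "bij_betw k {..<n} J"
    using ex_bij_betw_nat_finite[OF fin(2)] n_def fin(3) by (metis lessThan_atLeast0)
  define h' where "h' = the_inv_into {..<n} h"
  define k' where "k' = the_inv_into {..<n} k"
  have h': "h' i < n" "h (h' i) = i" if "i \<in> I" for i
    using that h unfolding h'_def bij_betw_def
    by (metis the_inv_into_into lessThan_iff order_refl, metis f_the_inv_into_f)
  have k': "k' i < n" "k (k' i) = i" if "i \<in> J" for i
    using that k unfolding k'_def bij_betw_def
    by (metis the_inv_into_into lessThan_iff order_refl, metis f_the_inv_into_f)
  have k'k: "k' (k b) = b" if "b < n" for b
    using that k unfolding k'_def bij_betw_def by (simp add: the_inv_into_f_f)
  have h'h: "h' (h b) = b" if "b < n" for b
    using that h unfolding h'_def bij_betw_def by (simp add: the_inv_into_f_f)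
  define M where "M = Matrix.mat n n (\<lambda>(a, b). C (h a) (k b))"
  have M: "M \<in> carrier_mat n n" by (simp add: M_def)
  have det: "Determinant.det M \<noteq> 0"
    unfolding M_def
  proof (rule det_nonzeroI)
    fix v assume v: "\<And>i. i < n \<Longrightarrow> (\<Sum>j<n. C (h i) (k j) * v j) = 0"
    have "(\<Sum>j\<in>J. C i j * v (k' j)) = 0" if "i \<in> I" for i
      using v[OF h'(1)[OF that]] h'(2)[OF that]
      by (subst sum.reindex_bij_betw[OF k, symmetric]) (simp add: k'k)
    then have "\<forall>i\<in>I. (\<Sum>j\<in>J. C i j * v (k' j)) = 0" by (rule ballI)
    with inj[THEN spec[of _ "\<lambda>j. v (k' j)"]] have "\<forall>j\<in>J. v (k' j) = 0" by (rule mp)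
    then show "\<forall>j<n. v j = 0" using k k'k by (metis bij_betwE lessThan_iff)
  qed
  define B where "B j i = adj_mat M $$ (k' j, h' i) / Determinant.det M" for j i
  show ?thesis
  proof (intro exI[of _ B] conjI ballI)
    fix i i' assume i: "i \<in> I" "i' \<in> I"
    have "(\<Sum>j\<in>J. C i j * B j i') = (\<Sum>b<n. M $$ (h' i, b) * adj_mat M $$ (b, h' i')) / Determinant.det M"
      using i h' by (subst sum.reindex_bij_betw[OF k, symmetric]) (simp add: k'k B_def M_def sum_divide_distrib)
    also have "\<dots> = (if i = i' then 1 else 0)"
      using adj_mat_sum(2)[OF M, of "h' i" "h' i'"] i h' det by (auto, metis)
    finally show "(\<Sum>j\<in>J. C i j * B j i') = (if i = i' then 1 else 0)" .
  next
    fix i i' assume i: "i \<in> J" "i' \<in> J"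
    have "(\<Sum>j\<in>I. B i j * C j i') = (\<Sum>b<n. adj_mat M $$ (k' i, b) * M $$ (b, k' i')) / Determinant.det M"
      using i k' by (subst sum.reindex_bij_betw[OF h, symmetric]) (simp add: h'h B_def M_def sum_divide_distrib)
    also have "\<dots> = (if i = i' then 1 else 0)"
      using adj_mat_sum(1)[OF M, of "k' i" "k' i'"] i k' det by (auto, metis)
    finally show "(\<Sum>j\<in>I. B i j * C j i') = (if i = i' then 1 else 0)" .
  qed
qed

text \<open>Cramer's rule for systems that may have more equations than unknowns. Conjugation is
  applied to \<open>A\<close> at the fixed point \<open>x0\<close> only, so the square system
  derived from it still has entries rational in \<open>x\<close>. Solvability is not asserted:
  \<open>z\<close> is a candidate that agrees with every solution that exists. One factor
  \<open>q\<close> serves all right-hand sides \<open>b\<close>.\<close>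

lemma rat_solve:
  fixes A :: "'i \<Rightarrow> 'j \<Rightarrow> 'x \<Rightarrow> complex"
  assumes fin: "finite I" "finite J" and D: "polyfun L D" "D x0 \<noteq> 0"
    and A: "\<And>i j. i \<in> I \<Longrightarrow> j \<in> J \<Longrightarrow> rat L D (A i j)"
    and inj: "\<forall>c. (\<forall>i\<in>I. (\<Sum>j\<in>J. A i j x0 * c j) = 0) \<longrightarrow> (\<forall>j\<in>J. c j = 0)"
  shows "\<exists>q. polyfun L q \<and> q x0 \<noteq> 0 \<and>
    (\<forall>x c. D x * q x \<noteq> 0 \<longrightarrow> (\<forall>i\<in>I. (\<Sum>j\<in>J. A i j x * c j) = 0) \<longrightarrow> (\<forall>j\<in>J. c j = 0)) \<and>
    (\<forall>b. (\<forall>i\<in>I. rat L D (b i)) \<longrightarrow> (\<exists>z. (\<forall>j\<in>J. rat L (\<lambda>x. D x * q x) (z j)) \<and>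
       (\<forall>x y. D x * q x \<noteq> 0 \<longrightarrow> (\<forall>i\<in>I. (\<Sum>j\<in>J. A i j x * y j) = b i x) \<longrightarrow> (\<forall>j\<in>J. y j = z j x))))"
proof -
  define n where "n = card J"
  obtain k where k: "bij_betw k {..<n} J"
    using ex_bij_betw_nat_finite[OF fin(2)] n_def by (metis lessThan_atLeast0)
  define k' where "k' = the_inv_into {..<n} k"
  have k': "k' i < n" "k (k' i) = i" if "i \<in> J" for i
    using that k unfolding k'_def bij_betw_def
    by (metis the_inv_into_into lessThan_iff order_refl, metis f_the_inv_into_f)
  have k'k: "k' (k b) = b" if "b < n" for b
    using that k unfolding k'_def bij_betw_def by (simp add: the_inv_into_f_f)
  have kJ: "k b \<in> J" if "b < n" for b using that k by (auto simp: bij_betw_def)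
  \<comment> \<open>The Gram matrix of \<open>A\<close> at \<open>x0\<close> with \<open>A\<close> at \<open>x\<close> is square, and positive definite at \<open>x = x0\<close>.\<close>
  define f where "f x a b = (\<Sum>i\<in>I. cnj (A i (k a) x0) * A i (k b) x)" for x a b
  define M where "M x = Matrix.mat n n (\<lambda>(a, b). f x a b)" for x
  define d where "d x = Determinant.det (M x)" for x
  have M: "M x \<in> carrier_mat n n" for x by (simp add: M_def)
  have Mab: "M x $$ (a, b) = f x a b" if "a < n" "b < n" for x a b
    using that by (simp add: M_def)
  have rf: "rat L D (\<lambda>x. f x a b)" if "a < n" "b < n" for a b
    unfolding f_def using that by (intro rat_sum D rat_mult rat_const A kJ)
  have rd: "rat L D d" unfolding d_def M_def by (intro rat_det D rf)
  then obtain m p where p: "polyfun L p" "\<And>x. D x \<noteq> 0 \<Longrightarrow> D x ^ m * d x = p x"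
    unfolding rat_def by metis
  have Mv: "(\<Sum>b<n. f x a b * c (k b)) = (\<Sum>i\<in>I. cnj (A i (k a) x0) * (\<Sum>j\<in>J. A i j x * c j))"
    for x a and c :: "'j \<Rightarrow> complex"
  proof -
    have "(\<Sum>b<n. f x a b * c (k b)) = (\<Sum>b<n. \<Sum>i\<in>I. cnj (A i (k a) x0) * (A i (k b) x * c (k b)))"
      by (simp add: f_def sum_distrib_right mult.assoc)
    also have "\<dots> = (\<Sum>i\<in>I. \<Sum>b<n. cnj (A i (k a) x0) * (A i (k b) x * c (k b)))"
      by (rule sum.swap)
    also have "\<dots> = (\<Sum>i\<in>I. cnj (A i (k a) x0) * (\<Sum>b<n. A i (k b) x * c (k b)))"
      by (simp add: sum_distrib_left)
    also have "\<dots> = (\<Sum>i\<in>I. cnj (A i (k a) x0) * (\<Sum>j\<in>J. A i j x * c j))"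
      by (subst sum.reindex_bij_betw[OF k, symmetric]) simp
    finally show ?thesis .
  qed
  have "d x0 \<noteq> 0"
    unfolding d_def M_def
  proof (rule det_nonzeroI)
    fix v assume v: "\<And>i. i < n \<Longrightarrow> (\<Sum>j<n. f x0 i j * v j) = 0"
    define c where "c j = v (k' j)" for j
    define y where "y i = (\<Sum>j\<in>J. A i j x0 * c j)" for i
    have cy: "cnj (y i) = (\<Sum>j\<in>J. cnj (c j) * cnj (A i j x0))" for i
      by (simp add: y_def mult.commute)
    \<comment> \<open>Pairing \<open>c\<close> with the Gram matrix applied to \<open>c\<close>
      gives the squared norm of \<open>y\<close>, the image of \<open>c\<close> under
      \<open>A\<close> at \<open>x0\<close>.\<close>
    have "(\<Sum>i\<in>I. cnj (y i) * y i) = (\<Sum>i\<in>I. \<Sum>j\<in>J. cnj (c j) * (cnj (A i j x0) * y i))"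
      by (simp only: cy sum_distrib_right mult.assoc)
    also have "\<dots> = (\<Sum>j\<in>J. cnj (c j) * (\<Sum>i\<in>I. cnj (A i j x0) * y i))"
      by (subst sum.swap) (simp add: sum_distrib_left)
    also have "\<dots> = (\<Sum>a<n. cnj (c (k a)) * (\<Sum>b<n. f x0 a b * c (k b)))"
      by (subst sum.reindex_bij_betw[OF k, symmetric]) (simp add: Mv y_def)
    also have "\<dots> = 0"
      using v by (intro sum.neutral) (auto simp: c_def k'k)
    finally have "complex_of_real (\<Sum>i\<in>I. (cmod (y i))\<^sup>2) = 0"
      by (simp only: of_real_sum complex_norm_square mult.commute)
    then have "(\<Sum>i\<in>I. (cmod (y i))\<^sup>2) = 0" using of_real_eq_0_iff by blast
    then have "y i = 0" if "i \<in> I" for i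
      using that fin(1) by (simp add: sum_nonneg_eq_0_iff)
    then have "\<forall>i\<in>I. (\<Sum>j\<in>J. A i j x0 * c j) = 0" unfolding y_def by blast
    with inj[THEN spec[of _ c]] have "\<forall>j\<in>J. c j = 0" by (rule mp)
    then show "\<forall>j<n. v j = 0" using kJ k'k unfolding c_def by metis
  qed
  then have "p x0 \<noteq> 0" using p(2)[OF D(2)] D(2) by force
  have dn: "d x \<noteq> 0" if "D x * p x \<noteq> 0" for x using p(2)[of x] that by auto
  have rp: "rat L (\<lambda>x. D x * p x) g" if "rat L D g" for g
    by (rule rat_refine[OF p(1) that]) simp
  have D': "polyfun L (\<lambda>x. D x * p x)" by (intro polyfun_mult D p)
  have rinv: "rat L (\<lambda>x. D x * p x) (\<lambda>x. 1 / d x)"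
  \<comment> \<open>Because \<open>p\<close> is \<open>D ^ m * d\<close>, one factor
    \<open>D * p\<close> clears the denominator \<open>d\<close> and leaves
    \<open>D ^ (m + 1)\<close>.\<close>
  proof (rule ratI[of L "\<lambda>x. D x ^ (m + 1)" _ 1])
    show "polyfun L (\<lambda>x. D x ^ (m + 1))" by (intro polyfun_power D)
    fix x assume *: "D x * p x \<noteq> 0"
    then show "(D x * p x) ^ 1 * (1 / d x) = D x ^ (m + 1)"
      using p(2)[of x] dn[OF *] by (simp add: field_simps)
  qed
  define z where "z b j x = (\<Sum>a<n. adj_mat (M x) $$ (k' j, a) * (\<Sum>i\<in>I. cnj (A i (k a) x0) * b i x)) * (1 / d x)"
    for b :: "'i \<Rightarrow> 'x \<Rightarrow> complex" and j x
  have rz: "rat L (\<lambda>x. D x * p x) (z b j)" if "\<And>i. i \<in> I \<Longrightarrow> rat L D (b i)" "j \<in> J" for b j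
    unfolding z_def
  proof (intro rat_mult rat_sum D' rinv rat_const)
    fix a assume "a \<in> {..<n}"
    then show "rat L (\<lambda>x. D x * p x) (\<lambda>x. adj_mat (M x) $$ (k' j, a))"
      unfolding M_def using k'[OF that(2)] by (intro rp rat_adj D rf) auto
  qed (intro rp that(1))
  have z: "c j = z b j x" if "D x * p x \<noteq> 0" "\<And>i. i \<in> I \<Longrightarrow> (\<Sum>j\<in>J. A i j x * c j) = b i x" "j \<in> J" for b c x j
  proof -
    have "z b j x * d x = (\<Sum>a<n. adj_mat (M x) $$ (k' j, a) * (\<Sum>i\<in>I. cnj (A i (k a) x0) * (\<Sum>j\<in>J. A i j x * c j)))"
      using dn[OF that(1)] that(2) by (simp add: z_def)
    also have "\<dots> = (\<Sum>a<n. \<Sum>b<n. adj_mat (M x) $$ (k' j, a) * f x a b * c (k b))"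
      unfolding Mv[symmetric] by (simp only: sum_distrib_left mult.assoc)
    also have "\<dots> = (\<Sum>b<n. (\<Sum>a<n. adj_mat (M x) $$ (k' j, a) * M x $$ (a, b)) * c (k b))"
      by (subst sum.swap) (simp add: sum_distrib_right Mab)
    also have "\<dots> = (\<Sum>b<n. if k' j = b then d x * c (k b) else 0)"
      using adj_mat_sum(1)[OF M] k'(1)[OF that(3)]
      by (intro sum.cong) (auto simp: d_def)
    also have "\<dots> = d x * c j" using k'[OF that(3)] by simp
    finally show ?thesis using dn[OF that(1)] by simp
  qed
  show ?thesis
  proof (intro exI[of _ p] conjI allI impI)
    fix x c assume *: "D x * p x \<noteq> 0" "\<forall>i\<in>I. (\<Sum>j\<in>J. A i j x * c j) = 0"
    have "c j = z (\<lambda>_ _. 0) j x" if "j \<in> J" for j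
      by (rule z[OF *(1) _ that]) (use *(2) in blast)
    then show "\<forall>j\<in>J. c j = 0" by (simp add: z_def)
  next
    fix b :: "'i \<Rightarrow> 'x \<Rightarrow> complex" assume b: "\<forall>i\<in>I. rat L D (b i)"
    have "y j = z b j x" if "D x * p x \<noteq> 0" "\<forall>i\<in>I. (\<Sum>j\<in>J. A i j x * y j) = b i x" "j \<in> J" for x y j
      by (rule z[OF that(1) _ that(3)]) (use that(2) in blast)
    moreover have "rat L (\<lambda>x. D x * p x) (z b j)" if "j \<in> J" for j
      by (rule rz[OF _ that]) (use b in blast)
    ultimately show "\<exists>z. (\<forall>j\<in>J. rat L (\<lambda>x. D x * p x) (z j)) \<and>
       (\<forall>x y. D x * p x \<noteq> 0 \<longrightarrow> (\<forall>i\<in>I. (\<Sum>j\<in>J. A i j x * y j) = b i x) \<longrightarrow> (\<forall>j\<in>J. y j = z j x))"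
      by (intro exI[of _ "z b"]) simp
  qed (use p \<open>p x0 \<noteq> 0\<close> in auto)
qed

section \<open>The secant map\<close>

lemma has_derivative_vec_lambda:
  fixes F :: "'n::finite \<Rightarrow> 'a::real_normed_vector \<Rightarrow> 'b::euclidean_space"
  assumes "\<And>r. (F r has_derivative F' r) (at x)"
  shows "((\<lambda>x. \<chi> r. F r x) has_derivative (\<lambda>h. \<chi> r. F' r h)) (at x)"
proof -
  have ax: "bounded_linear (axis r :: 'b \<Rightarrow> 'b ^ 'n)" for r
    by (intro linear_conv_bounded_linear[THEN iffD1] linearI) (auto simp: axis_def vec_eq_iff)
  have eq: "(\<chi> r. g r) = (\<Sum>r\<in>UNIV. axis r (g r))" for g :: "'n \<Rightarrow> 'b"
    by (simp add: vec_eq_iff axis_def if_distrib cong: if_cong)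
  show ?thesis unfolding eq
    by (intro has_derivative_sum bounded_linear.has_derivative[OF ax] assms)
qed

section \<open>Polynomial functions that vanish on a ball\<close>

lemma polyfun_on_line:
  fixes p :: "'a::real_vector \<Rightarrow> complex"
  assumes "polyfun L p" "\<And>l x v. l \<in> L \<Longrightarrow> \<exists>c. \<forall>t. l (x + t *\<^sub>R v) = l x + of_real t * c"
  shows "\<exists>q. \<forall>t. p (x + t *\<^sub>R v) = poly q (of_real t)"
  using assms(1)
proof induction
  case (polyfun_const c)
  show ?case by (rule exI[of _ "[:c:]"]) simp
next
  case (polyfun_base l)
  then obtain c where "\<forall>t. l (x + t *\<^sub>R v) = l x + of_real t * c" using assms(2) by blast
  then show ?case by (intro exI[of _ "[:l x, c:]"]) simp
next
  case (polyfun_add f g)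
  then obtain q r where "\<forall>t. f (x + t *\<^sub>R v) = poly q (of_real t)" "\<forall>t. g (x + t *\<^sub>R v) = poly r (of_real t)"
    by blast
  then show ?case by (intro exI[of _ "q + r"]) simp
next
  case (polyfun_mult f g)
  then obtain q r where "\<forall>t. f (x + t *\<^sub>R v) = poly q (of_real t)" "\<forall>t. g (x + t *\<^sub>R v) = poly r (of_real t)"
    by blast
  then show ?case by (intro exI[of _ "q * r"]) simp
qed

text \<open>On the real line through \<open>x\<close> and \<open>y\<close> the function is a
  polynomial in one variable that vanishes at infinitely many real parameters.\<close>

lemma polyfun_zero_if_zero_on_ball:
  fixes p :: "'a::real_normed_vector \<Rightarrow> complex"
  assumes p: "polyfun L p" and L: "\<And>l x v. l \<in> L \<Longrightarrow> \<exists>c. \<forall>t. l (x + t *\<^sub>R v) = l x + of_real t * c"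
    and e: "e > 0" "\<And>y. y \<in> ball x e \<Longrightarrow> p y = 0"
  shows "p y = 0"
proof -
  obtain q where q: "\<And>t. p (x + t *\<^sub>R (y - x)) = poly q (of_real t)"
    using polyfun_on_line[OF p L, where v = "y - x"] by blast
  \<comment> \<open>For \<open>0 < t < d\<close> the point \<open>x + t (y - x)\<close> stays in the
    ball; the summand \<open>1\<close> covers the case \<open>y = x\<close>.\<close>
  define d where "d = e / (norm (y - x) + 1)"
  have n0: "norm (y - x) + 1 > 0" by (simp add: add_nonneg_pos)
  have d: "d > 0" using e(1) n0 by (simp add: d_def)
  have "poly q (of_real t) = 0" if "t \<in> {0<..<d}" for t
  proof -
    have "norm (t *\<^sub>R (y - x)) = t * norm (y - x)" using that by simp
    also have "\<dots> \<le> t * (norm (y - x) + 1)" using that by simp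
    also have "\<dots> < d * (norm (y - x) + 1)" using that n0 by simp
    also have "\<dots> = e" using n0 unfolding d_def by simp
    finally show ?thesis using e(2)[of "x + t *\<^sub>R (y - x)"] q[of t] by (simp add: dist_norm)
  qed
  then have "complex_of_real ` {0<..<d} \<subseteq> {z. poly q z = 0}" by auto
  moreover have "infinite (complex_of_real ` {0<..<d})"
    using d by (subst finite_image_iff) (auto simp: inj_on_def)
  ultimately have "q = 0" using poly_roots_finite finite_subset by blast
  then show ?thesis using q[of 1] by simp
qed

text \<open>Coefficients, two lists of factors of five bivectors, and a correction term. Bivectors
  are represented by arbitrary 6 by 6 matrices, so that the target is a full euclidean space, in
  which a surjective derivative gives an image with interior.\<close>

type_synonym params = "(complex ^ 4 ^ 5) \<times> (complex ^ 6 ^ 5) \<times> (complex ^ 6 ^ 5) \<times> (complex ^ 6 ^ 6 ^ 4)"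

text \<open>\<open>A $ i \<otimes> B $ i\<close> represents a decomposable bivector modulo symmetric matrices, which are supplied by \<open>N\<close>.\<close>

definition secant_map :: "params \<Rightarrow> complex ^ 6 ^ 6 ^ 4" where
  "secant_map = (\<lambda>(u, A, B, N). \<chi> j a b. (\<Sum>i\<in>UNIV. u $ i $ j * A $ i $ a * B $ i $ b) + N $ j $ a $ b + N $ j $ b $ a)"

definition secant_deriv :: "params \<Rightarrow> params \<Rightarrow> complex ^ 6 ^ 6 ^ 4" where
  "secant_deriv = (\<lambda>(u, A, B, N) (u', A', B', N'). \<chi> j a b.
     (\<Sum>i\<in>UNIV. u $ i $ j * A $ i $ a * B' $ i $ b + (u $ i $ j * A' $ i $ a + u' $ i $ j * A $ i $ a) * B $ i $ b)
       + N' $ j $ a $ b + N' $ j $ b $ a)"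

lemma bounded_linear_nth2: "bounded_linear f \<Longrightarrow> bounded_linear (\<lambda>x. f x $ i)"
  using bounded_linear_compose[OF bounded_linear_vec_nth] by blast

lemma secant_map_has_derivative: "(secant_map has_derivative secant_deriv x) (at x)"
proof -
  have lin: "(f has_derivative f) (at x)" if "bounded_linear f" for f :: "params \<Rightarrow> complex"
    using that by (rule bounded_linear_imp_has_derivative)
  have u: "bounded_linear (\<lambda>x::params. fst x $ i $ j)" for i j
    by (intro bounded_linear_nth2 bounded_linear_fst)
  have A: "bounded_linear (\<lambda>x::params. fst (snd x) $ i $ j)" for i j
    by (intro bounded_linear_nth2 bounded_linear_compose[OF bounded_linear_fst] bounded_linear_snd)
  have B: "bounded_linear (\<lambda>x::params. fst (snd (snd x)) $ i $ j)" for i j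
    by (intro bounded_linear_nth2 bounded_linear_compose[OF bounded_linear_fst]
       bounded_linear_compose[OF bounded_linear_snd] bounded_linear_snd)
  have N: "bounded_linear (\<lambda>x::params. snd (snd (snd x)) $ i $ j $ k)" for i j k
    by (intro bounded_linear_nth2 
       bounded_linear_compose[OF bounded_linear_snd] bounded_linear_snd)
  have "((\<lambda>x. \<chi> j a b. (\<Sum>i\<in>UNIV. fst x $ i $ j * fst (snd x) $ i $ a * fst (snd (snd x)) $ i $ b) 
      + snd (snd (snd x)) $ j $ a $ b + snd (snd (snd x)) $ j $ b $ a) has_derivative
    (\<lambda>h. \<chi> j a b. (\<Sum>i\<in>UNIV. fst x $ i $ j * fst (snd x) $ i $ a * fst (snd (snd h)) $ i $ b
       + (fst x $ i $ j * fst (snd h) $ i $ a + fst h $ i $ j * fst (snd x) $ i $ a) * fst (snd (snd x)) $ i $ b)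
      + snd (snd (snd h)) $ j $ a $ b + snd (snd (snd h)) $ j $ b $ a)) (at x)"
    by (intro has_derivative_vec_lambda has_derivative_add has_derivative_sum has_derivative_mult lin u A B N)
  then show ?thesis by (simp add: secant_map_def secant_deriv_def case_prod_unfold)
qed

section \<open>Covectors orthogonal to the image of the derivative\<close>

lemma linear_surj_if_annihilator_zero:
  fixes f :: "'a::real_vector \<Rightarrow> 'b::euclidean_space"
  assumes "linear f" "\<And>\<theta>. (\<And>x. \<theta> \<bullet> f x = 0) \<Longrightarrow> \<theta> = 0"
  shows "surj f"
proof (rule ccontr)
  assume "\<not> surj f"
  moreover have "span (range f) = range f"
    using assms(1) by (simp add: linear_subspace_image span_eq_iff)
  ultimately have "span (range f) \<noteq> UNIV" by metis
  then obtain \<theta> where "\<theta> \<noteq> 0" "span (range f) \<subseteq> {x. \<theta> \<bullet> x = 0}"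
    using span_not_univ_subset_hyperplane by blast
  moreover have "range f \<subseteq> span (range f)" by (rule span_superset)
  ultimately have "\<theta> \<bullet> f x = 0" "\<theta> \<noteq> 0" for x by auto
  with assms(2)[of \<theta>] show False by auto
qed

lemma inner3: "(\<theta> :: complex ^ 'a::finite ^ 'b::finite ^ 'c::finite) \<bullet> y = Re (\<Sum>j\<in>UNIV. \<Sum>a\<in>UNIV. \<Sum>b\<in>UNIV. cnj (\<theta> $ j $ a $ b) * y $ j $ a $ b)"
  by (simp add: inner_vec_def inner_complex_def)

text \<open>The inner product in use is real and sees real parts only. Perturbations may be scaled
  by any complex \<open>c\<close>, and the values 1 and i recover the complex equation.\<close>

lemma Re_zero_all: "(\<And>c. Re (c * z) = 0) \<Longrightarrow> z = (0::complex)"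
  by (metis complex_eq_iff mult.left_neutral Re_i_times zero_complex.sel neg_equal_0_iff_equal)

text \<open>The derivative is tested on one coordinate of \<open>N\<close>, \<open>u\<close>,
  \<open>A\<close> and \<open>B\<close> in turn. In terms of the bilinear forms \<open>T j\<close>:
  each is alternating, each pairs \<open>A $ i\<close> with \<open>B $ i\<close> to zero, and their
  combination with coefficients \<open>u $ i $ j\<close> has \<open>A $ i\<close> and
  \<open>B $ i\<close> in its radical.\<close>

lemma secant_annihilator:
  fixes \<theta> :: "complex ^ 6 ^ 6 ^ 4"
  assumes th: "\<And>h. \<theta> \<bullet> secant_deriv (u, A, B, N) h = 0"
  defines "T \<equiv> \<lambda>j a b. cnj (\<theta> $ j $ a $ b)"
  shows "T j a b + T j b a = 0"
    and "(\<Sum>a\<in>UNIV. \<Sum>b\<in>UNIV. T j a b * A $ i $ a * B $ i $ b) = 0"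
    and "(\<Sum>j\<in>UNIV. u $ i $ j * (\<Sum>b\<in>UNIV. T j a b * B $ i $ b)) = 0"
    and "(\<Sum>j\<in>UNIV. u $ i $ j * (\<Sum>a\<in>UNIV. T j a b * A $ i $ a)) = 0"
proof -
  have *: "Re (\<Sum>j\<in>UNIV. \<Sum>a\<in>UNIV. \<Sum>b\<in>UNIV. T j a b * secant_deriv (u, A, B, N) h $ j $ a $ b) = 0" for h
    using th[of h] by (simp add: inner3 T_def)
  have d: "(if i' = i then f else 0) * g = (if i' = i then f * g else 0)"
    "g * (if i' = i then f else 0) = (if i' = i then g * f else 0)" for i' i :: 'x and f g :: complex
    by auto
  have s: "(\<Sum>x\<in>S. if P then f x else 0) = (if P then sum f S else 0)" for P and S :: "'x set" and f :: "'x \<Rightarrow> complex"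
    by auto
  show "(\<Sum>a\<in>UNIV. \<Sum>b\<in>UNIV. T j a b * A $ i $ a * B $ i $ b) = 0"
  proof (rule Re_zero_all)
    fix c
    show "Re (c * (\<Sum>a\<in>UNIV. \<Sum>b\<in>UNIV. T j a b * A $ i $ a * B $ i $ b)) = 0"
      using *[of "(\<chi> i' j'. if i' = i then if j' = j then c else 0 else 0, 0, 0, 0)"]
      by (simp add: secant_deriv_def d s sum_distrib_left mult_ac)
  qed
  show "(\<Sum>j\<in>UNIV. u $ i $ j * (\<Sum>b\<in>UNIV. T j a b * B $ i $ b)) = 0"
  proof (rule Re_zero_all)
    fix c
    show "Re (c * (\<Sum>j\<in>UNIV. u $ i $ j * (\<Sum>b\<in>UNIV. T j a b * B $ i $ b))) = 0"
      using *[of "(0, \<chi> i' a'. if i' = i then if a' = a then c else 0 else 0, 0, 0)"]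
      by (simp add: secant_deriv_def d s sum_distrib_left mult_ac)
  qed
  show "(\<Sum>j\<in>UNIV. u $ i $ j * (\<Sum>a\<in>UNIV. T j a b * A $ i $ a)) = 0"
  proof (rule Re_zero_all)
    fix c
    show "Re (c * (\<Sum>j\<in>UNIV. u $ i $ j * (\<Sum>a\<in>UNIV. T j a b * A $ i $ a))) = 0"
      using *[of "(0, 0, \<chi> i' a'. if i' = i then if a' = b then c else 0 else 0, 0)"]
      by (simp add: secant_deriv_def d s sum_distrib_left mult_ac)
  qed
  show "T j a b + T j b a = 0"
  proof (rule Re_zero_all)
    fix c
    show "Re (c * (T j a b + T j b a)) = 0"
      using *[of "(0, 0, 0, \<chi> j' a' b'. if j' = j then if a' = a then if b' = b then c else 0 else 0 else 0)"]
      by (simp add: secant_deriv_def d s distrib_left sum.distrib mult_ac)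
  qed
qed

section \<open>Eigenvalues of polynomial matrices\<close>

text \<open>Multiplicities are at least one and add up to at most the degree, so as many roots as
  the degree leave multiplicity one for each.\<close>

lemma card_roots_eq_degree_iff:
  fixes p :: "complex poly"
  assumes "p \<noteq> 0"
  shows "card {z. poly p z = 0} = degree p \<longleftrightarrow> rsquarefree p"
proof
  assume card: "card {z. poly p z = 0} = degree p"
  have fin: "finite {z. poly p z = 0}" using assms by (rule poly_roots_finite)
  have ge: "order z p \<ge> 1" if "poly p z = 0" for z
    using that assms by (simp add: order_root Suc_le_eq)
  have "order z p = 1" if z: "poly p z = 0" for z
  proof (rule ccontr)
    assume "order z p \<noteq> 1"
    then have "1 < order z p" using ge[OF z] by simp
    then have "(\<Sum>z | poly p z = 0. 1) < (\<Sum>z | poly p z = 0. order z p)"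
      using fin ge z by (intro sum_strict_mono_ex1) auto
    then show False using sum_order_le_degree[OF assms] card by simp
  qed
  then show "rsquarefree p" using assms unfolding rsquarefree_def by (metis order_root)
next
  assume "rsquarefree p"
  then have "smult (lead_coeff p) (\<Prod>z | poly p z = 0. [:- z, 1:]) = p"
    by (rule complex_poly_decompose_rsquarefree)
  then have "degree p = degree (\<Prod>z | poly p z = 0. [:- z, 1:])"
    using assms by (metis degree_smult_eq leading_coeff_0_iff)
  also have "\<dots> = card {z. poly p z = 0}" by (subst degree_prod_sum_eq) auto
  finally show "card {z. poly p z = 0} = degree p" by simp
qed

text \<open>A nonzero resultant means a constant gcd; over the complex numbers this is the absence
  of a common root of \<open>p\<close> and its derivative, that is, of a multiple root.\<close>

lemma resultant_pderiv_nonzero_iff: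
  fixes p :: "complex poly"
  assumes "p \<noteq> 0"
  shows "resultant p (pderiv p) \<noteq> 0 \<longleftrightarrow> card {z. poly p z = 0} = degree p"
proof -
  have "degree (gcd p (pderiv p)) = 0 \<longleftrightarrow> (\<forall>z. \<not> (poly p z = 0 \<and> poly (pderiv p) z = 0))"
  proof
    assume d: "degree (gcd p (pderiv p)) = 0"
    show "\<forall>z. \<not> (poly p z = 0 \<and> poly (pderiv p) z = 0)"
    proof (intro allI notI)
      fix z assume "poly p z = 0 \<and> poly (pderiv p) z = 0"
      then have "[:- z, 1:] dvd gcd p (pderiv p)" by (simp add: poly_eq_0_iff_dvd)
      then have "degree [:- z, 1:] \<le> degree (gcd p (pderiv p))"
        using assms by (intro dvd_imp_degree_le) auto
      then show False using d by simp
    qed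
  next
    assume no: "\<forall>z. \<not> (poly p z = 0 \<and> poly (pderiv p) z = 0)"
    show "degree (gcd p (pderiv p)) = 0"
    proof (rule ccontr)
      assume "degree (gcd p (pderiv p)) \<noteq> 0"
      then obtain z where "poly (gcd p (pderiv p)) z = 0"
        using fundamental_theorem_of_algebra[of "gcd p (pderiv p)"] constant_degree[of "gcd p (pderiv p)"] by auto
      then have "[:- z, 1:] dvd gcd p (pderiv p)" by (simp add: poly_eq_0_iff_dvd)
      then have "[:- z, 1:] dvd p" "[:- z, 1:] dvd pderiv p" by (auto intro: dvd_trans)
      then show False using no by (simp add: poly_eq_0_iff_dvd)
    qed
  qed
  then show ?thesis
    using resultant_0_gcd[of p "pderiv p"] card_roots_eq_degree_iff[OF assms] rsquarefree_roots[of p] by blast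
qed

definition rat_poly :: "('x \<Rightarrow> complex) set \<Rightarrow> ('x \<Rightarrow> complex) \<Rightarrow> ('x \<Rightarrow> complex poly) \<Rightarrow> bool" where
  "rat_poly L D f \<longleftrightarrow> (\<forall>n. rat L D (\<lambda>x. coeff (f x) n))"

lemma rat_if: "rat L D f \<Longrightarrow> rat L D g \<Longrightarrow> rat L D (\<lambda>x. if b then f x else g x)"
  by (cases b) simp_all

lemma rat_poly_const: "rat_poly L D (\<lambda>x. c)"
  by (simp add: rat_poly_def rat_const)

lemma rat_poly_mult:
  assumes "polyfun L D" "rat_poly L D f" "rat_poly L D g"
  shows "rat_poly L D (\<lambda>x. f x * g x)"
  unfolding rat_poly_def coeff_mult
  using assms by (intro allI rat_sum rat_mult) (auto simp: rat_poly_def)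

lemma rat_poly_sum:
  assumes "polyfun L D" "\<And>i. i \<in> I \<Longrightarrow> rat_poly L D (f i)"
  shows "rat_poly L D (\<lambda>x. \<Sum>i\<in>I. f i x)"
  unfolding rat_poly_def coeff_sum
  using assms by (intro allI rat_sum) (auto simp: rat_poly_def)

lemma rat_poly_prod:
  assumes "polyfun L D" "\<And>i. i \<in> I \<Longrightarrow> rat_poly L D (f i)"
  shows "rat_poly L D (\<lambda>x. \<Prod>i\<in>I. f i x)"
  using assms(2)
proof (induction I rule: infinite_finite_induct)
  case (insert i I)
  then show ?case using rat_poly_mult[OF assms(1), of "f i" "\<lambda>x. \<Prod>i\<in>I. f i x"] by simp
qed (auto intro: rat_poly_const)

lemma rat_poly_char_poly:
  assumes D: "polyfun L D" and f: "\<And>i j. i < n \<Longrightarrow> j < n \<Longrightarrow> rat L D (\<lambda>x. f x i j)"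
  shows "rat_poly L D (\<lambda>x. char_poly (Matrix.mat n n (\<lambda>(i, j). f x i j)))"
proof -
  define g where "g x i j = (if i = j then [:- f x i j, 1:] else [:- f x i j:])" for x i j
  have g: "rat_poly L D (\<lambda>x. g x i j)" if "i < n" "j < n" for i j
    unfolding rat_poly_def
  proof
    fix k
    have "rat L D (\<lambda>x. - f x i j)" by (intro rat_uminus f that)
    then show "rat L D (\<lambda>x. coeff (g x i j) k)"
      by (cases "i = j"; cases k; cases "k - 1") (simp_all add: g_def rat_const)
  qed
  have "char_poly (Matrix.mat n n (\<lambda>(i, j). f x i j)) =
      (\<Sum>p\<in>{p. p permutes {0..<n}}. signof p * (\<Prod>i = 0..<n. g x i (p i)))" for x
  proof -
    have "char_poly_matrix (Matrix.mat n n (\<lambda>(i, j). f x i j)) = Matrix.mat n n (\<lambda>(i, j). g x i j)"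
      by (intro eq_matI) (auto simp: char_poly_matrix_def g_def)
    then show ?thesis
      by (auto simp: char_poly_def Determinant.det_def intro!: sum.cong prod.cong)
  qed
  moreover have "rat_poly L D (\<lambda>x. \<Sum>p\<in>{p. p permutes {0..<n}}. signof p * (\<Prod>i = 0..<n. g x i (p i)))"
  proof (intro rat_poly_sum D rat_poly_mult rat_poly_const rat_poly_prod g)
    fix p i assume "p \<in> {p. p permutes {0..<n}}" and i: "i \<in> {0..<n}"
    then show "p i < n" using permutes_in_image[of p "{0..<n}" i] by auto
    show "i < n" using i by simp
  qed
  ultimately show ?thesis by simp
qed

text \<open>The characteristic polynomial is monic of degree \<open>n\<close> for every
  \<open>x\<close>, so its Sylvester matrix with the derivative has a fixed size and the
  discriminant is one rational function. Having \<open>n\<close> distinct eigenvalues thus becomes a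
  nonvanishing condition.\<close>

lemma rat_discriminant:
  assumes D: "polyfun L D" and f: "\<And>i j. i < n \<Longrightarrow> j < n \<Longrightarrow> rat L D (\<lambda>x. f x i j)"
  shows "\<exists>h. rat L D h \<and>
    (\<forall>x. h x \<noteq> 0 \<longleftrightarrow> card {z. poly (char_poly (Matrix.mat n n (\<lambda>(i, j). f x i j))) z = 0} = n)"
proof -
  define c where "c x = char_poly (Matrix.mat n n (\<lambda>(i, j). f x i j))" for x
  define h where "h x = resultant (c x) (pderiv (c x))" for x
  have deg: "degree (c x) = n" "degree (pderiv (c x)) = n - 1" "c x \<noteq> 0" for x
    using degree_monic_char_poly[of "Matrix.mat n n (\<lambda>(i, j). f x i j)" n]
    by (auto simp: c_def degree_pderiv)
  have rc: "rat L D (\<lambda>x. coeff (c x) k)" for k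
    using rat_poly_char_poly[OF D f] by (simp add: rat_poly_def c_def)
  have rc': "rat L D (\<lambda>x. coeff (pderiv (c x)) k)" for k
    unfolding coeff_pderiv by (intro rat_mult rat_const rc)
  have "rat L D (\<lambda>x. Determinant.det (Matrix.mat (n + (n - 1)) (n + (n - 1)) (\<lambda>(i, j).
     if i < n - 1 then if i \<le> j \<and> j - i \<le> n then coeff (c x) (n + i - j) else 0
     else if i - (n - 1) \<le> j \<and> j \<le> i then coeff (pderiv (c x)) (i - j) else 0)))"
    by (intro rat_det D rat_if rc rc' rat_const)
  then have "rat L D h"
    unfolding h_def resultant_def sylvester_mat_def sylvester_mat_sub_def deg(1) deg(2) .
  moreover have "h x \<noteq> 0 \<longleftrightarrow> card {z. poly (c x) z = 0} = n" for x
    unfolding h_def using resultant_pderiv_nonzero_iff[OF deg(3)] deg(1) by simp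
  ultimately show ?thesis unfolding c_def by blast
qed

text \<open>Apply \<open>N\<close> minus \<open>\<mu> a\<close> to a relation: the term of
  \<open>a\<close> disappears and every other coefficient is multiplied by a nonzero difference
  \<open>\<mu> i - \<mu> a\<close>.\<close>

lemma eigenvector_family_independent:
  fixes N :: "nat \<Rightarrow> nat \<Rightarrow> complex"
  assumes "finite S" "inj_on \<mu> S"
    and "\<And>i r. i \<in> S \<Longrightarrow> r < n \<Longrightarrow> (\<Sum>c<n. N r c * x i c) = \<mu> i * x i r"
    and "\<And>i. i \<in> S \<Longrightarrow> \<exists>r<n. x i r \<noteq> 0"
    and "\<And>r. r < n \<Longrightarrow> (\<Sum>i\<in>S. d i * x i r) = 0"
  shows "\<forall>i\<in>S. d i = 0"
  using assms
proof (induction S arbitrary: d rule: finite_induct)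
  case (insert a S)
  have "(\<Sum>i\<in>S. (d i * (\<mu> i - \<mu> a)) * x i r) = 0" if r: "r < n" for r
  proof -
    have "(\<Sum>i\<in>insert a S. d i * (\<mu> i * x i r)) = (\<Sum>i\<in>insert a S. \<Sum>c<n. N r c * (d i * x i c))"
      using insert.prems(2)[OF _ r] by (intro sum.cong refl) (simp add: sum_distrib_left[symmetric] mult.left_commute)
    also have "\<dots> = (\<Sum>c<n. N r c * (\<Sum>i\<in>insert a S. d i * x i c))"
      by (subst sum.swap) (simp add: sum_distrib_left)
    also have "\<dots> = 0" using insert.prems(4) by simp
    finally have 1: "(\<Sum>i\<in>insert a S. d i * (\<mu> i * x i r)) = 0" .
    have "(\<Sum>i\<in>insert a S. (d i * (\<mu> i - \<mu> a)) * x i r) =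
        (\<Sum>i\<in>insert a S. d i * (\<mu> i * x i r)) - \<mu> a * (\<Sum>i\<in>insert a S. d i * x i r)"
      unfolding sum_distrib_left sum_subtractf[symmetric] by (intro sum.cong) (auto simp: algebra_simps)
    then have "(\<Sum>i\<in>insert a S. (d i * (\<mu> i - \<mu> a)) * x i r) = 0"
      using 1 insert.prems(4)[OF r] by simp
    then show ?thesis using insert.hyps by simp
  qed
  then have "\<forall>i\<in>S. d i * (\<mu> i - \<mu> a) = 0"
    using insert.prems by (intro insert.IH) auto
  then have S: "\<forall>i\<in>S. d i = 0" using insert.prems(1) insert.hyps by (auto simp: inj_on_def)
  obtain r where r: "r < n" "x a r \<noteq> 0" using insert.prems(3) by blast
  then have "d a * x a r = 0" using insert.prems(4)[OF r(1)] S insert.hyps by simp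
  then show ?case using S r by simp
qed simp

lemma eigenvectors_if_distinct_roots:
  fixes N :: "nat \<Rightarrow> nat \<Rightarrow> complex"
  assumes "card {z. poly (char_poly (Matrix.mat n n (\<lambda>(i, j). N i j))) z = 0} = n"
  obtains \<mu> x where "inj_on \<mu> {..<n}"
    "\<And>i r. i < n \<Longrightarrow> r < n \<Longrightarrow> (\<Sum>c<n. N r c * x i c) = \<mu> i * x i r"
    "\<And>i. i < n \<Longrightarrow> \<exists>r<n. x i r \<noteq> (0::complex)"
proof -
  let ?M = "Matrix.mat n n (\<lambda>(i, j). N i j)"
  let ?S = "{z. poly (char_poly ?M) z = 0}"
  have M: "?M \<in> carrier_mat n n" by simp
  have "char_poly ?M \<noteq> 0" using degree_monic_char_poly[OF M] by auto
  then have "finite ?S" by (rule poly_roots_finite)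
  then obtain \<mu> where \<mu>: "bij_betw \<mu> {..<n} ?S"
    using ex_bij_betw_nat_finite assms by (metis lessThan_atLeast0)
  have "\<exists>v. eigenvector ?M v (\<mu> i)" if "i < n" for i
  proof -
    have "\<mu> i \<in> ?S" using \<mu> that by (auto simp: bij_betw_def)
    then show ?thesis using eigenvalue_root_char_poly[OF M] by (auto simp: eigenvalue_def)
  qed
  then obtain v where v: "\<And>i. i < n \<Longrightarrow> eigenvector ?M (v i) (\<mu> i)" by metis
  show thesis
  proof (rule that[of \<mu> "\<lambda>i r. vec_index (v i) r"])
    show "inj_on \<mu> {..<n}" using \<mu> by (simp add: bij_betw_def)
    fix i assume i: "i < n"
    have vi: "v i \<in> carrier_vec n" "v i \<noteq> 0\<^sub>v n" "?M *\<^sub>v v i = \<mu> i \<cdot>\<^sub>v v i"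
      using v[OF i] by (auto simp: eigenvector_def)
    show "\<exists>r<n. vec_index (v i) r \<noteq> 0"
      using vi(1,2) by (metis carrier_vecD eq_vecI index_zero_vec)
    fix r assume r: "r < n"
    have "vec_index (?M *\<^sub>v v i) r = vec_index (\<mu> i \<cdot>\<^sub>v v i) r" using vi(3) by simp
    then show "(\<Sum>c<n. N r c * vec_index (v i) c) = \<mu> i * vec_index (v i) r"
      using r vi(1) by (simp add: scalar_prod_def lessThan_atLeast0)
  qed
qed

text \<open>Distinct eigenvalues already give \<open>n\<close> roots, and the degree admits no
  more.\<close>

lemma card_roots_char_poly:
  fixes N :: "nat \<Rightarrow> nat \<Rightarrow> complex"
  assumes "inj_on \<mu> {..<n}"
    and "\<And>i r. i < n \<Longrightarrow> r < n \<Longrightarrow> (\<Sum>c<n. N r c * x i c) = \<mu> i * x i r"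
    and "\<And>i. i < n \<Longrightarrow> \<exists>r<n. x i r \<noteq> (0::complex)"
  shows "card {z. poly (char_poly (Matrix.mat n n (\<lambda>(i, j). N i j))) z = 0} = n"
proof -
  let ?M = "Matrix.mat n n (\<lambda>(i, j). N i j)"
  let ?S = "{z. poly (char_poly ?M) z = 0}"
  have M: "?M \<in> carrier_mat n n" by simp
  have c: "char_poly ?M \<noteq> 0" "degree (char_poly ?M) = n" using degree_monic_char_poly[OF M] by auto
  have fin: "finite ?S" using c(1) by (rule poly_roots_finite)
  have "\<mu> i \<in> ?S" if i: "i < n" for i
  proof -
    let ?v = "Matrix.vec n (x i)"
    have "?M *\<^sub>v ?v = \<mu> i \<cdot>\<^sub>v ?v"
      using assms(2)[OF i] by (intro eq_vecI) (auto simp: scalar_prod_def lessThan_atLeast0)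
    moreover have "?v \<noteq> 0\<^sub>v n" using assms(3)[OF i] by (metis index_vec index_zero_vec(1))
    ultimately have "eigenvector ?M ?v (\<mu> i)" by (simp add: eigenvector_def)
    then show ?thesis using eigenvalue_root_char_poly[OF M] by (auto simp: eigenvalue_def)
  qed
  then have "\<mu> ` {..<n} \<subseteq> ?S" by auto
  then have "n \<le> card ?S" using card_mono[OF fin] assms(1) by (metis card_image card_lessThan)
  moreover have "card ?S \<le> n" using poly_roots_degree[OF c(1)] c(2) by simp
  ultimately show ?thesis by simp
qed

section \<open>The base configuration\<close>

text \<open>Five decomposable bivectors \<open>a i \<and> b i\<close> and the frame \<open>j \<mapsto> a j \<and> b j + a 4 \<and> b 4\<close>.\<close>

definition base_a :: "nat \<Rightarrow> nat \<Rightarrow> 'c::comm_ring_1" where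
  "base_a i a = of_int ([[1, 0, 0, 0, 0, 0], [0, 0, 1, 0, 0, 0], [0, 0, 0, 0, 1, 0], [1, 0, 1, 0, 1, 0], [1, 0, 1, 0, 0, 1]] ! i ! a)"

definition base_b :: "nat \<Rightarrow> nat \<Rightarrow> 'c::comm_ring_1" where
  "base_b i a = of_int ([[0, 1, 0, 0, 0, 0], [0, 0, 0, 1, 0, 0], [0, 0, 0, 0, 0, 1], [0, 1, 0, 1, 0, 1], [0, 1, 0, -1, 1, 0]] ! i ! a)"

definition base_u :: "nat \<Rightarrow> nat \<Rightarrow> 'c::comm_ring_1" where
  "base_u i j = (if i = j \<or> i = 4 then 1 else 0)"

section \<open>Linear algebra at the base point of the secant map\<close>

lemma sum_lessThan_4: "(\<Sum>a<(4::nat). f a) = f 0 + f 1 + f 2 + (f 3 :: 'a::comm_monoid_add)"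
  by (simp add: eval_nat_numeral)

lemma sum_lessThan_5: "(\<Sum>a<(5::nat). f a) = f 0 + f 1 + f 2 + f 3 + (f 4 :: 'a::comm_monoid_add)"
  by (simp add: eval_nat_numeral)

lemma sum_lessThan_6: "(\<Sum>a<(6::nat). f a) = f 0 + f 1 + f 2 + f 3 + f 4 + (f 5 :: 'a::comm_monoid_add)"
  by (simp add: eval_nat_numeral)

text \<open>By the choice of \<open>base_u\<close>, form \<open>T i\<close> has plane
  \<open>i\<close> in its radical for \<open>i < 4\<close>, and the sum of the four forms has plane
  4 in its radical. Moreover, every form vanishes on every plane. Planes 0, 1 and 2 are coordinate
  planes, so their equations kill single coordinates; the rest is an explicit elimination.\<close>

lemma base_annihilator_real:
  fixes T :: "nat \<Rightarrow> nat \<Rightarrow> nat \<Rightarrow> real"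
  assumes skew: "\<And>j a b. j < 4 \<Longrightarrow> a < 6 \<Longrightarrow> b < 6 \<Longrightarrow> T j a b + T j b a = 0"
    and hu: "\<And>i j. i < 5 \<Longrightarrow> j < 4 \<Longrightarrow> (\<Sum>a<6. \<Sum>b<6. T j a b * base_a i a * base_b i b) = 0"
    and hB: "\<And>i a. i < 5 \<Longrightarrow> a < 6 \<Longrightarrow> (\<Sum>j<4. base_u i j * (\<Sum>b<6. T j a b * base_b i b)) = 0"
    and hA: "\<And>i b. i < 5 \<Longrightarrow> b < 6 \<Longrightarrow> (\<Sum>j<4. base_u i j * (\<Sum>a<6. T j a b * base_a i a)) = 0"
    and jab: "j < 4" "a < 6" "b < 6"
  shows "T j a b = 0"
proof -
  have sk: "T j a b = - T j b a" if "j < 4" "a < 6" "b < 6" "b < a" for j a b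
    using skew[OF that(1-3)] by simp
  have diag: "T j a a = 0" if "j < 4" "a < 6" for j a
    using skew[OF that(1,2,2)] by simp
  note defs = sum_lessThan_6 sum_lessThan_4 base_u_def base_a_def base_b_def sk diag
  \<comment> \<open>Labels that start with \<open>B\<close>, \<open>A\<close> or \<open>u\<close>
    record the indices at which \<open>hB\<close>, \<open>hA\<close> or \<open>hu\<close> is
    used.\<close>
  have B00: "T 0 0 1 = 0" using hB[of 0 0] by (simp add: defs del: One_nat_def)
  have B02: "T 0 1 2 = 0" using hB[of 0 2] by (simp add: defs del: One_nat_def)
  have A02: "T 0 0 2 = 0" using hA[of 0 2] by (simp add: defs del: One_nat_def)
  have B03: "T 0 1 3 = 0" using hB[of 0 3] by (simp add: defs del: One_nat_def)
  have A03: "T 0 0 3 = 0" using hA[of 0 3] by (simp add: defs del: One_nat_def)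
  have B04: "T 0 1 4 = 0" using hB[of 0 4] by (simp add: defs del: One_nat_def)
  have A04: "T 0 0 4 = 0" using hA[of 0 4] by (simp add: defs del: One_nat_def)
  have B05: "T 0 1 5 = 0" using hB[of 0 5] by (simp add: defs del: One_nat_def)
  have A05: "T 0 0 5 = 0" using hA[of 0 5] by (simp add: defs del: One_nat_def)
  have B10: "T 1 0 3 = 0" using hB[of 1 0] by (simp add: defs del: One_nat_def)
  have A10: "T 1 0 2 = 0" using hA[of 1 0] by (simp add: defs del: One_nat_def)
  have B11: "T 1 1 3 = 0" using hB[of 1 1] by (simp add: defs del: One_nat_def)
  have A11: "T 1 1 2 = 0" using hA[of 1 1] by (simp add: defs del: One_nat_def)
  have B12: "T 1 2 3 = 0" using hB[of 1 2] by (simp add: defs del: One_nat_def)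
  have B14: "T 1 3 4 = 0" using hB[of 1 4] by (simp add: defs del: One_nat_def)
  have A14: "T 1 2 4 = 0" using hA[of 1 4] by (simp add: defs del: One_nat_def)
  have B15: "T 1 3 5 = 0" using hB[of 1 5] by (simp add: defs del: One_nat_def)
  have A15: "T 1 2 5 = 0" using hA[of 1 5] by (simp add: defs del: One_nat_def)
  have B20: "T 2 0 5 = 0" using hB[of 2 0] by (simp add: defs del: One_nat_def)
  have A20: "T 2 0 4 = 0" using hA[of 2 0] by (simp add: defs del: One_nat_def)
  have B21: "T 2 1 5 = 0" using hB[of 2 1] by (simp add: defs del: One_nat_def)
  have A21: "T 2 1 4 = 0" using hA[of 2 1] by (simp add: defs del: One_nat_def)
  have B22: "T 2 2 5 = 0" using hB[of 2 2] by (simp add: defs del: One_nat_def)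
  have A22: "T 2 2 4 = 0" using hA[of 2 2] by (simp add: defs del: One_nat_def)
  have B23: "T 2 3 5 = 0" using hB[of 2 3] by (simp add: defs del: One_nat_def)
  have A23: "T 2 3 4 = 0" using hA[of 2 3] by (simp add: defs del: One_nat_def)
  have B24: "T 2 4 5 = 0" using hB[of 2 4] by (simp add: defs del: One_nat_def)
  have u01: "T 1 0 1 = 0" using hu[of 0 1] by (simp add: defs del: One_nat_def)
  have u02: "T 2 0 1 = 0" using hu[of 0 2] by (simp add: defs del: One_nat_def)
  have u03: "T 3 0 1 = 0" using hu[of 0 3] by (simp add: defs del: One_nat_def)
  have u10: "T 0 2 3 = 0" using hu[of 1 0] by (simp add: defs del: One_nat_def)
  have u12: "T 2 2 3 = 0" using hu[of 1 2] by (simp add: defs del: One_nat_def)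
  have u13: "T 3 2 3 = 0" using hu[of 1 3] by (simp add: defs del: One_nat_def)
  have u20: "T 0 4 5 = 0" using hu[of 2 0] by (simp add: defs del: One_nat_def)
  have u21: "T 1 4 5 = 0" using hu[of 2 1] by (simp add: defs del: One_nat_def)
  have u23: "T 3 4 5 = 0" using hu[of 2 3] by (simp add: defs del: One_nat_def)
  \<comment> \<open>Planes 3 and 4 now act on the 24 coordinates left over: the four of each of
    \<open>T 0\<close>, \<open>T 1\<close>, \<open>T 2\<close> that pair the other two coordinate
    planes, and the twelve of \<open>T 3\<close> that pair two different coordinate planes.\<close>
  have B30: "T 3 0 3 + T 3 0 5 = 0" using hB[of 3 0] by (simp add: defs B00 B02 A02 B03 A03 B04 A04 B05 A05 B10 A10 B11 A11 B12 B14 A14 B15 A15 B20 A20 B21 A21 B22 A22 B23 A23 B24 u01 u02 u03 u10 u12 u13 u20 u21 u23 del: One_nat_def)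
  have A30: "- T 3 0 2 - T 3 0 4 = 0" using hA[of 3 0] by (simp add: defs B00 B02 A02 B03 A03 B04 A04 B05 A05 B10 A10 B11 A11 B12 B14 A14 B15 A15 B20 A20 B21 A21 B22 A22 B23 A23 B24 u01 u02 u03 u10 u12 u13 u20 u21 u23 del: One_nat_def)
  have B31: "T 3 1 3 + T 3 1 5 = 0" using hB[of 3 1] by (simp add: defs B00 B02 A02 B03 A03 B04 A04 B05 A05 B10 A10 B11 A11 B12 B14 A14 B15 A15 B20 A20 B21 A21 B22 A22 B23 A23 B24 u01 u02 u03 u10 u12 u13 u20 u21 u23 del: One_nat_def)
  have A31: "- T 3 1 2 - T 3 1 4 = 0" using hA[of 3 1] by (simp add: defs B00 B02 A02 B03 A03 B04 A04 B05 A05 B10 A10 B11 A11 B12 B14 A14 B15 A15 B20 A20 B21 A21 B22 A22 B23 A23 B24 u01 u02 u03 u10 u12 u13 u20 u21 u23 del: One_nat_def)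
  have B32: "- T 3 1 2 + T 3 2 5 = 0" using hB[of 3 2] by (simp add: defs B00 B02 A02 B03 A03 B04 A04 B05 A05 B10 A10 B11 A11 B12 B14 A14 B15 A15 B20 A20 B21 A21 B22 A22 B23 A23 B24 u01 u02 u03 u10 u12 u13 u20 u21 u23 del: One_nat_def)
  have A32: "T 3 0 2 - T 3 2 4 = 0" using hA[of 3 2] by (simp add: defs B00 B02 A02 B03 A03 B04 A04 B05 A05 B10 A10 B11 A11 B12 B14 A14 B15 A15 B20 A20 B21 A21 B22 A22 B23 A23 B24 u01 u02 u03 u10 u12 u13 u20 u21 u23 del: One_nat_def)
  have B33: "- T 3 1 3 + T 3 3 5 = 0" using hB[of 3 3] by (simp add: defs B00 B02 A02 B03 A03 B04 A04 B05 A05 B10 A10 B11 A11 B12 B14 A14 B15 A15 B20 A20 B21 A21 B22 A22 B23 A23 B24 u01 u02 u03 u10 u12 u13 u20 u21 u23 del: One_nat_def)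
  have A33: "T 3 0 3 - T 3 3 4 = 0" using hA[of 3 3] by (simp add: defs B00 B02 A02 B03 A03 B04 A04 B05 A05 B10 A10 B11 A11 B12 B14 A14 B15 A15 B20 A20 B21 A21 B22 A22 B23 A23 B24 u01 u02 u03 u10 u12 u13 u20 u21 u23 del: One_nat_def)
  have B34: "- T 3 1 4 - T 3 3 4 = 0" using hB[of 3 4] by (simp add: defs B00 B02 A02 B03 A03 B04 A04 B05 A05 B10 A10 B11 A11 B12 B14 A14 B15 A15 B20 A20 B21 A21 B22 A22 B23 A23 B24 u01 u02 u03 u10 u12 u13 u20 u21 u23 del: One_nat_def)
  have A34: "T 3 0 4 + T 3 2 4 = 0" using hA[of 3 4] by (simp add: defs B00 B02 A02 B03 A03 B04 A04 B05 A05 B10 A10 B11 A11 B12 B14 A14 B15 A15 B20 A20 B21 A21 B22 A22 B23 A23 B24 u01 u02 u03 u10 u12 u13 u20 u21 u23 del: One_nat_def)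
  have B35: "- T 3 1 5 - T 3 3 5 = 0" using hB[of 3 5] by (simp add: defs B00 B02 A02 B03 A03 B04 A04 B05 A05 B10 A10 B11 A11 B12 B14 A14 B15 A15 B20 A20 B21 A21 B22 A22 B23 A23 B24 u01 u02 u03 u10 u12 u13 u20 u21 u23 del: One_nat_def)
  have A35: "T 3 0 5 + T 3 2 5 = 0" using hA[of 3 5] by (simp add: defs B00 B02 A02 B03 A03 B04 A04 B05 A05 B10 A10 B11 A11 B12 B14 A14 B15 A15 B20 A20 B21 A21 B22 A22 B23 A23 B24 u01 u02 u03 u10 u12 u13 u20 u21 u23 del: One_nat_def)
  have B40: "T 1 0 4 - T 2 0 3 - T 3 0 3 + T 3 0 4 = 0" using hB[of 4 0] by (simp add: defs B00 B02 A02 B03 A03 B04 A04 B05 A05 B10 A10 B11 A11 B12 B14 A14 B15 A15 B20 A20 B21 A21 B22 A22 B23 A23 B24 u01 u02 u03 u10 u12 u13 u20 u21 u23 del: One_nat_def)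
  have A40: "- T 1 0 5 - T 2 0 2 - T 3 0 2 - T 3 0 5 = 0" using hA[of 4 0] by (simp add: defs B00 B02 A02 B03 A03 B04 A04 B05 A05 B10 A10 B11 A11 B12 B14 A14 B15 A15 B20 A20 B21 A21 B22 A22 B23 A23 B24 u01 u02 u03 u10 u12 u13 u20 u21 u23 del: One_nat_def)
  have B41: "T 1 1 4 - T 2 1 3 - T 3 1 3 + T 3 1 4 = 0" using hB[of 4 1] by (simp add: defs B00 B02 A02 B03 A03 B04 A04 B05 A05 B10 A10 B11 A11 B12 B14 A14 B15 A15 B20 A20 B21 A21 B22 A22 B23 A23 B24 u01 u02 u03 u10 u12 u13 u20 u21 u23 del: One_nat_def)
  have A41: "- T 1 1 5 - T 2 1 2 - T 3 1 2 - T 3 1 5 = 0" using hA[of 4 1] by (simp add: defs B00 B02 A02 B03 A03 B04 A04 B05 A05 B10 A10 B11 A11 B12 B14 A14 B15 A15 B20 A20 B21 A21 B22 A22 B23 A23 B24 u01 u02 u03 u10 u12 u13 u20 u21 u23 del: One_nat_def)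
  have B42: "T 0 2 4 - T 2 1 2 - T 3 1 2 + T 3 2 4 = 0" using hB[of 4 2] by (simp add: defs B00 B02 A02 B03 A03 B04 A04 B05 A05 B10 A10 B11 A11 B12 B14 A14 B15 A15 B20 A20 B21 A21 B22 A22 B23 A23 B24 u01 u02 u03 u10 u12 u13 u20 u21 u23 del: One_nat_def)
  have A42: "- T 0 2 5 + T 2 0 2 + T 3 0 2 - T 3 2 5 = 0" using hA[of 4 2] by (simp add: defs B00 B02 A02 B03 A03 B04 A04 B05 A05 B10 A10 B11 A11 B12 B14 A14 B15 A15 B20 A20 B21 A21 B22 A22 B23 A23 B24 u01 u02 u03 u10 u12 u13 u20 u21 u23 del: One_nat_def)
  have B43: "T 0 3 4 - T 2 1 3 - T 3 1 3 + T 3 3 4 = 0" using hB[of 4 3] by (simp add: defs B00 B02 A02 B03 A03 B04 A04 B05 A05 B10 A10 B11 A11 B12 B14 A14 B15 A15 B20 A20 B21 A21 B22 A22 B23 A23 B24 u01 u02 u03 u10 u12 u13 u20 u21 u23 del: One_nat_def)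
  have A43: "- T 0 3 5 + T 2 0 3 + T 3 0 3 - T 3 3 5 = 0" using hA[of 4 3] by (simp add: defs B00 B02 A02 B03 A03 B04 A04 B05 A05 B10 A10 B11 A11 B12 B14 A14 B15 A15 B20 A20 B21 A21 B22 A22 B23 A23 B24 u01 u02 u03 u10 u12 u13 u20 u21 u23 del: One_nat_def)
  have B44: "T 0 3 4 - T 1 1 4 - T 3 1 4 + T 3 3 4 = 0" using hB[of 4 4] by (simp add: defs B00 B02 A02 B03 A03 B04 A04 B05 A05 B10 A10 B11 A11 B12 B14 A14 B15 A15 B20 A20 B21 A21 B22 A22 B23 A23 B24 u01 u02 u03 u10 u12 u13 u20 u21 u23 del: One_nat_def)
  have A44: "T 0 2 4 + T 1 0 4 + T 3 0 4 + T 3 2 4 = 0" using hA[of 4 4] by (simp add: defs B00 B02 A02 B03 A03 B04 A04 B05 A05 B10 A10 B11 A11 B12 B14 A14 B15 A15 B20 A20 B21 A21 B22 A22 B23 A23 B24 u01 u02 u03 u10 u12 u13 u20 u21 u23 del: One_nat_def)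
  have B45: "T 0 3 5 - T 1 1 5 - T 3 1 5 + T 3 3 5 = 0" using hB[of 4 5] by (simp add: defs B00 B02 A02 B03 A03 B04 A04 B05 A05 B10 A10 B11 A11 B12 B14 A14 B15 A15 B20 A20 B21 A21 B22 A22 B23 A23 B24 u01 u02 u03 u10 u12 u13 u20 u21 u23 del: One_nat_def)
  have A45: "T 0 2 5 + T 1 0 5 + T 3 0 5 + T 3 2 5 = 0" using hA[of 4 5] by (simp add: defs B00 B02 A02 B03 A03 B04 A04 B05 A05 B10 A10 B11 A11 B12 B14 A14 B15 A15 B20 A20 B21 A21 B22 A22 B23 A23 B24 u01 u02 u03 u10 u12 u13 u20 u21 u23 del: One_nat_def)
  have u30: "T 0 2 5 - T 0 3 4 = 0" using hu[of 3 0] by (simp add: defs B00 B02 A02 B03 A03 B04 A04 B05 A05 B10 A10 B11 A11 B12 B14 A14 B15 A15 B20 A20 B21 A21 B22 A22 B23 A23 B24 u01 u02 u03 u10 u12 u13 u20 u21 u23 del: One_nat_def)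
  have u31: "T 1 0 5 - T 1 1 4 = 0" using hu[of 3 1] by (simp add: defs B00 B02 A02 B03 A03 B04 A04 B05 A05 B10 A10 B11 A11 B12 B14 A14 B15 A15 B20 A20 B21 A21 B22 A22 B23 A23 B24 u01 u02 u03 u10 u12 u13 u20 u21 u23 del: One_nat_def)
  have u32: "T 2 0 3 - T 2 1 2 = 0" using hu[of 3 2] by (simp add: defs B00 B02 A02 B03 A03 B04 A04 B05 A05 B10 A10 B11 A11 B12 B14 A14 B15 A15 B20 A20 B21 A21 B22 A22 B23 A23 B24 u01 u02 u03 u10 u12 u13 u20 u21 u23 del: One_nat_def)
  have u33: "T 3 0 3 + T 3 0 5 - T 3 1 2 + T 3 2 5 - T 3 1 4 - T 3 3 4 = 0" using hu[of 3 3] by (simp add: defs B00 B02 A02 B03 A03 B04 A04 B05 A05 B10 A10 B11 A11 B12 B14 A14 B15 A15 B20 A20 B21 A21 B22 A22 B23 A23 B24 u01 u02 u03 u10 u12 u13 u20 u21 u23 del: One_nat_def)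
  have u40: "T 0 2 4 + T 0 3 5 = 0" using hu[of 4 0] by (simp add: defs B00 B02 A02 B03 A03 B04 A04 B05 A05 B10 A10 B11 A11 B12 B14 A14 B15 A15 B20 A20 B21 A21 B22 A22 B23 A23 B24 u01 u02 u03 u10 u12 u13 u20 u21 u23 del: One_nat_def)
  have u41: "T 1 0 4 - T 1 1 5 = 0" using hu[of 4 1] by (simp add: defs B00 B02 A02 B03 A03 B04 A04 B05 A05 B10 A10 B11 A11 B12 B14 A14 B15 A15 B20 A20 B21 A21 B22 A22 B23 A23 B24 u01 u02 u03 u10 u12 u13 u20 u21 u23 del: One_nat_def)
  have u42: "- T 2 0 3 - T 2 1 2 = 0" using hu[of 4 2] by (simp add: defs B00 B02 A02 B03 A03 B04 A04 B05 A05 B10 A10 B11 A11 B12 B14 A14 B15 A15 B20 A20 B21 A21 B22 A22 B23 A23 B24 u01 u02 u03 u10 u12 u13 u20 u21 u23 del: One_nat_def)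
  have u43: "- T 3 0 3 + T 3 0 4 - T 3 1 2 + T 3 2 4 - T 3 1 5 + T 3 3 5 = 0" using hu[of 4 3] by (simp add: defs B00 B02 A02 B03 A03 B04 A04 B05 A05 B10 A10 B11 A11 B12 B14 A14 B15 A15 B20 A20 B21 A21 B22 A22 B23 A23 B24 u01 u02 u03 u10 u12 u13 u20 u21 u23 del: One_nat_def)
  \<comment> \<open>Elimination: each \<open>S\<close> label solves for the coordinate whose indices
    it carries, and the \<open>Z\<close> labels substitute back.\<close>
  have S305: "T 3 0 5 = - T 3 0 3" using B30  by linarith
  have S304: "T 3 0 4 = - T 3 0 2" using A30  by linarith
  have S315: "T 3 1 5 = - T 3 1 3" using B31  by linarith
  have S314: "T 3 1 4 = - T 3 1 2" using A31  by linarith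
  have S325: "T 3 2 5 = T 3 1 2" using B32  by linarith
  have S324: "T 3 2 4 = T 3 0 2" using A32  by linarith
  have S335: "T 3 3 5 = T 3 1 3" using B33  by linarith
  have S334: "T 3 3 4 = T 3 0 3" using A33  by linarith
  have S312: "T 3 1 2 = T 3 0 3" using B34 S314 S334 by linarith
  have S104: "T 1 0 4 = - T 0 2 4" using A44 S304 S324 by linarith
  have S105: "T 1 0 5 = - T 0 2 5" using A45 S305 S325 S312 by linarith
  have S034: "T 0 3 4 = T 0 2 5" using u30  by linarith
  have S114: "T 1 1 4 = - T 0 2 5" using u31 S105 by linarith
  have S303: "T 3 0 3 = - T 0 2 5" using B44 S034 S114 S314 S334 S312 by linarith
  have S302: "T 3 0 2 = - T 2 0 2" using A40 S105 S305 S303 by linarith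
  have S313: "T 3 1 3 = - T 2 1 3" using B41 S114 S314 S312 S303 by linarith
  have S212: "T 2 1 2 = T 2 0 3" using u32  by linarith
  have S203: "T 2 0 3 = 0" using u42 S212 by linarith
  have S035: "T 0 3 5 = - T 0 2 4" using u40  by linarith
  have S115: "T 1 1 5 = - T 0 2 4" using u41 S104 by linarith
  have S213: "T 2 1 3 = 0" using B45 S035 S115 S315 S335 S313 by linarith
  have S025: "T 0 2 5 = 0" using u43 S303 S304 S312 S324 S315 S335 S313 S213 by linarith
  have S024: "T 0 2 4 = 0" using A41 S115 S212 S312 S315 S203 S303 S313 S025 S213 by linarith
  have S202: "T 2 0 2 = 0" using B40 S104 S203 S303 S304 S024 S025 S302 by linarith
  have Z115: "T 1 1 5 = 0" using S115 S024 by simp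
  have Z035: "T 0 3 5 = 0" using S035 S024 by simp
  have Z212: "T 2 1 2 = 0" using S212 S203 by simp
  have Z313: "T 3 1 3 = 0" using S313 S213 by simp
  have Z302: "T 3 0 2 = 0" using S302 S202 by simp
  have Z303: "T 3 0 3 = 0" using S303 S025 by simp
  have Z114: "T 1 1 4 = 0" using S114 S025 by simp
  have Z034: "T 0 3 4 = 0" using S034 S025 by simp
  have Z105: "T 1 0 5 = 0" using S105 S025 by simp
  have Z104: "T 1 0 4 = 0" using S104 S024 by simp
  have Z312: "T 3 1 2 = 0" using S312 Z303 by simp
  have Z334: "T 3 3 4 = 0" using S334 Z303 by simp
  have Z335: "T 3 3 5 = 0" using S335 Z313 by simp
  have Z324: "T 3 2 4 = 0" using S324 Z302 by simp
  have Z325: "T 3 2 5 = 0" using S325 Z312 by simp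
  have Z314: "T 3 1 4 = 0" using S314 Z312 by simp
  have Z315: "T 3 1 5 = 0" using S315 Z313 by simp
  have Z304: "T 3 0 4 = 0" using S304 Z302 by simp
  have Z305: "T 3 0 5 = 0" using S305 Z303 by simp
  note zeros = B00 B02 A02 B03 A03 B04 A04 B05 A05 B10 A10 B11 A11 B12 B14 A14 B15 A15 B20 A20 B21 A21 B22 A22 B23 A23 B24 u01 u02 u03 u10 u12 u13 u20 u21 u23 S202 S024 S025 S213 Z115 Z035 S203 Z212 Z313 Z302 Z303 Z114 Z034 Z105 Z104 Z312 Z334 Z335 Z324 Z325 Z314 Z315 Z304 Z305
  have up: "T j a b = 0" if "j < 4" "a < b" "b < 6" for j a b
  proof -
    have "j = 0 \<or> j = 1 \<or> j = 2 \<or> j = 3" "b = 0 \<or> b = 1 \<or> b = 2 \<or> b = 3 \<or> b = 4 \<or> b = 5"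
      "a = 0 \<or> a = 1 \<or> a = 2 \<or> a = 3 \<or> a = 4"
      using that by auto
    then show ?thesis using that(2) by (elim disjE; hypsubst; simp add: zeros del: One_nat_def)
  qed
  show ?thesis using up[of j a b] up[of j b a] sk[of j a b] diag[of j a] jab
    by (cases a b rule: linorder_cases) simp_all
qed

text \<open>The base data are integers, so the equations hold for real and imaginary parts
  separately, where linear arithmetic over an ordered field applies.\<close>

lemma base_annihilator:
  fixes T :: "nat \<Rightarrow> nat \<Rightarrow> nat \<Rightarrow> complex"
  assumes skew: "\<And>j a b. j < 4 \<Longrightarrow> a < 6 \<Longrightarrow> b < 6 \<Longrightarrow> T j a b + T j b a = 0"
    and hu: "\<And>i j. i < 5 \<Longrightarrow> j < 4 \<Longrightarrow> (\<Sum>a<6. \<Sum>b<6. T j a b * base_a i a * base_b i b) = 0"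
    and hB: "\<And>i a. i < 5 \<Longrightarrow> a < 6 \<Longrightarrow> (\<Sum>j<4. base_u i j * (\<Sum>b<6. T j a b * base_b i b)) = 0"
    and hA: "\<And>i b. i < 5 \<Longrightarrow> b < 6 \<Longrightarrow> (\<Sum>j<4. base_u i j * (\<Sum>a<6. T j a b * base_a i a)) = 0"
    and jab: "j < 4" "a < 6" "b < 6"
  shows "T j a b = 0"
proof -
  have ra: "base_a i a = complex_of_real (base_a i a)" for i a by (simp add: base_a_def)
  have rb: "base_b i a = complex_of_real (base_b i a)" for i a by (simp add: base_b_def)
  have ru: "base_u i a = complex_of_real (base_u i a)" for i a by (simp add: base_u_def)
  have "Re (T j a b) = 0"
  proof (rule base_annihilator_real[where T = "\<lambda>j a b. Re (T j a b)", OF _ _ _ _ jab])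
    show "Re (T j a b) + Re (T j b a) = 0" if "j < 4" "a < 6" "b < 6" for j a b
      using arg_cong[OF skew[OF that], of Re] by simp
    show "(\<Sum>a<6. \<Sum>b<6. Re (T j a b) * base_a i a * base_b i b) = 0" if "i < 5" "j < 4" for i j
      using arg_cong[OF hu[OF that], of Re] by (simp add: ra rb)
    show "(\<Sum>j<4. base_u i j * (\<Sum>b<6. Re (T j a b) * base_b i b)) = 0" if "i < 5" "a < 6" for i a
      using arg_cong[OF hB[OF that], of Re] by (simp add: ru rb)
    show "(\<Sum>j<4. base_u i j * (\<Sum>a<6. Re (T j a b) * base_a i a)) = 0" if "i < 5" "b < 6" for i b
      using arg_cong[OF hA[OF that], of Re] by (simp add: ru ra)
  qed
  moreover have "Im (T j a b) = 0"
  proof (rule base_annihilator_real[where T = "\<lambda>j a b. Im (T j a b)", OF _ _ _ _ jab])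
    show "Im (T j a b) + Im (T j b a) = 0" if "j < 4" "a < 6" "b < 6" for j a b
      using arg_cong[OF skew[OF that], of Im] by simp
    show "(\<Sum>a<6. \<Sum>b<6. Im (T j a b) * base_a i a * base_b i b) = 0" if "i < 5" "j < 4" for i j
      using arg_cong[OF hu[OF that], of Im] by (simp add: ra rb)
    show "(\<Sum>j<4. base_u i j * (\<Sum>b<6. Im (T j a b) * base_b i b)) = 0" if "i < 5" "a < 6" for i a
      using arg_cong[OF hB[OF that], of Im] by (simp add: ru rb)
    show "(\<Sum>j<4. base_u i j * (\<Sum>a<6. Im (T j a b) * base_a i a)) = 0" if "i < 5" "b < 6" for i b
      using arg_cong[OF hA[OF that], of Im] by (simp add: ru ra)
  qed
  ultimately show ?thesis by (simp add: complex_eq_iff)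
qed

section \<open>Density of the frames that lie in a span of five decomposable bivectors\<close>

lemma polyfun_sum: "(\<And>i. i \<in> I \<Longrightarrow> polyfun L (f i)) \<Longrightarrow> polyfun L (\<lambda>x. \<Sum>i\<in>I. f i x)"
  by (induction I rule: infinite_finite_induct) (auto intro: polyfun.intros)

definition frame_coords :: "(complex \<Rightarrow> 'e::ab_group_add \<Rightarrow> 'e) \<Rightarrow> nat \<Rightarrow> ((nat \<Rightarrow> 'e) \<Rightarrow> complex) set" where
  "frame_coords s k = {\<lambda>w. \<phi> (w j) | j \<phi>. j < k \<and> Vector_Spaces.linear s (*) \<phi>}"

lemma polyfun_frame_cong:
  assumes "polyfun (frame_coords s k) p" "\<And>j. j < k \<Longrightarrow> w j = w' j"
  shows "p w = p w'"
  using assms(1)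
proof induction
  case (polyfun_base l)
  then obtain j \<phi> where "l = (\<lambda>w. \<phi> (w j))" "j < k" unfolding frame_coords_def by auto
  then show ?case using assms(2) by simp
qed simp_all

text \<open>The derivative of \<open>secant_map\<close> is surjective at the base point, so the
  image contains a ball of coordinate arrays. The polynomial, pulled back along the linear map
  \<open>W\<close>, vanishes on this ball and hence everywhere. Here \<open>w2 a b\<close> stands
  for the product of two basis vectors.\<close>

lemma polyfun_zero_if_zero_on_secants:
  fixes s :: "complex \<Rightarrow> 'e::ab_group_add \<Rightarrow> 'e" and w2 :: "nat \<Rightarrow> nat \<Rightarrow> 'e"
  assumes vs: "vector_space s"
    and w2: "\<And>a b. a < 6 \<Longrightarrow> b < 6 \<Longrightarrow> w2 a b + w2 b a = 0"
    and span: "\<And>y. \<exists>c. y = (\<Sum>a<6. \<Sum>b<6. s (c a b) (w2 a b))"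
    and p: "polyfun (frame_coords s 4) p"
    and zero: "\<And>w u A B. (\<And>j. j < 4 \<Longrightarrow> w j = (\<Sum>a<6. \<Sum>b<6. s (\<Sum>i<(5::nat). u i j * A i a * B i b) (w2 a b))) \<Longrightarrow> p w = 0"
  shows "p w = 0"
proof -
  interpret vector_space s by (rule vs)
  \<comment> \<open>The euclidean structure belongs to vectors indexed by the finite types 4, 5 and
    6; these enumerations translate to indices in the natural numbers.\<close>
  obtain h4 :: "nat \<Rightarrow> 4" where h4: "bij_betw h4 {..<4} UNIV"
    using ex_bij_betw_nat_finite[of "UNIV :: 4 set"] by (auto simp: lessThan_atLeast0)
  obtain h5 :: "nat \<Rightarrow> 5" where h5: "bij_betw h5 {..<5} UNIV"
    using ex_bij_betw_nat_finite[of "UNIV :: 5 set"] by (auto simp: lessThan_atLeast0)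
  obtain h6 :: "nat \<Rightarrow> 6" where h6: "bij_betw h6 {..<6} UNIV"
    using ex_bij_betw_nat_finite[of "UNIV :: 6 set"] by (auto simp: lessThan_atLeast0)
  define g4 g5 g6 where "g4 = the_inv_into {..<4} h4" and "g5 = the_inv_into {..<5} h5" and "g6 = the_inv_into {..<6} h6"
  have g4: "g4 (h4 j) = j" if "j < 4" for j
    using that h4 unfolding g4_def bij_betw_def by (simp add: the_inv_into_f_f)
  have g5: "g5 (h5 j) = j" if "j < 5" for j
    using that h5 unfolding g5_def bij_betw_def by (simp add: the_inv_into_f_f)
  have g6: "g6 (h6 j) = j" if "j < 6" for j
    using that h6 unfolding g6_def bij_betw_def by (simp add: the_inv_into_f_f)
  have h4s: "\<exists>i<4. h4 i = j" for j using h4 by (metis UNIV_I bij_betw_imp_surj_on imageE lessThan_iff)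
  have h6s: "\<exists>i<6. h6 i = j" for j using h6 by (metis UNIV_I bij_betw_imp_surj_on imageE lessThan_iff)
  note r4 = sum.reindex_bij_betw[OF h4, symmetric]
    and r5 = sum.reindex_bij_betw[OF h5, symmetric]
    and r6 = sum.reindex_bij_betw[OF h6, symmetric]
  define W where "W Y j = (\<Sum>a<6. \<Sum>b<6. s (Y $ h4 j $ h6 a $ h6 b) (w2 a b))" for Y :: "complex ^ 6 ^ 6 ^ 4" and j
  define L where "L = {\<lambda>Y :: complex ^ 6 ^ 6 ^ 4. Y $ j $ a $ b | j a b. True}"
  have pW: "polyfun L (\<lambda>Y. q (W Y))" if "polyfun (frame_coords s 4) q" for q
    using that
  proof induction
    case (polyfun_base l)
    then obtain j \<phi> where l: "l = (\<lambda>w. \<phi> (w j))" and \<phi>: "Vector_Spaces.linear s (*) \<phi>"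
      unfolding frame_coords_def by auto
    interpret \<phi>: Vector_Spaces.linear s "(*)" \<phi> by (rule \<phi>)
    have "(\<lambda>Y. l (W Y)) = (\<lambda>Y. \<Sum>a<6. \<Sum>b<6. Y $ h4 j $ h6 a $ h6 b * \<phi> (w2 a b))"
      by (simp add: l W_def \<phi>.sum \<phi>.scale)
    moreover have "polyfun L \<dots>"
      by (intro polyfun_sum polyfun_mult polyfun_const, rule polyfun.polyfun_base) (auto simp: L_def)
    ultimately show ?case by simp
  qed (auto intro: polyfun.intros)
  have Lline: "\<exists>c. \<forall>t. l (x + t *\<^sub>R v) = l x + of_real t * c" if "l \<in> L" for l x v
    using that by (auto simp: L_def scaleR_conv_of_real[where 'a = complex] intro!: exI[of _ "l v"])
  define x0 :: params where "x0 = (\<chi> i j. base_u (g5 i) (g4 j), \<chi> i a. base_a (g5 i) (g6 a), \<chi> i a. base_b (g5 i) (g6 a), 0)"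
  have lin: "linear (secant_deriv x0)" using secant_map_has_derivative by (rule has_derivative_linear)
  have "surj (secant_deriv x0)"
  proof (rule linear_surj_if_annihilator_zero[OF lin])
    fix \<theta> assume "\<And>x. \<theta> \<bullet> secant_deriv x0 x = 0"
    note ann = secant_annihilator[OF this[unfolded x0_def]]
    have "cnj (\<theta> $ h4 j $ h6 a $ h6 b) = 0" if "j < 4" "a < 6" "b < 6" for j a b
    proof (rule base_annihilator[OF _ _ _ _ that])
      show "cnj (\<theta> $ h4 j $ h6 a $ h6 b) + cnj (\<theta> $ h4 j $ h6 b $ h6 a) = 0" for j a b
        by (rule ann(1))
      show "(\<Sum>a<6. \<Sum>b<6. cnj (\<theta> $ h4 j $ h6 a $ h6 b) * base_a i a * base_b i b) = 0" if "i < 5" "j < 4" for i j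
        using ann(2)[of "h4 j" "h5 i"] that by (simp add: r6 g4 g5 g6)
      show "(\<Sum>j<4. base_u i j * (\<Sum>b<6. cnj (\<theta> $ h4 j $ h6 a $ h6 b) * base_b i b)) = 0" if "i < 5" "a < 6" for i a
        using ann(3)[of "h5 i" "h6 a"] that by (simp add: r4 r6 g4 g5 g6)
      show "(\<Sum>j<4. base_u i j * (\<Sum>a<6. cnj (\<theta> $ h4 j $ h6 a $ h6 b) * base_a i a)) = 0" if "i < 5" "b < 6" for i b
        using ann(4)[of "h5 i" "h6 b"] that by (simp add: r4 r6 g4 g5 g6)
    qed
    then have "\<theta> $ j $ a $ b = 0" for j a b
      using h4s[of j] h6s[of a] h6s[of b] by (metis complex_cnj_zero_iff)
    then show "\<theta> = 0" by (simp add: vec_eq_iff)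
  qed
  then obtain g where g: "linear g" "secant_deriv x0 \<circ> g = id"
    using linear_surjective_right_inverse[OF lin] by blast
  have "continuous_on UNIV secant_map"
    by (intro continuous_at_imp_continuous_on ballI has_derivative_continuous[OF secant_map_has_derivative])
  then have "secant_map x0 \<in> interior (range secant_map)"
    using sussmann_open_mapping[of UNIV secant_map x0 "secant_deriv x0" g UNIV]
      secant_map_has_derivative[of x0] g linear_conv_bounded_linear[of g] by simp
  then obtain e where e: "e > 0" "ball (secant_map x0) e \<subseteq> range secant_map"
    by (auto simp: mem_interior)
  have "p (W (secant_map x)) = 0" for x
  proof -
    obtain u A B N where x: "x = (u, A, B, N)" by (cases x)
    have "W (secant_map x) j = (\<Sum>a<6. \<Sum>b<6. s (\<Sum>i<5. u $ h5 i $ h4 j * A $ h5 i $ h6 a * B $ h5 i $ h6 b) (w2 a b))" for j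
    proof -
      let ?N = "\<lambda>a b. N $ h4 j $ h6 a $ h6 b"
      \<comment> \<open>The symmetric correction disappears because \<open>w2\<close> is
        skew.\<close>
      have "(\<Sum>a<6. \<Sum>b<6. s (?N a b) (w2 a b) + s (?N b a) (w2 a b)) =
          (\<Sum>a<6. \<Sum>b<6. s (?N a b) (w2 a b)) + (\<Sum>a<6. \<Sum>b<6. s (?N a b) (w2 b a))"
        by (simp add: sum.distrib) (rule sum.swap)
      also have "\<dots> = (\<Sum>a<6. \<Sum>b<6. s (?N a b) (w2 a b + w2 b a))"
        by (simp add: sum.distrib scale_right_distrib)
      also have "\<dots> = 0" using w2 by simp
      finally show ?thesis
        by (simp add: W_def x secant_map_def r5 scale_left_distrib sum.distrib add.assoc)
    qed
    then show ?thesis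
      by (intro zero[where u = "\<lambda>i j. u $ h5 i $ h4 j" and A = "\<lambda>i a. A $ h5 i $ h6 a" and B = "\<lambda>i a. B $ h5 i $ h6 a"]) auto
  qed
  then have pW0: "p (W Y) = 0" for Y
    using polyfun_zero_if_zero_on_ball[OF pW[OF p] Lline e(1), of "secant_map x0"] e(2)
    by (metis imageE subsetD)
  \<comment> \<open>On its first four vectors every frame agrees with \<open>W\<close> of an array
    of coefficients, so \<open>p\<close> vanishes on all frames.\<close>
  define c where "c y = (SOME c. y = (\<Sum>a<6. \<Sum>b<6. s (c a b) (w2 a b)))" for y
  have c: "y = (\<Sum>a<6. \<Sum>b<6. s (c y a b) (w2 a b))" for y
    unfolding c_def by (rule someI_ex[OF span])
  have "p w = p (W (\<chi> j a b. c (w (g4 j)) (g6 a) (g6 b)))"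
    by (rule polyfun_frame_cong[OF p]) (simp add: W_def g4 g6 c[symmetric])
  then show ?thesis using pW0 by simp
qed

section \<open>Families of vectors\<close>

lemma (in vector_space) independent_family_iff:
  assumes "finite I"
  shows "inj_on v I \<and> independent (v ` I) \<longleftrightarrow>
    (\<forall>c. (\<Sum>i\<in>I. scale (c i) (v i)) = 0 \<longrightarrow> (\<forall>i\<in>I. c i = 0))"
proof (intro iffI conjI)
  assume L: "inj_on v I \<and> independent (v ` I)"
  show "\<forall>c. (\<Sum>i\<in>I. scale (c i) (v i)) = 0 \<longrightarrow> (\<forall>i\<in>I. c i = 0)"
  proof (intro allI impI)
    fix c assume "(\<Sum>i\<in>I. scale (c i) (v i)) = 0"
    then have z: "(\<Sum>y\<in>v ` I. scale (c (the_inv_into I v y)) y) = 0"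
      using L by (simp add: sum.reindex the_inv_into_f_f)
    have "c (the_inv_into I v y) = 0" if "y \<in> v ` I" for y
      by (rule independentD[OF conjunct2[OF L] finite_imageI[OF assms] order_refl z that])
    then show "\<forall>i\<in>I. c i = 0" using the_inv_into_f_f[OF conjunct1[OF L]] by (metis imageI)
  qed
next
  assume R: "\<forall>c. (\<Sum>i\<in>I. scale (c i) (v i)) = 0 \<longrightarrow> (\<forall>i\<in>I. c i = 0)"
  show inj: "inj_on v I"
  proof (rule inj_onI, rule ccontr)
    fix i j assume ij: "i \<in> I" "j \<in> I" "v i = v j" "i \<noteq> j"
    define c where "c k = (if k = i then 1 else 0) - (if k = j then 1 else (0::'a))" for k
    have "(\<Sum>k\<in>I. scale (c k) (v k)) = (\<Sum>k\<in>I. if k = i then v k else 0) - (\<Sum>k\<in>I. if k = j then v k else 0)"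
      unfolding sum_subtractf[symmetric] by (intro sum.cong) (auto simp: c_def)
    then have "(\<Sum>k\<in>I. scale (c k) (v k)) = 0" using ij assms by simp
    then have "c i = 0" using R ij(1) by blast
    then show False using ij(4) by (simp add: c_def)
  qed
  show "independent (v ` I)"
  proof
    assume "dependent (v ` I)"
    then obtain u y where u: "y \<in> v ` I" "u y \<noteq> 0" "(\<Sum>y\<in>v ` I. scale (u y) y) = 0"
      using dependent_finite[of "v ` I"] assms by auto
    then have "(\<Sum>i\<in>I. scale (u (v i)) (v i)) = 0" using inj by (simp add: sum.reindex)
    then have "\<forall>i\<in>I. u (v i) = 0" using R[THEN spec[of _ "\<lambda>i. u (v i)"]] by blast
    then show False using u(1,2) by blast
  qed
qed

text \<open>A relation among the rows of \<open>C\<close> would be a relation among the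
  \<open>F j\<close>, so independence of \<open>F\<close> makes the square matrix \<open>C\<close>
  invertible. Its inverse expresses \<open>G\<close> through \<open>F\<close> and carries over
  independence. The members of both families are given through their coordinates
  \<open>\<kappa>\<close>.\<close>

lemma family_basis_change:
  fixes F :: "'j \<Rightarrow> 'k \<Rightarrow> complex" and G :: "'l \<Rightarrow> 'k \<Rightarrow> complex"
  assumes fin: "finite J" "finite L" "card J = card L"
    and C: "\<forall>j\<in>J. \<forall>\<kappa>\<in>K. F j \<kappa> = (\<Sum>l\<in>L. C j l * G l \<kappa>)"
    and ind: "\<forall>c. (\<forall>\<kappa>\<in>K. (\<Sum>j\<in>J. c j * F j \<kappa>) = 0) \<longrightarrow> (\<forall>j\<in>J. c j = 0)"
  shows "\<exists>B. \<forall>l\<in>L. \<forall>\<kappa>\<in>K. G l \<kappa> = (\<Sum>j\<in>J. B l j * F j \<kappa>)"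
    and "\<forall>c. (\<forall>\<kappa>\<in>K. (\<Sum>l\<in>L. c l * G l \<kappa>) = 0) \<longrightarrow> (\<forall>l\<in>L. c l = 0)"
proof -
  have inj: "\<forall>c. (\<forall>l\<in>L. (\<Sum>j\<in>J. C j l * c j) = 0) \<longrightarrow> (\<forall>j\<in>J. c j = 0)"
  proof (intro allI impI)
    fix c assume c: "\<forall>l\<in>L. (\<Sum>j\<in>J. C j l * c j) = 0"
    have "(\<Sum>j\<in>J. c j * F j \<kappa>) = 0" if "\<kappa> \<in> K" for \<kappa>
    proof -
      have "(\<Sum>j\<in>J. c j * F j \<kappa>) = (\<Sum>j\<in>J. \<Sum>l\<in>L. G l \<kappa> * (C j l * c j))"
        using C that by (intro sum.cong) (auto simp: sum_distrib_left mult_ac)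
      also have "\<dots> = (\<Sum>l\<in>L. G l \<kappa> * (\<Sum>j\<in>J. C j l * c j))"
        by (subst sum.swap) (simp add: sum_distrib_left)
      also have "\<dots> = 0" using c by simp
      finally show ?thesis .
    qed
    then have "\<forall>\<kappa>\<in>K. (\<Sum>j\<in>J. c j * F j \<kappa>) = 0" by (rule ballI)
    with ind[THEN spec[of _ c]] show "\<forall>j\<in>J. c j = 0" by (rule mp)
  qed
  from square_inverse[OF fin(2) fin(1) fin(3)[symmetric] inj]
  obtain B where BB: "(\<forall>i\<in>L. \<forall>i'\<in>L. (\<Sum>j\<in>J. C j i * B j i') = (if i = i' then 1 else 0)) \<and>
    (\<forall>j\<in>J. \<forall>j'\<in>J. (\<Sum>i\<in>L. B j i * C j' i) = (if j = j' then 1 else 0))"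
    by (rule exE)
  have B: "(\<Sum>j\<in>J. C j l * B j l') = (if l = l' then 1 else 0)" if "l \<in> L" "l' \<in> L" for l l'
    by (rule BB[THEN conjunct1, THEN bspec, OF that(1), THEN bspec, OF that(2)])
  have G: "G l \<kappa> = (\<Sum>j\<in>J. B j l * F j \<kappa>)" if "l \<in> L" "\<kappa> \<in> K" for l \<kappa>
  proof -
    have "(\<Sum>j\<in>J. B j l * F j \<kappa>) = (\<Sum>j\<in>J. \<Sum>l'\<in>L. G l' \<kappa> * (C j l' * B j l))"
      using C that by (intro sum.cong) (auto simp: sum_distrib_left mult_ac)
    also have "\<dots> = (\<Sum>l'\<in>L. G l' \<kappa> * (\<Sum>j\<in>J. C j l' * B j l))"
      by (subst sum.swap) (simp add: sum_distrib_left)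
    also have "\<dots> = (\<Sum>l'\<in>L. if l' = l then G l' \<kappa> else 0)"
      using B that by (intro sum.cong) auto
    also have "\<dots> = G l \<kappa>" using that fin by simp
    finally show ?thesis by simp
  qed
  show "\<exists>B. \<forall>l\<in>L. \<forall>\<kappa>\<in>K. G l \<kappa> = (\<Sum>j\<in>J. B l j * F j \<kappa>)"
    by (rule exI[of _ "\<lambda>l j. B j l"]) (simp add: G)
  show "\<forall>c. (\<forall>\<kappa>\<in>K. (\<Sum>l\<in>L. c l * G l \<kappa>) = 0) \<longrightarrow> (\<forall>l\<in>L. c l = 0)"
  proof (intro allI impI)
    fix c assume c: "\<forall>\<kappa>\<in>K. (\<Sum>l\<in>L. c l * G l \<kappa>) = 0"
    have "\<forall>\<kappa>\<in>K. (\<Sum>j\<in>J. (\<Sum>l\<in>L. c l * B j l) * F j \<kappa>) = 0"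
    proof
      fix \<kappa> assume "\<kappa> \<in> K"
      have "(\<Sum>j\<in>J. (\<Sum>l\<in>L. c l * B j l) * F j \<kappa>) = (\<Sum>j\<in>J. \<Sum>l\<in>L. c l * (B j l * F j \<kappa>))"
        by (simp add: sum_distrib_right mult.assoc)
      also have "\<dots> = (\<Sum>l\<in>L. c l * (\<Sum>j\<in>J. B j l * F j \<kappa>))"
        by (subst sum.swap) (simp add: sum_distrib_left)
      also have "\<dots> = 0" using c G \<open>\<kappa> \<in> K\<close> by simp
      finally show "(\<Sum>j\<in>J. (\<Sum>l\<in>L. c l * B j l) * F j \<kappa>) = 0" .
    qed
    with ind[THEN spec[of _ "\<lambda>j. \<Sum>l\<in>L. c l * B j l"]]
    have "\<forall>j\<in>J. (\<Sum>l\<in>L. c l * B j l) = 0" by (rule mp)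
    then have z: "(\<Sum>l'\<in>L. c l' * B j l') = 0" if "j \<in> J" for j using that by blast
    show "\<forall>l\<in>L. c l = 0"
    proof
      fix l assume l: "l \<in> L"
      have "0 = (\<Sum>j\<in>J. C j l * (\<Sum>l'\<in>L. c l' * B j l'))" using z by simp
      also have "\<dots> = (\<Sum>j\<in>J. \<Sum>l'\<in>L. c l' * (C j l * B j l'))"
        by (simp add: sum_distrib_left mult_ac)
      also have "\<dots> = (\<Sum>l'\<in>L. c l' * (\<Sum>j\<in>J. C j l * B j l'))"
        by (subst sum.swap) (simp add: sum_distrib_left)
      also have "\<dots> = (\<Sum>l'\<in>L. if l' = l then c l' else 0)"
        using B l by (intro sum.cong) auto
      also have "\<dots> = c l" using l fin by simp
      finally show "c l = 0" by simp
    qed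
  qed
qed

text \<open>\<open>pairs 5\<close> indexes the products of two different \<open>\<omega> i\<close>,
  and \<open>upairs 4\<close> the products of two frame vectors, squares included. That both have
  ten elements is the numerical coincidence on which the argument rests.\<close>

definition pairs :: "nat \<Rightarrow> (nat \<times> nat) set" where
  "pairs n = {(i, l). i < l \<and> l < n}"

definition upairs :: "nat \<Rightarrow> (nat \<times> nat) set" where
  "upairs n = {(i, l). i \<le> l \<and> l < n}"

lemma pairs_5: "pairs 5 = {(0, 1), (0, 2), (0, 3), (0, 4), (1, 2), (1, 3), (1, 4), (2, 3), (2, 4), (3, 4)}"
proof -
  have "pairs 5 = set (filter (\<lambda>(i, l). i < l) (List.product [0..<5] [0..<5]))"
    by (auto simp: pairs_def)
  also have "\<dots> = {(0, 1), (0, 2), (0, 3), (0, 4), (1, 2), (1, 3), (1, 4), (2, 3), (2, 4), (3, 4)}"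
    by code_simp
  finally show ?thesis .
qed

lemma sum_pairs_5: "(\<Sum>p\<in>pairs 5. f p) = f (0, 1) + f (0, 2) + f (0, 3) + f (0, 4) + f (1, 2)
    + f (1, 3) + f (1, 4) + f (2, 3) + f (2, 4) + (f (3, 4) :: 'a::comm_monoid_add)"
  by (simp add: pairs_5 add.assoc)

lemma upairs_4: "upairs 4 = {(0, 0), (0, 1), (0, 2), (0, 3), (1, 1), (1, 2), (1, 3), (2, 2), (2, 3), (3, 3)}"
proof -
  have "upairs 4 = set (filter (\<lambda>(i, l). i \<le> l) (List.product [0..<4] [0..<4]))"
    by (auto simp: upairs_def)
  also have "\<dots> = {(0, 0), (0, 1), (0, 2), (0, 3), (1, 1), (1, 2), (1, 3), (2, 2), (2, 3), (3, 3)}"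
    by code_simp
  finally show ?thesis .
qed

lemma sum_upairs_4: "(\<Sum>p\<in>upairs 4. f p) = f (0, 0) + f (0, 1) + f (0, 2) + f (0, 3) + f (1, 1)
    + f (1, 2) + f (1, 3) + f (2, 2) + f (2, 3) + (f (3, 3) :: 'a::comm_monoid_add)"
  by (simp add: upairs_4 add.assoc)

lemma finite_pairs: "finite (pairs 5)" "finite (upairs 4)" "card (upairs 4) = card (pairs 5)"
  by (simp_all add: pairs_5 upairs_4)

lemma sum_isotropic:
  fixes f :: "nat \<Rightarrow> nat \<Rightarrow> complex"
  assumes "\<And>i. i < 5 \<Longrightarrow> f i i = 0" "\<And>i l. f i l = f l i"
  shows "(\<Sum>i<5. \<Sum>l<5. a i * b l * f i l) = (\<Sum>p\<in>pairs 5. (a (fst p) * b (snd p) + a (snd p) * b (fst p)) * f (fst p) (snd p))"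
proof -
  note f = assms(1)[of 0] assms(1)[of 1] assms(1)[of 2] assms(1)[of 3] assms(1)[of 4]
    assms(2)[of 1 0] assms(2)[of 2 0] assms(2)[of 3 0] assms(2)[of 4 0] assms(2)[of 2 1]
    assms(2)[of 3 1] assms(2)[of 4 1] assms(2)[of 3 2] assms(2)[of 4 2] assms(2)[of 4 3]
  show ?thesis
    by (simp add: sum_lessThan_5 sum_pairs_5 f distrib_right add_ac del: One_nat_def)
qed

lemma sum_symmetric:
  fixes f :: "nat \<Rightarrow> nat \<Rightarrow> complex"
  assumes "\<And>i l. f i l = f l i"
  shows "(\<Sum>i<4. \<Sum>l<4. x i * x l * f i l) =
    (\<Sum>p\<in>upairs 4. (if fst p = snd p then 1 else 2) * x (fst p) * x (snd p) * f (fst p) (snd p))"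
proof -
  note f = assms(1)[of 1 0] assms(1)[of 2 0] assms(1)[of 3 0] assms(1)[of 2 1] assms(1)[of 3 1] assms(1)[of 3 2]
  show ?thesis
    by (simp add: sum_lessThan_4 sum_upairs_4 f del: One_nat_def)
qed

section \<open>Open subsets of the Grassmannian\<close>

lemma pluecker_form_power:
  assumes "pluecker_form s k 1 F"
  shows "pluecker_form s k n (\<lambda>w. F w ^ n)"
proof (induction n)
  case 0
  show ?case using pluecker_form.const[of s k 1] by simp
next
  case (Suc n)
  show ?case using pluecker_form.mult[OF assms Suc] by simp
qed

definition coord_mat :: "nat \<Rightarrow> (nat \<Rightarrow> 'e \<Rightarrow> complex) \<Rightarrow> (nat \<Rightarrow> 'e) \<Rightarrow> complex mat" where
  "coord_mat k \<phi> w = Matrix.mat k k (\<lambda>(i, j). \<phi> i (w j))"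

text \<open>The frame of the same subspace on which the forms \<open>\<phi>\<close> take the values of the identity matrix.\<close>

definition reduced_frame ::
  "(complex \<Rightarrow> 'e::ab_group_add \<Rightarrow> 'e) \<Rightarrow> nat \<Rightarrow> (nat \<Rightarrow> 'e \<Rightarrow> complex) \<Rightarrow> (nat \<Rightarrow> 'e) \<Rightarrow> nat \<Rightarrow> 'e" where
  "reduced_frame s k \<phi> w j =
    (\<Sum>l<k. s (adj_mat (coord_mat k \<phi> w) $$ (l, j) / Determinant.det (coord_mat k \<phi> w)) (w l))"

lemma coord_mat_carrier: "coord_mat k \<phi> w \<in> carrier_mat k k"
  by (simp add: coord_mat_def)

text \<open>Homogenization on the chart where the determinant is nonzero. By Cramer's rule the value
  of a form \<open>\<psi>\<close> on vector \<open>j\<close> of the reduced frame is a quotient of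
  two Pluecker coordinates, the numerator having \<open>\<phi> j\<close> replaced by
  \<open>\<psi>\<close>.\<close>

lemma pluecker_form_of_polyfun:
  assumes \<phi>: "\<And>i. i < k \<Longrightarrow> Vector_Spaces.linear s (*) (\<phi> i)"
    and G: "polyfun (frame_coords s k) G"
  shows "\<exists>d F. pluecker_form s k d F \<and> (\<forall>w. Determinant.det (coord_mat k \<phi> w) \<noteq> 0 \<longrightarrow>
    F w = Determinant.det (coord_mat k \<phi> w) ^ d * G (reduced_frame s k \<phi> w))"
  using G
proof induction
  case (polyfun_const c)
  show ?case
    using pluecker_form.const[of s k c] by (intro exI[of _ 0] exI[of _ "\<lambda>w. c"]) simp
next
  case (polyfun_base l)
  then obtain j \<psi> where l: "l = (\<lambda>w. \<psi> (w j))" and j: "j < k" and \<psi>: "Vector_Spaces.linear s (*) \<psi>"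
    unfolding frame_coords_def by auto
  let ?F = "\<lambda>w. Determinant.det (Matrix.mat k k (\<lambda>(i, m). (\<phi>(j := \<psi>)) i (w m)))"
  have "pluecker_form s k 1 ?F"
    by (rule pluecker_form.coordinate) (auto simp: \<phi> \<psi>)
  moreover have "?F w = Determinant.det (coord_mat k \<phi> w) ^ 1 * l (reduced_frame s k \<phi> w)"
    if nz: "Determinant.det (coord_mat k \<phi> w) \<noteq> 0" for w
  proof -
    let ?M = "coord_mat k \<phi> w"
    let ?M' = "Matrix.mat k k (\<lambda>(i, m). (\<phi>(j := \<psi>)) i (w m))"
    interpret \<psi>: Vector_Spaces.linear s "(*)" \<psi> by (rule \<psi>)
    have "cofactor ?M' j m = cofactor ?M j m" if "m < k" for m
    proof -
      have "mat_delete ?M' j m = mat_delete ?M j m"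
        unfolding mat_delete_def coord_mat_def using j that by (intro eq_matI) auto
      then show ?thesis by (simp add: cofactor_def)
    qed
    then have "?F w = (\<Sum>m<k. \<psi> (w m) * cofactor ?M j m)"
      using j by (subst laplace_expansion_row[of _ k j]) auto
    moreover have "Determinant.det ?M * \<psi> (reduced_frame s k \<phi> w j) = (\<Sum>m<k. \<psi> (w m) * cofactor ?M j m)"
      using nz j by (simp add: reduced_frame_def \<psi>.sum \<psi>.scale sum_distrib_left adj_mat_def coord_mat_def mult.commute)
    ultimately show ?thesis by (simp add: l)
  qed
  ultimately show ?case by (intro exI[of _ 1] exI[of _ ?F]) simp
next
  case (polyfun_add f g)
  let ?p = "\<lambda>w. Determinant.det (coord_mat k \<phi> w)"
  have p: "pluecker_form s k 1 ?p"
    unfolding coord_mat_def by (rule pluecker_form.coordinate) (rule \<phi>)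
  obtain d F e H where F: "pluecker_form s k d F" "\<forall>w. ?p w \<noteq> 0 \<longrightarrow> F w = ?p w ^ d * f (reduced_frame s k \<phi> w)"
    and H: "pluecker_form s k e H" "\<forall>w. ?p w \<noteq> 0 \<longrightarrow> H w = ?p w ^ e * g (reduced_frame s k \<phi> w)"
    using polyfun_add.IH by blast
  \<comment> \<open>Powers of the determinant bring both summands to the common degree
    \<open>d + e\<close>.\<close>
  have "pluecker_form s k (e + d) (\<lambda>w. ?p w ^ e * F w)"
    by (intro pluecker_form.mult pluecker_form_power p F)
  moreover have "pluecker_form s k (d + e) (\<lambda>w. ?p w ^ d * H w)"
    by (intro pluecker_form.mult pluecker_form_power p H)
  ultimately have "pluecker_form s k (d + e) (\<lambda>w. ?p w ^ e * F w + ?p w ^ d * H w)"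
    by (intro pluecker_form.add) (simp_all add: add.commute)
  then show ?case
    using F(2) H(2) by (intro exI[of _ "d + e"] exI[of _ "\<lambda>w. ?p w ^ e * F w + ?p w ^ d * H w"])
      (simp add: power_add algebra_simps)
next
  case (polyfun_mult f g)
  let ?p = "\<lambda>w. Determinant.det (coord_mat k \<phi> w)"
  obtain d F e H where F: "pluecker_form s k d F" "\<forall>w. ?p w \<noteq> 0 \<longrightarrow> F w = ?p w ^ d * f (reduced_frame s k \<phi> w)"
    and H: "pluecker_form s k e H" "\<forall>w. ?p w \<noteq> 0 \<longrightarrow> H w = ?p w ^ e * g (reduced_frame s k \<phi> w)"
    using polyfun_mult.IH by blast
  have "pluecker_form s k (d + e) (\<lambda>w. F w * H w)"
    by (intro pluecker_form.mult F H)
  then show ?case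
    using F(2) H(2) by (intro exI[of _ "d + e"] exI[of _ "\<lambda>w. F w * H w"])
      (simp add: power_add mult_ac)
qed

lemma (in vector_space) span_family:
  assumes "finite I"
  shows "x \<in> span (v ` I) \<longleftrightarrow> (\<exists>c. x = (\<Sum>i\<in>I. scale (c i) (v i)))"
proof
  let ?S = "{x. \<exists>c. x = (\<Sum>i\<in>I. scale (c i) (v i))}"
  have "subspace ?S"
  proof (rule subspaceI)
    show "0 \<in> ?S" by (auto intro!: exI[of _ "\<lambda>_. 0"])
    show "x + y \<in> ?S" if xy: "x \<in> ?S" "y \<in> ?S" for x y
    proof -
      obtain c d where "x = (\<Sum>i\<in>I. scale (c i) (v i))" "y = (\<Sum>i\<in>I. scale (d i) (v i))" using xy by blast
      then have "x + y = (\<Sum>i\<in>I. scale (c i + d i) (v i))" by (simp add: scale_left_distrib sum.distrib)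
      then show ?thesis by (intro CollectI exI[of _ "\<lambda>i. c i + d i"])
    qed
    show "scale a x \<in> ?S" if x: "x \<in> ?S" for a x
    proof -
      obtain c where "x = (\<Sum>i\<in>I. scale (c i) (v i))" using x by blast
      then have "scale a x = (\<Sum>i\<in>I. scale (a * c i) (v i))" by (simp add: scale_sum_right)
      then show ?thesis by (intro CollectI exI[of _ "\<lambda>i. a * c i"])
    qed
  qed
  moreover have "v ` I \<subseteq> ?S"
  proof
    fix x assume "x \<in> v ` I"
    then obtain i where i: "i \<in> I" "x = v i" by blast
    have "(\<Sum>j\<in>I. scale (if j = i then 1 else 0) (v j)) = (\<Sum>j\<in>I. if j = i then v j else 0)"
      by (intro sum.cong) auto
    then have "x = (\<Sum>j\<in>I. scale (if j = i then 1 else 0) (v j))" using i assms by simp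
    then show "x \<in> ?S" by (intro CollectI exI[of _ "\<lambda>j. if j = i then 1 else 0"])
  qed
  ultimately have "span (v ` I) \<subseteq> ?S" by (intro span_minimal)
  then show "\<exists>c. x = (\<Sum>i\<in>I. scale (c i) (v i))" if "x \<in> span (v ` I)" using that by blast
  show "x \<in> span (v ` I)" if "\<exists>c. x = (\<Sum>i\<in>I. scale (c i) (v i))"
    using that by (auto intro!: span_sum span_scale intro: span_base)
qed

text \<open>The reduced frame is obtained from \<open>w\<close> by the inverse of the coordinate
  matrix, so the coordinate matrix leads back to \<open>w\<close>.\<close>

lemma span_reduced_frame:
  assumes vs: "vector_space s" and nz: "Determinant.det (coord_mat k \<phi> w) \<noteq> 0"
  shows "module.span s (reduced_frame s k \<phi> w ` {..<k}) = module.span s (w ` {..<k})"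
proof -
  interpret vector_space s by (rule vs)
  let ?M = "coord_mat k \<phi> w"
  let ?r = "reduced_frame s k \<phi> w"
  have "?r j \<in> span (w ` {..<k})" for j
    unfolding reduced_frame_def by (intro span_sum span_scale span_base) auto
  then have 1: "?r ` {..<k} \<subseteq> span (w ` {..<k})" by blast
  have "w m \<in> span (?r ` {..<k})" if m: "m < k" for m
  proof -
    have "(\<Sum>j<k. s (?M $$ (j, m)) (?r j)) = (\<Sum>j<k. \<Sum>l<k. s (?M $$ (j, m) * (adj_mat ?M $$ (l, j) / Determinant.det ?M)) (w l))"
      by (simp add: reduced_frame_def scale_sum_right)
    also have "\<dots> = (\<Sum>l<k. s (\<Sum>j<k. ?M $$ (j, m) * (adj_mat ?M $$ (l, j) / Determinant.det ?M)) (w l))"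
      by (subst sum.swap) (simp add: scale_sum_left)
    also have "\<dots> = (\<Sum>l<k. s (if l = m then 1 else 0) (w l))"
    proof (intro sum.cong refl arg_cong2[of _ _ _ _ s])
      fix l assume "l \<in> {..<k}"
      then have "(\<Sum>j<k. adj_mat ?M $$ (l, j) * ?M $$ (j, m)) = (if l = m then Determinant.det ?M else 0)"
        using adj_mat_sum(1)[OF coord_mat_carrier, of l k m \<phi> w] m by simp
      then have "(\<Sum>j<k. adj_mat ?M $$ (l, j) * ?M $$ (j, m)) / Determinant.det ?M = (if l = m then 1 else 0)"
        using nz by simp
      then show "(\<Sum>j<k. ?M $$ (j, m) * (adj_mat ?M $$ (l, j) / Determinant.det ?M)) = (if l = m then 1 else 0)"
        by (simp add: sum_divide_distrib mult.commute)
    qed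
    also have "\<dots> = (\<Sum>l<k. if l = m then w l else 0)" by (intro sum.cong) auto
    also have "\<dots> = w m" using m by simp
    finally show ?thesis
      using span_sum[of "{..<k}" "\<lambda>j. s (?M $$ (j, m)) (?r j)" "?r ` {..<k}"] by (auto intro: span_scale span_base)
  qed
  then have 2: "w ` {..<k} \<subseteq> span (?r ` {..<k})" by blast
  show ?thesis using span_minimal[OF 1 subspace_span] span_minimal[OF 2 subspace_span] by blast
qed

text \<open>The value of \<open>G\<close> depends on the frame and not only on its span. It is
  therefore taken at the reduced frame, which the subspace determines, and homogenized to a form
  \<open>F\<close>; the other factor of \<open>H\<close> confines everything to the chart. Since the
  forms are dual to \<open>w\<^sub>0\<close>, this frame agrees with its reduced frame, and the open
  set is nonempty.\<close>

lemma zariski_open_frames: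
  assumes vs: "vector_space s" and \<phi>: "\<And>i. i < k \<Longrightarrow> Vector_Spaces.linear s (*) (\<phi> i)"
    and G: "polyfun (frame_coords s k) G" "G w\<^sub>0 \<noteq> 0"
    and w\<^sub>0: "\<And>i j. i < k \<Longrightarrow> j < k \<Longrightarrow> \<phi> i (w\<^sub>0 j) = (if i = j then 1 else 0)"
  shows "\<exists>Om. zariski_open s k Om \<and> Om \<noteq> {} \<and>
    (\<forall>W\<in>Om. \<exists>w. G w \<noteq> 0 \<and> W = module.span s (w ` {..<k}))"
proof -
  interpret vector_space s by (rule vs)
  let ?p = "\<lambda>w. Determinant.det (coord_mat k \<phi> w)"
  obtain d F where F: "pluecker_form s k d F"
    "\<forall>w. ?p w \<noteq> 0 \<longrightarrow> F w = ?p w ^ d * G (reduced_frame s k \<phi> w)"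
    using pluecker_form_of_polyfun[of k s \<phi>, OF \<phi> G(1)] by blast
  have p: "pluecker_form s k 1 ?p"
    unfolding coord_mat_def by (rule pluecker_form.coordinate) (rule \<phi>)
  define H where "H w = ?p w * F w" for w
  have H: "pluecker_form s k (1 + d) H"
    using pluecker_form.mult[OF p F(1)] unfolding H_def .
  define Om where "Om = {W \<in> grassmannian s k. \<exists>w. is_frame s k w W \<and> H w \<noteq> 0}"
  have "grassmannian s k - Om = {W \<in> grassmannian s k. \<forall>F\<in>{H}. \<forall>w. is_frame s k w W \<longrightarrow> F w = 0}"
    unfolding Om_def by auto
  then have "zariski_open s k Om"
    unfolding zariski_open_def zariski_closed_def using H by (intro conjI exI[of _ "{H}"]) (auto simp: Om_def)
  moreover have "Om \<noteq> {}"
  proof -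
    have "\<forall>i\<in>{..<k}. c i = 0" if c: "(\<Sum>i<k. s (c i) (w\<^sub>0 i)) = 0" for c
    proof
      fix m assume "m \<in> {..<k}"
      then have m: "m < k" by simp
      interpret f: Vector_Spaces.linear s "(*)" "\<phi> m" by (rule \<phi>[OF m])
      have "0 = \<phi> m (\<Sum>i<k. s (c i) (w\<^sub>0 i))" using c by simp
      also have "\<dots> = (\<Sum>i<k. if i = m then c i else 0)"
        unfolding f.sum f.scale using m by (intro sum.cong) (auto simp: w\<^sub>0)
      finally show "c m = 0" using m by simp
    qed
    then have ind: "inj_on w\<^sub>0 {..<k}" "independent (w\<^sub>0 ` {..<k})"
      using independent_family_iff[of "{..<k}" w\<^sub>0] by auto
    have fr: "is_frame s k w\<^sub>0 (span (w\<^sub>0 ` {..<k}))" using ind by (simp add: is_frame_def)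
    have gr: "span (w\<^sub>0 ` {..<k}) \<in> grassmannian s k"
      unfolding grassmannian_def using ind by (intro CollectI exI[of _ "w\<^sub>0 ` {..<k}"]) (auto simp: card_image)
    have one: "coord_mat k \<phi> w\<^sub>0 = 1\<^sub>m k"
      unfolding coord_mat_def by (intro eq_matI) (auto simp: w\<^sub>0)
    have det: "?p w\<^sub>0 = 1" by (simp add: one)
    have adj: "adj_mat (1\<^sub>m k) = (1\<^sub>m k :: complex mat)"
    proof -
      have "(1\<^sub>m k :: complex mat) * adj_mat (1\<^sub>m k) = 1 \<cdot>\<^sub>m 1\<^sub>m k"
        using adj_mat(2)[of "1\<^sub>m k :: complex mat" k] by simp
      moreover have "1 \<cdot>\<^sub>m 1\<^sub>m k = (1\<^sub>m k :: complex mat)" by (intro eq_matI) auto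
      ultimately show ?thesis using left_mult_one_mat[OF adj_mat(1)[of "1\<^sub>m k :: complex mat" k]] by simp
    qed
    have "reduced_frame s k \<phi> w\<^sub>0 j = w\<^sub>0 j" if "j < k" for j
    proof -
      have "reduced_frame s k \<phi> w\<^sub>0 j = (\<Sum>l<k. if l = j then w\<^sub>0 l else 0)"
        unfolding reduced_frame_def det unfolding one adj using that by (intro sum.cong) auto
      then show ?thesis using that by simp
    qed
    then have "G (reduced_frame s k \<phi> w\<^sub>0) = G w\<^sub>0" by (intro polyfun_frame_cong[OF G(1)])
    then have "H w\<^sub>0 \<noteq> 0" using F(2) det G(2) by (simp add: H_def)
    then have "span (w\<^sub>0 ` {..<k}) \<in> Om" unfolding Om_def using fr gr by blast
    then show ?thesis by blast
  qed
  moreover have "\<exists>w. G w \<noteq> 0 \<and> W = span (w ` {..<k})" if "W \<in> Om" for W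
  proof -
    obtain w where w: "is_frame s k w W" "H w \<noteq> 0" using \<open>W \<in> Om\<close> by (auto simp: Om_def)
    then have nz: "?p w \<noteq> 0" "F w \<noteq> 0" by (auto simp: H_def)
    then have "G (reduced_frame s k \<phi> w) \<noteq> 0" using F(2) by auto
    moreover have "W = span (reduced_frame s k \<phi> w ` {..<k})"
      using span_reduced_frame[OF vs nz(1)] w(1) by (simp add: is_frame_def)
    ultimately show ?thesis by blast
  qed
  ultimately show ?thesis by blast
qed

section \<open>Webs of quadrics\<close>

text \<open>The product \<open>y \<and> z\<close> enters through its coordinates \<open>P y z \<kappa>\<close>; so decomposable vectors are
  the common isotropic vectors of the quadratic forms \<open>y \<mapsto> P y y \<kappa>\<close>.\<close>

locale secant_web = vector_space s
  for s :: "complex \<Rightarrow> 'e::ab_group_add \<Rightarrow> 'e" +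
  fixes P :: "'e \<Rightarrow> 'e \<Rightarrow> 'k \<Rightarrow> complex" and K :: "'k set"
    and X :: "'q \<Rightarrow> 'e \<Rightarrow> complex" and \<epsilon> :: "'q \<Rightarrow> 'e" and Q :: "'q set"
    and \<omega>\<^sub>0 :: "nat \<Rightarrow> 'e"
  assumes finite_K: "finite K" and finite_Q: "finite Q"
    and P_linear: "\<And>\<kappa> z. \<kappa> \<in> K \<Longrightarrow> Vector_Spaces.linear s (*) (\<lambda>y. P y z \<kappa>)"
    and P_sym: "\<And>y z \<kappa>. P y z \<kappa> = P z y \<kappa>"
    and X_linear: "\<And>q. q \<in> Q \<Longrightarrow> Vector_Spaces.linear s (*) (X q)"
    and X_\<epsilon>: "\<And>q q'. q \<in> Q \<Longrightarrow> q' \<in> Q \<Longrightarrow> X q (\<epsilon> q') = (if q = q' then 1 else 0)"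
    and X_rep: "\<And>y. y = (\<Sum>q\<in>Q. s (X q y) (\<epsilon> q))"
    and base_isotropic: "\<And>i \<kappa>. i < 5 \<Longrightarrow> \<kappa> \<in> K \<Longrightarrow> P (\<omega>\<^sub>0 i) (\<omega>\<^sub>0 i) \<kappa> = 0"
    and base_products: "\<And>c. (\<And>\<kappa>. \<kappa> \<in> K \<Longrightarrow> (\<Sum>p\<in>pairs 5. c p * P (\<omega>\<^sub>0 (fst p)) (\<omega>\<^sub>0 (snd p)) \<kappa>) = 0)
      \<Longrightarrow> \<forall>p\<in>pairs 5. c p = 0"
    and base_stab: "\<And>\<eta>. (\<And>j. j < 4 \<Longrightarrow> \<exists>c. \<forall>\<kappa>\<in>K. P \<eta> (\<omega>\<^sub>0 j + \<omega>\<^sub>0 4) \<kappa> =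
        (\<Sum>p\<in>pairs 5. c p * P (\<omega>\<^sub>0 (fst p)) (\<omega>\<^sub>0 (snd p)) \<kappa>)) \<Longrightarrow> \<exists>t. \<eta> = (\<Sum>i<5. s (t i) (\<omega>\<^sub>0 i))"
    and dense: "\<And>p w. polyfun (frame_coords s 4) p \<Longrightarrow>
      (\<And>w (\<omega> :: nat \<Rightarrow> 'e) (u :: nat \<Rightarrow> nat \<Rightarrow> complex). (\<And>i. i < 5 \<Longrightarrow> \<forall>\<kappa>\<in>K. P (\<omega> i) (\<omega> i) \<kappa> = 0) \<Longrightarrow>
         (\<And>j. j < 4 \<Longrightarrow> w j = (\<Sum>i<5. s (u j i) (\<omega> i))) \<Longrightarrow> p w = 0) \<Longrightarrow> p w = 0"
begin

lemma X_cong: "(\<And>q. q \<in> Q \<Longrightarrow> X q y = X q z) \<Longrightarrow> y = z"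
  using X_rep[of y] X_rep[of z] by simp

lemma linear_sum_scale:
  assumes "Vector_Spaces.linear s (*) f"
  shows "f (\<Sum>i\<in>I. s (t i) (v i)) = (\<Sum>i\<in>I. t i * f (v i))"
proof -
  interpret Vector_Spaces.linear s "(*)" f by (rule assms)
  show ?thesis by (simp add: sum scale)
qed

lemma P_sum1: "\<kappa> \<in> K \<Longrightarrow> P (\<Sum>i\<in>I. s (t i) (v i)) z \<kappa> = (\<Sum>i\<in>I. t i * P (v i) z \<kappa>)"
  using linear_sum_scale[OF P_linear] .

lemma P_sum2: "\<kappa> \<in> K \<Longrightarrow> P z (\<Sum>i\<in>I. s (t i) (v i)) \<kappa> = (\<Sum>i\<in>I. t i * P z (v i) \<kappa>)"
  using P_sum1[of \<kappa> t v I z] by (simp add: P_sym[of z])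

lemma P_scale1: "\<kappa> \<in> K \<Longrightarrow> P (s c y) z \<kappa> = c * P y z \<kappa>"
  using P_sum1[of \<kappa> "\<lambda>_. c" "\<lambda>_. y" "{0::nat}" z] by simp

definition isotropic :: "(nat \<Rightarrow> 'e) \<Rightarrow> bool" where
  "isotropic \<omega> \<longleftrightarrow> (\<forall>i<5. \<forall>\<kappa>\<in>K. P (\<omega> i) (\<omega> i) \<kappa> = 0)"

definition comb :: "(nat \<Rightarrow> complex) \<Rightarrow> (nat \<Rightarrow> 'e) \<Rightarrow> 'e" where
  "comb t \<omega> = (\<Sum>i<5. s (t i) (\<omega> i))"

lemma P_comb:
  assumes "isotropic \<omega>" "\<kappa> \<in> K"
  shows "P (comb a \<omega>) (comb b \<omega>) \<kappa> =
    (\<Sum>p\<in>pairs 5. (a (fst p) * b (snd p) + a (snd p) * b (fst p)) * P (\<omega> (fst p)) (\<omega> (snd p)) \<kappa>)"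
proof -
  have "P (comb a \<omega>) (comb b \<omega>) \<kappa> = (\<Sum>i<5. \<Sum>l<5. a i * b l * P (\<omega> i) (\<omega> l) \<kappa>)"
    unfolding comb_def P_sum1[OF assms(2)] by (simp add: P_sum2[OF assms(2)] sum_distrib_left mult.assoc)
  also have "\<dots> = (\<Sum>p\<in>pairs 5. (a (fst p) * b (snd p) + a (snd p) * b (fst p)) * P (\<omega> (fst p)) (\<omega> (snd p)) \<kappa>)"
    using assms by (intro sum_isotropic) (auto simp: isotropic_def P_sym)
  finally show ?thesis .
qed

definition products_independent :: "(nat \<Rightarrow> 'e) \<Rightarrow> bool" where
  "products_independent \<omega> \<longleftrightarrow> (\<forall>c. (\<forall>\<kappa>\<in>K. (\<Sum>p\<in>pairs 5. c p * P (\<omega> (fst p)) (\<omega> (snd p)) \<kappa>) = 0)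
      \<longrightarrow> (\<forall>p\<in>pairs 5. c p = 0))"

definition squares_independent :: "(nat \<Rightarrow> 'e) \<Rightarrow> bool" where
  "squares_independent w \<longleftrightarrow> (\<forall>c. (\<forall>\<kappa>\<in>K. (\<Sum>p\<in>upairs 4. c p * P (w (fst p)) (w (snd p)) \<kappa>) = 0)
      \<longrightarrow> (\<forall>p\<in>upairs 4. c p = 0))"

text \<open>The products of the \<open>w j\<close> are combinations of the products of the
  \<open>\<omega> i\<close>, because the squares of the \<open>\<omega> i\<close> vanish. Both
  families have ten members, so independence passes from the former to the latter and the
  combinations can be inverted.\<close>

lemma products_from_squares:
  assumes "isotropic \<omega>" "\<And>j. j < 4 \<Longrightarrow> w j = comb (u j) \<omega>" "squares_independent w"
  shows "products_independent \<omega>"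
    and "\<exists>B. \<forall>p\<in>pairs 5. \<forall>\<kappa>\<in>K. P (\<omega> (fst p)) (\<omega> (snd p)) \<kappa> = (\<Sum>q\<in>upairs 4. B p q * P (w (fst q)) (w (snd q)) \<kappa>)"
proof -
  have PW: "P (w (fst q)) (w (snd q)) \<kappa> = (\<Sum>p\<in>pairs 5. (u (fst q) (fst p) * u (snd q) (snd p)
        + u (fst q) (snd p) * u (snd q) (fst p)) * P (\<omega> (fst p)) (\<omega> (snd p)) \<kappa>)"
      if "q \<in> upairs 4" "\<kappa> \<in> K" for q \<kappa>
    using that assms(2)[of "fst q"] assms(2)[of "snd q"] P_comb[OF assms(1) that(2)]
    by (auto simp: upairs_def)
  note change = family_basis_change[of "upairs 4" "pairs 5" K "\<lambda>q. P (w (fst q)) (w (snd q))"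
      "\<lambda>q p. u (fst q) (fst p) * u (snd q) (snd p) + u (fst q) (snd p) * u (snd q) (fst p)"
      "\<lambda>p. P (\<omega> (fst p)) (\<omega> (snd p))", OF finite_pairs(2,1,3) _ assms(3)[unfolded squares_independent_def]]
  show "products_independent \<omega>"
    unfolding products_independent_def by (rule change(2)) (intro ballI PW)
  show "\<exists>B. \<forall>p\<in>pairs 5. \<forall>\<kappa>\<in>K. P (\<omega> (fst p)) (\<omega> (snd p)) \<kappa> = (\<Sum>q\<in>upairs 4. B p q * P (w (fst q)) (w (snd q)) \<kappa>)"
    by (rule change(1)) (intro ballI PW)
qed

text \<open>Multiplying the relation \<open>comb t \<omega> = 0\<close> by \<open>\<omega> k\<close>
  leaves a relation among the products with index \<open>k\<close>, which kills every
  \<open>t l\<close> with \<open>l \<noteq> k\<close>.\<close>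

lemma independent_if_products_independent:
  assumes "isotropic \<omega>" "products_independent \<omega>" "comb t \<omega> = 0" "i < 5"
  shows "t i = 0"
proof -
  have key: "t l = 0" if k: "k < 5" "l < 5" "l \<noteq> k" for k l
  proof -
    define e where "e i = (if i = k then 1 else 0 :: complex)" for i
    define d where "d p = t (fst p) * e (snd p) + t (snd p) * e (fst p)" for p
    have "\<forall>\<kappa>\<in>K. (\<Sum>p\<in>pairs 5. d p * P (\<omega> (fst p)) (\<omega> (snd p)) \<kappa>) = 0"
    proof
      fix \<kappa> assume \<kappa>: "\<kappa> \<in> K"
      have "P (comb t \<omega>) (comb e \<omega>) \<kappa> = 0"
        using P_scale1[OF \<kappa>, of 0 0 "comb e \<omega>"] by (simp add: assms(3))
      then show "(\<Sum>p\<in>pairs 5. d p * P (\<omega> (fst p)) (\<omega> (snd p)) \<kappa>) = 0"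
        unfolding P_comb[OF assms(1) \<kappa>] d_def .
    qed
    with assms(2)[unfolded products_independent_def, THEN spec[of _ d]]
    have d: "\<forall>p\<in>pairs 5. d p = 0" by (rule mp)
    have *: "t a * e b + t b * e a = 0" if "(a, b) \<in> pairs 5" for a b
      using d[THEN bspec, OF that] by (simp add: d_def)
    show ?thesis
      using k *[of k l] *[of l k] by (cases "k < l") (auto simp: pairs_def e_def)
  qed
  \<comment> \<open>Any \<open>k < 5\<close> other than \<open>i\<close> will do.\<close>
  show ?thesis using key[of "if i = 0 then 1 else 0" i] assms(4) by auto
qed

lemma isotropic_base: "isotropic \<omega>\<^sub>0"
  using base_isotropic by (simp add: isotropic_def)

lemma products_independent_base: "products_independent \<omega>\<^sub>0"
  unfolding products_independent_def
proof (intro allI impI)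
  fix c assume "\<forall>\<kappa>\<in>K. (\<Sum>p\<in>pairs 5. c p * P (\<omega>\<^sub>0 (fst p)) (\<omega>\<^sub>0 (snd p)) \<kappa>) = 0"
  then show "\<forall>p\<in>pairs 5. c p = 0" by (intro base_products) (rule bspec)
qed

lemmas base_independent = independent_if_products_independent[OF isotropic_base products_independent_base]

definition w\<^sub>0 :: "nat \<Rightarrow> 'e" where
  "w\<^sub>0 j = \<omega>\<^sub>0 j + \<omega>\<^sub>0 4"

lemma w\<^sub>0_comb: "j < 4 \<Longrightarrow> w\<^sub>0 j = comb (\<lambda>i. (if i = j then 1 else 0) + (if i = 4 then 1 else 0)) \<omega>\<^sub>0"
  by (simp add: w\<^sub>0_def comb_def scale_left_distrib sum.distrib if_distrib[of "\<lambda>x. s x _"] cong: if_cong)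

text \<open>Forms dual to the basis \<open>w\<^sub>0 0\<close>, ..., \<open>w\<^sub>0 3\<close>,
  \<open>\<omega>\<^sub>0 4\<close> of the base subspace of dimension five. The first four define
  the chart of the Grassmannian; all five normalize the extra vector of the stabilizer.\<close>

lemma base_dual:
  obtains \<phi> where "\<And>m. Vector_Spaces.linear s (*) (\<phi> m)"
    "\<And>m j. m < 5 \<Longrightarrow> j < 4 \<Longrightarrow> \<phi> m (w\<^sub>0 j) = (if m = j then 1 else 0)"
    "\<And>m. m < 5 \<Longrightarrow> \<phi> m (\<omega>\<^sub>0 4) = (if m = 4 then 1 else 0)"
proof -
  define v where "v j = (if j = 4 then \<omega>\<^sub>0 4 else w\<^sub>0 j)" for j
  have fam: "\<forall>i\<in>{..<5}. c i = 0" if "(\<Sum>i<5. s (c i) (v i)) = 0" for c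
  proof -
    \<comment> \<open>Each of the five vectors \<open>v j\<close> contains
      \<open>\<omega>\<^sub>0 4\<close> exactly once, hence the full sum in the last
      coefficient.\<close>
    define d where "d i = (if i = 4 then \<Sum>j<5. c j else c i)" for i
    have "(\<Sum>i<5. s (c i) (v i)) = comb d \<omega>\<^sub>0"
      by (simp add: sum_lessThan_5 comb_def d_def v_def w\<^sub>0_def scale_left_distrib scale_right_distrib del: One_nat_def)
    then have d: "d i = 0" if "i < 5" for i
      using base_independent[OF _ that, of d] \<open>(\<Sum>i<5. s (c i) (v i)) = 0\<close> by simp
    have c: "c i = 0" if "i < 4" for i using d[of i] that by (simp add: d_def)
    have "c 4 = 0" using d[of 4] c[of 0] c[of 1] c[of 2] c[of 3] by (simp add: d_def sum_lessThan_5)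
    show ?thesis
    proof
      fix i :: nat assume "i \<in> {..<5}"
      then show "c i = 0" using c[of i] \<open>c 4 = 0\<close> by (cases "i = 4") auto
    qed
  qed
  then have v: "inj_on v {..<5}" "independent (v ` {..<5})"
    using independent_family_iff[of "{..<5}" v, THEN iffD2] fam by simp_all
  interpret C: vector_space "(*) :: complex \<Rightarrow> complex \<Rightarrow> complex"
    by unfold_locales (auto simp: algebra_simps)
  interpret EC: vector_space_pair s "(*) :: complex \<Rightarrow> complex \<Rightarrow> complex" ..
  have "\<exists>f. Vector_Spaces.linear s (*) f \<and> (\<forall>y\<in>v ` {..<5}. f y = (if y = v m then 1 else 0))" for m
    by (rule EC.linear_independent_extend[OF v(2)])
  then have "\<exists>\<phi>. \<forall>m. Vector_Spaces.linear s (*) (\<phi> m) \<and> (\<forall>y\<in>v ` {..<5}. \<phi> m y = (if y = v m then 1 else 0))"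
    by (intro choice allI)
  then obtain \<phi> where \<phi>: "\<And>m. Vector_Spaces.linear s (*) (\<phi> m)"
    "\<And>m y. y \<in> v ` {..<5} \<Longrightarrow> \<phi> m y = (if y = v m then 1 else 0)"
    by blast
  have \<phi>v: "\<phi> m (v j) = (if m = j then 1 else 0)" if "m < 5" "j < 5" for m j
    using \<phi>(2)[of "v j" m] that v(1) by (auto simp: inj_on_def)
  show thesis
  proof (rule that)
    show "Vector_Spaces.linear s (*) (\<phi> m)" for m by (rule \<phi>(1))
    show "\<phi> m (w\<^sub>0 j) = (if m = j then 1 else 0)" if "m < 5" "j < 4" for m j
      using \<phi>v[of m j] that by (simp add: v_def)
    show "\<phi> m (\<omega>\<^sub>0 4) = (if m = 4 then 1 else 0)" if "m < 5" for m
      using \<phi>v[of m 4] that by (simp add: v_def)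
  qed
qed

end

section \<open>The linear system that defines the stabilizer\<close>

locale secant_web_dual = secant_web s P K X \<epsilon> Q \<omega>\<^sub>0
  for s :: "complex \<Rightarrow> 'e::ab_group_add \<Rightarrow> 'e" and P :: "'e \<Rightarrow> 'e \<Rightarrow> 'k \<Rightarrow> complex" and K
    and X :: "'q \<Rightarrow> 'e \<Rightarrow> complex" and \<epsilon> Q \<omega>\<^sub>0 +
  fixes \<phi> :: "nat \<Rightarrow> 'e \<Rightarrow> complex"
  assumes \<phi>_linear: "\<And>m. Vector_Spaces.linear s (*) (\<phi> m)"
    and \<phi>_w\<^sub>0: "\<And>m j. m < 5 \<Longrightarrow> j < 4 \<Longrightarrow> \<phi> m (w\<^sub>0 j) = (if m = j then 1 else 0)"
    and \<phi>_\<omega>\<^sub>0: "\<And>m. m < 5 \<Longrightarrow> \<phi> m (\<omega>\<^sub>0 4) = (if m = 4 then 1 else 0)"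
begin

abbreviation "FC \<equiv> frame_coords s 4"

lemma polyfun_coord: "Vector_Spaces.linear s (*) f \<Longrightarrow> j < 4 \<Longrightarrow> polyfun FC (\<lambda>w. f (w j))"
  by (rule polyfun_base) (auto simp: frame_coords_def)

lemma P_rep: "\<kappa> \<in> K \<Longrightarrow> P y z \<kappa> = (\<Sum>q\<in>Q. X q y * P (\<epsilon> q) z \<kappa>)"
  using arg_cong[OF X_rep[of y], of "\<lambda>y. P y z \<kappa>"] P_sum1[of \<kappa> "\<lambda>q. X q y" \<epsilon> Q z] by simp

lemma polyfun_P\<epsilon>: "\<kappa> \<in> K \<Longrightarrow> j < 4 \<Longrightarrow> polyfun FC (\<lambda>w. P (\<epsilon> q) (w j) \<kappa>)"
  using polyfun_coord[OF P_linear, of \<kappa> j "\<epsilon> q"] by (simp add: P_sym[of "\<epsilon> q"])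

lemma polyfun_P:
  assumes "\<kappa> \<in> K" "j < 4" "k < 4"
  shows "polyfun FC (\<lambda>w. P (w j) (w k) \<kappa>)"
proof -
  have "polyfun FC (\<lambda>w. \<Sum>q\<in>Q. X q (w j) * P (\<epsilon> q) (w k) \<kappa>)"
    using assms by (intro polyfun_sum polyfun_mult polyfun_coord polyfun_P\<epsilon> X_linear)
  then show ?thesis by (simp only: P_rep[OF assms(1), symmetric])
qed

text \<open>Invertibility of the 4 by 4 coordinate matrix, phrased as injectivity to match
  \<open>rat_solve\<close>.\<close>

definition nondeg :: "(nat \<Rightarrow> 'e) \<Rightarrow> bool" where
  "nondeg w \<longleftrightarrow> (\<forall>x. (\<forall>m\<in>{..<4}. (\<Sum>j<4. \<phi> m (w j) * x j) = 0) \<longrightarrow> (\<forall>j\<in>{..<4}. x j = 0))"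

definition stab :: "(nat \<Rightarrow> 'e) \<Rightarrow> 'e \<Rightarrow> (nat \<Rightarrow> nat \<times> nat \<Rightarrow> complex) \<Rightarrow> bool" where
  "stab w \<eta> a \<longleftrightarrow> (\<forall>i<4. \<forall>\<kappa>\<in>K. P \<eta> (w i) \<kappa> = (\<Sum>p\<in>upairs 4. a i p * P (w (fst p)) (w (snd p)) \<kappa>))"

text \<open>The five forms are jointly injective on the stabilizer, which bounds its dimension by
  five without counting dimensions.\<close>

definition stab_unique :: "(nat \<Rightarrow> 'e) \<Rightarrow> bool" where
  "stab_unique w \<longleftrightarrow> (\<forall>\<eta> a. stab w \<eta> a \<longrightarrow> (\<forall>m<5. \<phi> m \<eta> = 0) \<longrightarrow> \<eta> = 0)"

text \<open>The matrix of the linear system expressing \<open>stab w \<eta> a\<close>, with prescribed values \<open>\<phi> m \<eta>\<close>; the unknowns are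
  the coordinates of \<open>\<eta>\<close> and the coefficients \<open>a\<close>.\<close>

definition sys :: "(nat \<times> 'k) + nat \<Rightarrow> 'q + (nat \<times> nat \<times> nat) \<Rightarrow> (nat \<Rightarrow> 'e) \<Rightarrow> complex" where
  "sys r c w = (case r of
      Inl (i, \<kappa>) \<Rightarrow> (case c of Inl q \<Rightarrow> P (\<epsilon> q) (w i) \<kappa>
        | Inr (i', p) \<Rightarrow> if i = i' then - P (w (fst p)) (w (snd p)) \<kappa> else 0)
    | Inr m \<Rightarrow> (case c of Inl q \<Rightarrow> \<phi> m (\<epsilon> q) | Inr _ \<Rightarrow> 0))"

abbreviation "sys_rows \<equiv> ({..<4::nat} \<times> K) <+> {..<5::nat}"
abbreviation "sys_cols \<equiv> Q <+> ({..<4::nat} \<times> upairs 4)"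

definition unknowns :: "'e \<Rightarrow> (nat \<Rightarrow> nat \<times> nat \<Rightarrow> complex) \<Rightarrow> 'q + (nat \<times> nat \<times> nat) \<Rightarrow> complex" where
  "unknowns \<eta> a c = (case c of Inl q \<Rightarrow> X q \<eta> | Inr (i, p) \<Rightarrow> a i p)"

lemma finite_rows: "finite sys_rows" and finite_cols: "finite sys_cols"
  using finite_K finite_Q finite_pairs by auto

lemma sum_cols: "(\<Sum>c\<in>sys_cols. f c) = (\<Sum>q\<in>Q. f (Inl q)) + (\<Sum>i<4. \<Sum>p\<in>upairs 4. f (Inr (i, p)))"
  using finite_Q finite_pairs by (subst sum.Plus) (auto simp: sum.cartesian_product)

lemma sys_Inl:
  assumes "i < 4" "\<kappa> \<in> K"
  shows "(\<Sum>c\<in>sys_cols. sys (Inl (i, \<kappa>)) c w * unknowns \<eta> a c) =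
    P \<eta> (w i) \<kappa> - (\<Sum>p\<in>upairs 4. a i p * P (w (fst p)) (w (snd p)) \<kappa>)"
proof -
  have "(\<Sum>i'<4. \<Sum>p\<in>upairs 4. (if i = i' then - P (w (fst p)) (w (snd p)) \<kappa> else 0) * a i' p) =
      (\<Sum>i'<4. if i' = i then - (\<Sum>p\<in>upairs 4. a i p * P (w (fst p)) (w (snd p)) \<kappa>) else 0)"
    by (intro sum.cong) (auto simp: sum_negf mult.commute)
  also have "\<dots> = - (\<Sum>p\<in>upairs 4. a i p * P (w (fst p)) (w (snd p)) \<kappa>)" using assms(1) by simp
  finally show ?thesis
    unfolding sum_cols by (simp add: sys_def unknowns_def P_rep[OF assms(2), of \<eta>] mult.commute)
qed

lemma sys_Inr: "(\<Sum>c\<in>sys_cols. sys (Inr m) c w * unknowns \<eta> a c) = \<phi> m \<eta>"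
  unfolding sum_cols
  using arg_cong[OF X_rep[of \<eta>], of "\<phi> m"] linear_sum_scale[OF \<phi>_linear[of m], of "\<lambda>q. X q \<eta>" \<epsilon> Q]
  by (simp add: sys_def unknowns_def mult.commute)

lemma unknowns_surj:
  "\<exists>\<eta> a. \<forall>x\<in>sys_cols. c x = unknowns \<eta> a x"
proof (intro exI ballI)
  fix x assume "x \<in> sys_cols"
  moreover have "X q (\<Sum>q\<in>Q. s (c (Inl q)) (\<epsilon> q)) = c (Inl q)" if "q \<in> Q" for q
  proof -
    have "X q (\<Sum>q\<in>Q. s (c (Inl q)) (\<epsilon> q)) = (\<Sum>q'\<in>Q. c (Inl q') * (if q' = q then 1 else 0))"
      using that by (subst linear_sum_scale[OF X_linear[OF that]]) (auto intro!: sum.cong simp: X_\<epsilon>)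
    also have "\<dots> = (\<Sum>q'\<in>Q. if q' = q then c (Inl q') else 0)" by (intro sum.cong) auto
    also have "\<dots> = c (Inl q)" using that finite_Q by simp
    finally show ?thesis .
  qed
  ultimately show "c x = unknowns (\<Sum>q\<in>Q. s (c (Inl q)) (\<epsilon> q)) (\<lambda>i p. c (Inr (i, p))) x"
    by (auto simp: unknowns_def)
qed

lemma base_square:
  assumes "j < 4" "k < 4" "\<kappa> \<in> K"
  shows "P (w\<^sub>0 j) (w\<^sub>0 k) \<kappa> = (\<Sum>p\<in>pairs 5.
    (((if fst p = j then 1 else 0) + (if fst p = 4 then 1 else 0)) * ((if snd p = k then 1 else 0) + (if snd p = 4 then 1 else 0)) +
     ((if snd p = j then 1 else 0) + (if snd p = 4 then 1 else 0)) * ((if fst p = k then 1 else 0) + (if fst p = 4 then 1 else 0))) *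
      P (\<omega>\<^sub>0 (fst p)) (\<omega>\<^sub>0 (snd p)) \<kappa>)"
  unfolding w\<^sub>0_comb[OF assms(1)] w\<^sub>0_comb[OF assms(2)] by (rule P_comb[OF isotropic_base assms(3)])

text \<open>Write o_i for the base bivectors. Isotropy turns the square of
  \<open>w\<^sub>0 j\<close> into 2 o_j o_4, and the product of \<open>w\<^sub>0 j\<close> and
  \<open>w\<^sub>0 k\<close> into o_j o_k + o_j o_4 + o_k o_4 for \<open>j \<noteq> k\<close>: a
  triangular change of basis.\<close>

lemma base_squares_independent: "squares_independent w\<^sub>0"
  unfolding squares_independent_def
proof (intro allI impI)
  fix c assume c: "\<forall>\<kappa>\<in>K. (\<Sum>p\<in>upairs 4. c p * P (w\<^sub>0 (fst p)) (w\<^sub>0 (snd p)) \<kappa>) = 0"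
  \<comment> \<open>\<open>M q p\<close> is the coefficient of the base product \<open>p\<close> in
    the frame product \<open>q\<close>.\<close>
  define M where "M q p = ((if fst p = fst q then 1 else 0) + (if fst p = (4::nat) then 1 else 0)) * ((if snd p = snd q then 1 else 0) + (if snd p = 4 then 1 else 0)) +
     ((if snd p = fst q then 1 else 0) + (if snd p = (4::nat) then 1 else 0)) * ((if fst p = snd q then 1 else 0) + (if fst p = 4 then 1 else (0::complex)))" for p q
  have "(\<Sum>p\<in>pairs 5. (\<Sum>q\<in>upairs 4. c q * M q p) * P (\<omega>\<^sub>0 (fst p)) (\<omega>\<^sub>0 (snd p)) \<kappa>) = 0" if "\<kappa> \<in> K" for \<kappa>
  proof -
    have "(\<Sum>q\<in>upairs 4. c q * P (w\<^sub>0 (fst q)) (w\<^sub>0 (snd q)) \<kappa>) =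
        (\<Sum>q\<in>upairs 4. \<Sum>p\<in>pairs 5. c q * M q p * P (\<omega>\<^sub>0 (fst p)) (\<omega>\<^sub>0 (snd p)) \<kappa>)"
      using that by (intro sum.cong refl, subst base_square) (auto simp: upairs_def M_def sum_distrib_left mult.assoc)
    also have "\<dots> = (\<Sum>p\<in>pairs 5. (\<Sum>q\<in>upairs 4. c q * M q p) * P (\<omega>\<^sub>0 (fst p)) (\<omega>\<^sub>0 (snd p)) \<kappa>)"
      by (subst sum.swap) (simp add: sum_distrib_right)
    finally show ?thesis using c that by simp
  qed
  then have "\<forall>\<kappa>\<in>K. (\<Sum>p\<in>pairs 5. (\<Sum>q\<in>upairs 4. c q * M q p) * P (\<omega>\<^sub>0 (fst p)) (\<omega>\<^sub>0 (snd p)) \<kappa>) = 0"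
    by (rule ballI)
  with products_independent_base[unfolded products_independent_def, THEN spec[of _ "\<lambda>p. \<Sum>q\<in>upairs 4. c q * M q p"]]
  have "\<forall>p\<in>pairs 5. (\<Sum>q\<in>upairs 4. c q * M q p) = 0" by (rule mp)
  note e = this[unfolded pairs_5 ball_simps, simplified sum_upairs_4 M_def, simplified]
  show "\<forall>p\<in>upairs 4. c p = 0"
    using e by (auto simp: upairs_4)
qed

lemma \<phi>_comb_base:
  assumes "m < 5" "\<And>m. m < 5 \<Longrightarrow> \<phi> m (comb t \<omega>\<^sub>0) = 0"
  shows "t m = 0"
proof -
  have \<phi>\<omega>: "\<phi> m (\<omega>\<^sub>0 j) = (if m = j then 1 else 0) - (if m = 4 then 1 else 0)" if "m < 5" "j < 4" for m j
  proof -
    interpret f: Vector_Spaces.linear s "(*)" "\<phi> m" by (rule \<phi>_linear)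
    have "\<phi> m (w\<^sub>0 j) = \<phi> m (\<omega>\<^sub>0 j) + \<phi> m (\<omega>\<^sub>0 4)" by (simp add: w\<^sub>0_def f.add)
    then show ?thesis using \<phi>_w\<^sub>0[OF that] \<phi>_\<omega>\<^sub>0[OF that(1)] by simp
  qed
  have sum: "\<phi> m (comb t \<omega>\<^sub>0) = (\<Sum>i<5. t i * \<phi> m (\<omega>\<^sub>0 i))" for m
    unfolding comb_def by (rule linear_sum_scale[OF \<phi>_linear])
  have lt: "t m = 0" if "m < 4" for m
  proof -
    have "(\<Sum>i<5. t i * \<phi> m (\<omega>\<^sub>0 i)) = (\<Sum>i<5. if i = m then t i else 0)"
    proof (intro sum.cong refl)
      fix i :: nat assume "i \<in> {..<5}"
      then have "i < 4 \<or> i = 4" by auto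
      then show "t i * \<phi> m (\<omega>\<^sub>0 i) = (if i = m then t i else 0)"
        using that \<phi>\<omega>[of m i] \<phi>_\<omega>\<^sub>0[of m] by auto
    qed
    then show ?thesis using assms(2)[of m] that sum[of m] by simp
  qed
  have "t 4 = 0"
    using assms(2)[of 4] sum[of 4] \<phi>_\<omega>\<^sub>0[of 4] lt[of 0] lt[of 1] lt[of 2] lt[of 3] by (simp add: sum_lessThan_5)
  then show ?thesis using lt[of m] assms(1) by (cases "m = 4") auto
qed

text \<open>The products of the frame vectors lie in the span of the base products, so
  \<open>base_stab\<close> puts \<open>\<eta>\<close> into the span of the base bivectors, where the
  five forms are injective.\<close>

lemma base_stab_zero:
  assumes "stab w\<^sub>0 \<eta> a" "\<And>m. m < 5 \<Longrightarrow> \<phi> m \<eta> = 0"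
  shows "\<eta> = 0"
proof -
  have "\<exists>t. \<eta> = (\<Sum>i<5. s (t i) (\<omega>\<^sub>0 i))"
  proof (rule base_stab)
    fix j :: nat assume j: "j < 4"
    define M where "M q p = ((if fst p = fst q then 1 else 0) + (if fst p = (4::nat) then 1 else 0)) * ((if snd p = snd q then 1 else 0) + (if snd p = 4 then 1 else 0)) +
       ((if snd p = fst q then 1 else 0) + (if snd p = (4::nat) then 1 else 0)) * ((if fst p = snd q then 1 else 0) + (if fst p = 4 then 1 else (0::complex)))" for p q
    have "P \<eta> (\<omega>\<^sub>0 j + \<omega>\<^sub>0 4) \<kappa> = (\<Sum>p\<in>pairs 5. (\<Sum>q\<in>upairs 4. a j q * M q p) * P (\<omega>\<^sub>0 (fst p)) (\<omega>\<^sub>0 (snd p)) \<kappa>)" if "\<kappa> \<in> K" for \<kappa>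
    proof -
      have "P \<eta> (\<omega>\<^sub>0 j + \<omega>\<^sub>0 4) \<kappa> = (\<Sum>q\<in>upairs 4. a j q * P (w\<^sub>0 (fst q)) (w\<^sub>0 (snd q)) \<kappa>)"
        using assms(1) j that by (simp add: stab_def w\<^sub>0_def)
      also have "\<dots> = (\<Sum>q\<in>upairs 4. \<Sum>p\<in>pairs 5. a j q * M q p * P (\<omega>\<^sub>0 (fst p)) (\<omega>\<^sub>0 (snd p)) \<kappa>)"
        using that by (intro sum.cong refl, subst base_square) (auto simp: upairs_def M_def sum_distrib_left mult.assoc)
      also have "\<dots> = (\<Sum>p\<in>pairs 5. (\<Sum>q\<in>upairs 4. a j q * M q p) * P (\<omega>\<^sub>0 (fst p)) (\<omega>\<^sub>0 (snd p)) \<kappa>)"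
        by (subst sum.swap) (simp add: sum_distrib_right)
      finally show ?thesis .
    qed
    then show "\<exists>c. \<forall>\<kappa>\<in>K. P \<eta> (\<omega>\<^sub>0 j + \<omega>\<^sub>0 4) \<kappa> = (\<Sum>p\<in>pairs 5. c p * P (\<omega>\<^sub>0 (fst p)) (\<omega>\<^sub>0 (snd p)) \<kappa>)"
      by (intro exI[of _ "\<lambda>p. \<Sum>q\<in>upairs 4. a j q * M q p"] ballI)
  qed
  then obtain t where t: "\<eta> = comb t \<omega>\<^sub>0" by (auto simp: comb_def)
  have "t m = 0" if "m < 5" for m
    using \<phi>_comb_base[OF that, of t] assms(2) t by blast
  then show ?thesis unfolding t comb_def by simp
qed

text \<open>Since the products of the \<open>\<omega> i\<close> are combinations of the products of
  the \<open>w j\<close>, so are all products of two vectors in the span of \<open>\<omega>\<close>.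
  In particular this whole span stabilizes.\<close>

lemma comb_products:
  assumes "isotropic \<omega>" "\<And>j. j < 4 \<Longrightarrow> w j = comb (u j) \<omega>" "squares_independent w"
  shows "\<exists>g. \<forall>\<kappa>\<in>K. P (comb t \<omega>) (comb t' \<omega>) \<kappa> = (\<Sum>q\<in>upairs 4. g q * P (w (fst q)) (w (snd q)) \<kappa>)"
proof -
  obtain B where B: "\<forall>p\<in>pairs 5. \<forall>\<kappa>\<in>K. P (\<omega> (fst p)) (\<omega> (snd p)) \<kappa> = (\<Sum>q\<in>upairs 4. B p q * P (w (fst q)) (w (snd q)) \<kappa>)"
    using products_from_squares(2)[OF assms] by blast
  define C where "C p = t (fst p) * t' (snd p) + t (snd p) * t' (fst p)" for p
  have "P (comb t \<omega>) (comb t' \<omega>) \<kappa> = (\<Sum>q\<in>upairs 4. (\<Sum>p\<in>pairs 5. C p * B p q) * P (w (fst q)) (w (snd q)) \<kappa>)" if "\<kappa> \<in> K" for \<kappa>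
  proof -
    have "P (comb t \<omega>) (comb t' \<omega>) \<kappa> = (\<Sum>p\<in>pairs 5. C p * (\<Sum>q\<in>upairs 4. B p q * P (w (fst q)) (w (snd q)) \<kappa>))"
      unfolding P_comb[OF assms(1) that] C_def using B that by (intro sum.cong) auto
    also have "\<dots> = (\<Sum>p\<in>pairs 5. \<Sum>q\<in>upairs 4. C p * B p q * P (w (fst q)) (w (snd q)) \<kappa>)"
      by (simp add: sum_distrib_left mult.assoc)
    also have "\<dots> = (\<Sum>q\<in>upairs 4. (\<Sum>p\<in>pairs 5. C p * B p q) * P (w (fst q)) (w (snd q)) \<kappa>)"
      by (subst sum.swap) (simp add: sum_distrib_right)
    finally show ?thesis .
  qed
  then show ?thesis by (intro exI[of _ "\<lambda>q. \<Sum>p\<in>pairs 5. C p * B p q"] ballI)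
qed

text \<open>Every vector in the span of \<open>\<omega>\<close> stabilizes. By
  \<open>stab_unique\<close> the five forms are then injective on this span of dimension five, so
  the normalization can be solved there.\<close>

lemma secant_solution:
  assumes "isotropic \<omega>" "\<And>j. j < 4 \<Longrightarrow> w j = comb (u j) \<omega>" "squares_independent w" "stab_unique w"
  shows "\<exists>t a g. stab w (comb t \<omega>) a \<and> (\<forall>m<5. \<phi> m (comb t \<omega>) = (if m = 4 then 1 else 0)) \<and>
    (\<forall>\<kappa>\<in>K. P (comb t \<omega>) (comb t \<omega>) \<kappa> = (\<Sum>q\<in>upairs 4. g q * P (w (fst q)) (w (snd q)) \<kappa>))"
proof -
  have st: "\<exists>a. stab w (comb t \<omega>) a" for t
  proof -
    have "\<exists>g. \<forall>\<kappa>\<in>K. P (comb t \<omega>) (w i) \<kappa> = (\<Sum>q\<in>upairs 4. g q * P (w (fst q)) (w (snd q)) \<kappa>)" if "i < 4" for i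
      using comb_products[OF assms(1-3), of t "u i"] assms(2)[OF that] by simp
    then have "\<forall>i\<in>{..<4}. \<exists>g. \<forall>\<kappa>\<in>K. P (comb t \<omega>) (w i) \<kappa> = (\<Sum>q\<in>upairs 4. g q * P (w (fst q)) (w (snd q)) \<kappa>)"
      by simp
    then have "\<exists>a. \<forall>i\<in>{..<4}. \<forall>\<kappa>\<in>K. P (comb t \<omega>) (w i) \<kappa> = (\<Sum>q\<in>upairs 4. a i q * P (w (fst q)) (w (snd q)) \<kappa>)"
      by (rule bchoice)
    then show ?thesis by (simp only: stab_def Ball_def lessThan_iff)
  qed
  have PI: "products_independent \<omega>"
    by (rule products_from_squares(1)[OF assms(1) assms(2) assms(3)])
  have sum: "\<phi> m (comb t \<omega>) = (\<Sum>i<5. \<phi> m (\<omega> i) * t i)" for m t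
    unfolding comb_def by (simp add: linear_sum_scale[OF \<phi>_linear] mult.commute)
  have "\<forall>c. (\<forall>m\<in>{..<5}. (\<Sum>i<5. \<phi> m (\<omega> i) * c i) = 0) \<longrightarrow> (\<forall>i\<in>{..<5}. c i = 0)"
  proof (intro allI impI)
    fix c assume "\<forall>m\<in>{..<5}. (\<Sum>i<5. \<phi> m (\<omega> i) * c i) = 0"
    then have "\<forall>m<5. \<phi> m (comb c \<omega>) = 0" by (simp add: sum)
    then have "comb c \<omega> = 0" using assms(4) st[of c] unfolding stab_unique_def by blast
    then have "c i = 0" if "i < 5" for i
      by (rule independent_if_products_independent[OF assms(1) PI _ that])
    then show "\<forall>i\<in>{..<5}. c i = 0" by simp
  qed
  from square_inverse[OF finite_lessThan finite_lessThan refl this]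
  obtain B where BB: "(\<forall>i\<in>{..<5}. \<forall>i'\<in>{..<5}. (\<Sum>j<5. \<phi> i (\<omega> j) * B j i') = (if i = i' then 1 else 0)) \<and>
      (\<forall>j\<in>{..<5}. \<forall>j'\<in>{..<5}. (\<Sum>i<5. B j i * \<phi> i (\<omega> j')) = (if j = j' then 1 else 0))"
    by (rule exE)
  note B = BB[THEN conjunct1]
  \<comment> \<open>The last column of the inverse matrix solves for the values 0, 0, 0, 0, 1 of the
    five forms.\<close>
  define t where "t i = B i 4" for i
  have "\<forall>m<5. \<phi> m (comb t \<omega>) = (if m = 4 then 1 else 0)" using B by (simp add: sum t_def)
  moreover obtain a where "stab w (comb t \<omega>) a" using st by (rule exE)
  moreover have "\<exists>g. \<forall>\<kappa>\<in>K. P (comb t \<omega>) (comb t \<omega>) \<kappa> = (\<Sum>q\<in>upairs 4. g q * P (w (fst q)) (w (snd q)) \<kappa>)"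
    by (rule comb_products[OF assms(1) assms(2) assms(3)])
  ultimately show ?thesis by (elim exE) (intro exI conjI)
qed

text \<open>This is how \<open>dense\<close> is used. Clearing denominators turns a rational
  identity into a polynomial one, which spreads to all frames from the special ones, those inside a
  span of five isotropic vectors.\<close>

lemma rat_zero:
  assumes "polyfun FC D" "rat FC D f" "D w \<noteq> 0"
    and zero: "\<And>w \<omega> u. isotropic \<omega> \<Longrightarrow> (\<And>j. j < 4 \<Longrightarrow> w j = comb (u j) \<omega>) \<Longrightarrow> D w \<noteq> 0 \<Longrightarrow> f w = 0"
  shows "f w = 0"
proof -
  obtain n p where p: "polyfun FC p" "\<And>w. D w \<noteq> 0 \<Longrightarrow> D w ^ n * f w = p w"
    using assms(2) unfolding rat_def by metis
  \<comment> \<open>The factor \<open>D\<close> is kept because \<open>p\<close> is not controlled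
    at special frames where \<open>D\<close> vanishes.\<close>
  have "D w * p w = 0"
  proof (rule dense)
    show "polyfun FC (\<lambda>w. D w * p w)" by (intro polyfun_mult assms p)
    fix w :: "nat \<Rightarrow> 'e" and \<omega> and u :: "nat \<Rightarrow> nat \<Rightarrow> complex"
    assume *: "\<And>i. i < 5 \<Longrightarrow> \<forall>\<kappa>\<in>K. P (\<omega> i) (\<omega> i) \<kappa> = 0" "\<And>j. j < 4 \<Longrightarrow> w j = (\<Sum>i<5. s (u j i) (\<omega> i))"
    show "D w * p w = 0"
    proof (cases "D w = 0")
      case False
      have "f w = 0" by (rule zero[of \<omega> w u]) (use * False in \<open>auto simp: isotropic_def comb_def\<close>)
      then show ?thesis using p(2)[OF False] by simp
    qed simp
  qed
  then show ?thesis using p(2)[OF assms(3)] assms(3) by simp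
qed

end

section \<open>The stabilizer of a generic frame\<close>

context secant_web_dual
begin

lemma sys_iff:
  "(\<forall>r\<in>sys_rows. (\<Sum>x\<in>sys_cols. sys r x w * unknowns \<eta> a x) = (case r of Inl _ \<Rightarrow> 0 | Inr m \<Rightarrow> b m)) \<longleftrightarrow>
    stab w \<eta> a \<and> (\<forall>m<5. \<phi> m \<eta> = b m)"
proof -
  have "(\<forall>r\<in>sys_rows. (\<Sum>x\<in>sys_cols. sys r x w * unknowns \<eta> a x) = (case r of Inl _ \<Rightarrow> 0 | Inr m \<Rightarrow> b m)) \<longleftrightarrow>
    (\<forall>i<4. \<forall>\<kappa>\<in>K. (\<Sum>x\<in>sys_cols. sys (Inl (i, \<kappa>)) x w * unknowns \<eta> a x) = 0) \<and>
    (\<forall>m<5. (\<Sum>x\<in>sys_cols. sys (Inr m) x w * unknowns \<eta> a x) = b m)"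
    by (auto simp: Plus_def)
  also have "\<dots> \<longleftrightarrow> stab w \<eta> a \<and> (\<forall>m<5. \<phi> m \<eta> = b m)"
    unfolding sys_Inr stab_def by (simp add: sys_Inl)
  finally show ?thesis .
qed

lemma polyfun_sys:
  assumes "r \<in> sys_rows" "x \<in> sys_cols"
  shows "polyfun FC (sys r x)"
proof (cases r)
  case (Inl l)
  obtain i \<kappa> where l: "l = (i, \<kappa>)" by (cases l)
  have i: "i < 4" "\<kappa> \<in> K" using assms(1) by (auto simp: Inl l)
  show ?thesis
  proof (cases x)
    case x: (Inl q)
    have "sys r x = (\<lambda>w. P (\<epsilon> q) (w i) \<kappa>)" by (simp add: fun_eq_iff sys_def Inl l x)
    then show ?thesis using polyfun_P\<epsilon>[OF i(2) i(1)] by simp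
  next
    case x: (Inr y)
    obtain i' p where y: "y = (i', p)" by (cases y)
    have p: "p \<in> upairs 4" using assms(2) by (auto simp: x y)
    then have p4: "fst p < 4" "snd p < 4" by (auto simp: upairs_def)
    show ?thesis
    proof (cases "i = i'")
      case True
      then have "sys r x = (\<lambda>w. (- 1) * P (w (fst p)) (w (snd p)) \<kappa>)" by (simp add: fun_eq_iff sys_def Inl l x y)
      moreover have "polyfun FC \<dots>" by (intro polyfun_mult polyfun_const polyfun_P i p4)
      ultimately show ?thesis by simp
    next
      case False
      then have "sys r x = (\<lambda>w. 0)" by (simp add: fun_eq_iff sys_def Inl l x y)
      then show ?thesis by (simp add: polyfun_const)
    qed
  qed
next
  case (Inr m)
  have "sys r x = (\<lambda>w. sys r x (\<lambda>_. 0))" by (auto simp: fun_eq_iff sys_def Inr split: sum.split)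
  then show ?thesis by (metis polyfun_const)
qed

text \<open>A kernel vector consists of \<open>\<eta>\<close> and \<open>a\<close>: first
  \<open>base_stab_zero\<close> kills \<open>\<eta>\<close>, and then the independence of the ten
  frame products kills every \<open>a i\<close>.\<close>

lemma base_sys_injective:
  "\<forall>c. (\<forall>r\<in>sys_rows. (\<Sum>x\<in>sys_cols. sys r x w\<^sub>0 * c x) = 0) \<longrightarrow> (\<forall>x\<in>sys_cols. c x = 0)"
proof (intro allI impI)
  fix c assume c: "\<forall>r\<in>sys_rows. (\<Sum>x\<in>sys_cols. sys r x w\<^sub>0 * c x) = 0"
  obtain \<eta> a where u': "\<forall>x\<in>sys_cols. c x = unknowns \<eta> a x" using unknowns_surj[of c] by (elim exE)
  have u: "c x = unknowns \<eta> a x" if "x \<in> sys_cols" for x by (rule u'[THEN bspec, OF that])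
  have "(\<Sum>x\<in>sys_cols. sys r x w\<^sub>0 * c x) = (\<Sum>x\<in>sys_cols. sys r x w\<^sub>0 * unknowns \<eta> a x)" for r
    by (rule sum.cong) (simp_all add: u)
  then have "\<forall>r\<in>sys_rows. (\<Sum>x\<in>sys_cols. sys r x w\<^sub>0 * unknowns \<eta> a x) = (case r of Inl _ \<Rightarrow> 0 | Inr m \<Rightarrow> 0)"
    using c by (auto split: sum.split)
  then have st: "stab w\<^sub>0 \<eta> a" and ph: "\<forall>m<5. \<phi> m \<eta> = 0" unfolding sys_iff by simp_all
  have \<eta>: "\<eta> = 0" by (rule base_stab_zero[OF st]) (use ph in blast)
  have a: "a i p = 0" if i: "i < 4" and p: "p \<in> upairs 4" for i p
  proof -
    have "\<forall>\<kappa>\<in>K. (\<Sum>p\<in>upairs 4. a i p * P (w\<^sub>0 (fst p)) (w\<^sub>0 (snd p)) \<kappa>) = 0"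
    proof
      fix \<kappa> assume \<kappa>: "\<kappa> \<in> K"
      have "P \<eta> (w\<^sub>0 i) \<kappa> = 0" using P_scale1[OF \<kappa>, of 0 0] by (simp add: \<eta>)
      then show "(\<Sum>p\<in>upairs 4. a i p * P (w\<^sub>0 (fst p)) (w\<^sub>0 (snd p)) \<kappa>) = 0"
        using st i \<kappa> by (simp add: stab_def)
    qed
    with base_squares_independent[unfolded squares_independent_def, THEN spec[of _ "a i"]]
    have "\<forall>p\<in>upairs 4. a i p = 0" by (rule mp)
    then show ?thesis using p by blast
  qed
  have X0: "X q 0 = 0" if "q \<in> Q" for q
    using linear_sum_scale[OF X_linear[OF that], of "\<lambda>_. 0" "\<lambda>_. 0" "{}"] by simp
  show "\<forall>x\<in>sys_cols. c x = 0"
  proof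
    fix x assume x: "x \<in> sys_cols"
    show "c x = 0" unfolding u[OF x] using x by (auto simp: unknowns_def \<eta> X0 a)
  qed
qed

lemma base_nondeg: "nondeg w\<^sub>0"
  unfolding nondeg_def
proof (intro allI impI ballI)
  fix x and m :: nat assume x: "\<forall>m\<in>{..<4}. (\<Sum>j<4. \<phi> m (w\<^sub>0 j) * x j) = 0" and m: "m \<in> {..<4}"
  have "(\<Sum>j<4. \<phi> m (w\<^sub>0 j) * x j) = (\<Sum>j<4. if j = m then x j else 0)"
    using m by (intro sum.cong) (auto simp: \<phi>_w\<^sub>0)
  then show "x m = 0" using x m by simp
qed

lemma rat_P2:
  assumes D: "polyfun FC D" and r: "\<And>q. q \<in> Q \<Longrightarrow> rat FC D (\<lambda>w. z q w)" and \<kappa>: "\<kappa> \<in> K"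
  defines "\<eta> \<equiv> \<lambda>w. \<Sum>q\<in>Q. s (z q w) (\<epsilon> q)"
  shows "rat FC D (\<lambda>w. P (\<eta> w) (\<eta> w) \<kappa>)" and "i < 4 \<Longrightarrow> rat FC D (\<lambda>w. P (\<eta> w) (w i) \<kappa>)"
proof -
  have "rat FC D (\<lambda>w. \<Sum>q\<in>Q. z q w * (\<Sum>q'\<in>Q. z q' w * P (\<epsilon> q) (\<epsilon> q') \<kappa>))"
    by (intro rat_sum rat_mult rat_const D r)
  then show "rat FC D (\<lambda>w. P (\<eta> w) (\<eta> w) \<kappa>)"
    unfolding \<eta>_def P_sum1[OF \<kappa>] by (simp add: P_sum2[OF \<kappa>])
  show "rat FC D (\<lambda>w. P (\<eta> w) (w i) \<kappa>)" if "i < 4"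
    unfolding \<eta>_def P_sum1[OF \<kappa>] by (intro rat_sum rat_mult D r rat_polyfun polyfun_P\<epsilon> \<kappa> that)
qed

text \<open>Three applications of \<open>rat_solve\<close> supply the factors of \<open>D\<close>
  and candidates for \<open>\<eta>\<close>, \<open>\<alpha>\<close> and \<open>\<gamma>\<close>. The
  candidates need not solve the overdetermined systems a priori. At the special frames they do, by
  \<open>secant_solution\<close>, and \<open>rat_zero\<close> extends this to every \<open>w\<close>
  with \<open>D w \<noteq> 0\<close>.\<close>

lemma stabilizer_functions:
  "\<exists>D \<eta> \<alpha> \<gamma>. polyfun FC D \<and> D w\<^sub>0 \<noteq> 0 \<and>
    (\<forall>w. D w \<noteq> 0 \<longrightarrow> nondeg w \<and> stab_unique w \<and> squares_independent w) \<and>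
    (\<forall>i<4. \<forall>p\<in>upairs 4. rat FC D (\<lambda>w. \<alpha> w i p)) \<and> (\<forall>p\<in>upairs 4. rat FC D (\<lambda>w. \<gamma> w p)) \<and>
    (\<forall>w. D w \<noteq> 0 \<longrightarrow> stab w (\<eta> w) (\<alpha> w) \<and> (\<forall>m<5. \<phi> m (\<eta> w) = (if m = 4 then 1 else 0)) \<and>
      (\<forall>\<kappa>\<in>K. P (\<eta> w) (\<eta> w) \<kappa> = (\<Sum>q\<in>upairs 4. \<gamma> w q * P (w (fst q)) (w (snd q)) \<kappa>)))"
proof -
  \<comment> \<open>The first factor guarantees \<open>nondeg\<close>; the initial denominator is
    the constant 1.\<close>
  have "\<exists>q. polyfun FC q \<and> q w\<^sub>0 \<noteq> 0 \<and>
    (\<forall>w c. 1 * q w \<noteq> 0 \<longrightarrow> (\<forall>m\<in>{..<4}. (\<Sum>j<4. \<phi> m (w j) * c j) = 0) \<longrightarrow> (\<forall>j\<in>{..<4}. c j = 0)) \<and>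
    (\<forall>b. (\<forall>i\<in>{..<4}. rat FC (\<lambda>_. 1) (b i)) \<longrightarrow> (\<exists>z. (\<forall>j\<in>{..<4}. rat FC (\<lambda>x. 1 * q x) (z j)) \<and>
       (\<forall>x y. 1 * q x \<noteq> 0 \<longrightarrow> (\<forall>i\<in>{..<4}. (\<Sum>j<4. \<phi> i (x j) * y j) = b i x) \<longrightarrow> (\<forall>j\<in>{..<4}. y j = z j x))))"
  proof (rule rat_solve)
    show "\<forall>c. (\<forall>i\<in>{..<4}. (\<Sum>j<4. \<phi> i (w\<^sub>0 j) * c j) = 0) \<longrightarrow> (\<forall>j\<in>{..<4}. c j = 0)"
      using base_nondeg unfolding nondeg_def .
  qed (auto intro!: rat_polyfun polyfun_coord polyfun_const \<phi>_linear)
  then obtain q0 where q0: "polyfun FC q0" "q0 w\<^sub>0 \<noteq> 0" and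
    q0': "\<forall>w c. q0 w \<noteq> 0 \<longrightarrow> (\<forall>m\<in>{..<4}. (\<Sum>j<4. \<phi> m (w j) * c j) = 0) \<longrightarrow> (\<forall>j\<in>{..<4}. c j = 0)"
    unfolding mult_1 by (elim exE conjE) (rule that)
  have nondeg: "nondeg w" if "q0 w \<noteq> 0" for w
    unfolding nondeg_def using q0'[THEN spec[of _ w]] that by simp
  \<comment> \<open>The second factor makes the stabilizer system injective; its candidate solution
    supplies \<open>\<eta>\<close> and \<open>\<alpha>\<close>.\<close>
  have "\<exists>q. polyfun FC q \<and> q w\<^sub>0 \<noteq> 0 \<and>
    (\<forall>w c. q0 w * q w \<noteq> 0 \<longrightarrow> (\<forall>r\<in>sys_rows. (\<Sum>x\<in>sys_cols. sys r x w * c x) = 0) \<longrightarrow> (\<forall>x\<in>sys_cols. c x = 0)) \<and>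
    (\<forall>b. (\<forall>r\<in>sys_rows. rat FC q0 (b r)) \<longrightarrow> (\<exists>z. (\<forall>x\<in>sys_cols. rat FC (\<lambda>x. q0 x * q x) (z x)) \<and>
       (\<forall>w y. q0 w * q w \<noteq> 0 \<longrightarrow> (\<forall>r\<in>sys_rows. (\<Sum>x\<in>sys_cols. sys r x w * y x) = b r w) \<longrightarrow> (\<forall>x\<in>sys_cols. y x = z x w))))"
  proof (rule rat_solve[where A = sys and I = sys_rows and J = sys_cols and ?x0.0 = "w\<^sub>0", OF finite_rows finite_cols q0])
    show "rat FC q0 (sys r x)" if "r \<in> sys_rows" "x \<in> sys_cols" for r x
      using that by (intro rat_polyfun polyfun_sys)
  qed (rule base_sys_injective)
  then obtain q2 where q2: "polyfun FC q2 \<and> q2 w\<^sub>0 \<noteq> 0 \<and>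
    (\<forall>w c. q0 w * q2 w \<noteq> 0 \<longrightarrow> (\<forall>r\<in>sys_rows. (\<Sum>x\<in>sys_cols. sys r x w * c x) = 0) \<longrightarrow> (\<forall>x\<in>sys_cols. c x = 0)) \<and>
    (\<forall>b. (\<forall>r\<in>sys_rows. rat FC q0 (b r)) \<longrightarrow> (\<exists>z. (\<forall>x\<in>sys_cols. rat FC (\<lambda>x. q0 x * q2 x) (z x)) \<and>
       (\<forall>w y. q0 w * q2 w \<noteq> 0 \<longrightarrow> (\<forall>r\<in>sys_rows. (\<Sum>x\<in>sys_cols. sys r x w * y x) = b r w) \<longrightarrow> (\<forall>x\<in>sys_cols. y x = z x w))))"
    by (rule exE)
  define D2 where "D2 w = q0 w * q2 w" for w
  have D2: "polyfun FC D2" "D2 w\<^sub>0 \<noteq> 0"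
    using q0 q2 unfolding D2_def by (auto intro: polyfun_mult)
  have su: "stab_unique w" if "D2 w \<noteq> 0" for w
    unfolding stab_unique_def
  proof (intro allI impI)
    fix \<eta> a assume *: "stab w \<eta> a" "\<forall>m<5. \<phi> m \<eta> = 0"
    then have "\<forall>r\<in>sys_rows. (\<Sum>x\<in>sys_cols. sys r x w * unknowns \<eta> a x) = 0"
      using sys_iff[of w \<eta> a "\<lambda>_. 0"] by (auto split: sum.splits)
    with q2[THEN conjunct2, THEN conjunct2, THEN conjunct1, THEN spec[of _ w], THEN spec[of _ "unknowns \<eta> a"]] that
    have u: "\<forall>x\<in>sys_cols. unknowns \<eta> a x = 0" unfolding D2_def by blast
    have "\<forall>q\<in>Q. X q \<eta> = 0"
    proof
      fix q assume "q \<in> Q"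
      then show "X q \<eta> = 0" using u[THEN bspec, OF InlI[of q Q]] by (simp add: unknowns_def)
    qed
    then have "(\<Sum>q\<in>Q. s (X q \<eta>) (\<epsilon> q)) = 0" by simp
    then show "\<eta> = 0" using X_rep[of \<eta>] by (rule trans[rotated])
  qed
  \<comment> \<open>Zero for the stabilizer equations, and the prescribed values of the five forms
    on \<open>\<eta>\<close> in the last rows.\<close>
  define b :: "(nat \<times> 'k) + nat \<Rightarrow> (nat \<Rightarrow> 'e) \<Rightarrow> complex"
    where "b r w = (case r of Inl _ \<Rightarrow> 0 | Inr m \<Rightarrow> if m = 4 then 1 else 0)" for r w
  have "\<forall>r\<in>sys_rows. rat FC q0 (b r)"
    unfolding b_def by (intro ballI rat_const)
  with q2[THEN conjunct2, THEN conjunct2, THEN conjunct2, THEN spec[of _ b]]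
  obtain z where z: "(\<forall>x\<in>sys_cols. rat FC (\<lambda>x. q0 x * q2 x) (z x)) \<and>
       (\<forall>w y. q0 w * q2 w \<noteq> 0 \<longrightarrow> (\<forall>r\<in>sys_rows. (\<Sum>x\<in>sys_cols. sys r x w * y x) = b r w) \<longrightarrow> (\<forall>x\<in>sys_cols. y x = z x w))"
    by (elim impE exE)
  have rz: "rat FC D2 (z x)" if "x \<in> sys_cols" for x
    using z[THEN conjunct1] that unfolding D2_def by blast
  have zu: "unknowns \<eta> a x = z x w"
    if "D2 w \<noteq> 0" "stab w \<eta> a" "\<forall>m<5. \<phi> m \<eta> = (if m = 4 then 1 else 0)" "x \<in> sys_cols" for w \<eta> a x
  proof -
    have "\<forall>r\<in>sys_rows. (\<Sum>x\<in>sys_cols. sys r x w * unknowns \<eta> a x) = b r w"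
      using that sys_iff[of w \<eta> a "\<lambda>m. if m = 4 then 1 else 0"] unfolding b_def by blast
    with z[THEN conjunct2, THEN spec[of _ w], THEN spec[of _ "unknowns \<eta> a"]] that(1,4)
    show ?thesis unfolding D2_def by blast
  qed
  define \<eta> where "\<eta> w = (\<Sum>q\<in>Q. s (z (Inl q) w) (\<epsilon> q))" for w
  define \<alpha> where "\<alpha> w i p = z (Inr (i, p)) w" for w i p
  have rzq: "rat FC D2 (\<lambda>w. z (Inl q) w)" if "q \<in> Q" for q using rz[of "Inl q"] that by auto
  \<comment> \<open>The third factor keeps the ten frame products independent; the candidate
    solution expresses the square of \<open>\<eta> w\<close> through them.\<close>
  have "\<exists>q. polyfun FC q \<and> q w\<^sub>0 \<noteq> 0 \<and>
    (\<forall>w c. D2 w * q w \<noteq> 0 \<longrightarrow> (\<forall>\<kappa>\<in>K. (\<Sum>p\<in>upairs 4. P (w (fst p)) (w (snd p)) \<kappa> * c p) = 0) \<longrightarrow> (\<forall>p\<in>upairs 4. c p = 0)) \<and>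
    (\<forall>b. (\<forall>\<kappa>\<in>K. rat FC D2 (b \<kappa>)) \<longrightarrow> (\<exists>z. (\<forall>p\<in>upairs 4. rat FC (\<lambda>x. D2 x * q x) (z p)) \<and>
       (\<forall>w y. D2 w * q w \<noteq> 0 \<longrightarrow> (\<forall>\<kappa>\<in>K. (\<Sum>p\<in>upairs 4. P (w (fst p)) (w (snd p)) \<kappa> * y p) = b \<kappa> w) \<longrightarrow> (\<forall>p\<in>upairs 4. y p = z p w))))"
  proof (rule rat_solve[where D = D2 and ?x0.0 = "w\<^sub>0", OF finite_K finite_pairs(2) D2])
    show "rat FC D2 (\<lambda>w. P (w (fst p)) (w (snd p)) \<kappa>)" if "\<kappa> \<in> K" "p \<in> upairs 4" for \<kappa> p
      using that by (intro rat_polyfun polyfun_P) (auto simp: upairs_def)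
    show "\<forall>c. (\<forall>\<kappa>\<in>K. (\<Sum>p\<in>upairs 4. P (w\<^sub>0 (fst p)) (w\<^sub>0 (snd p)) \<kappa> * c p) = 0) \<longrightarrow> (\<forall>p\<in>upairs 4. c p = 0)"
      using base_squares_independent unfolding squares_independent_def by (simp only: mult.commute)
  qed
  then obtain q3 where q3: "polyfun FC q3 \<and> q3 w\<^sub>0 \<noteq> 0 \<and>
    (\<forall>w c. D2 w * q3 w \<noteq> 0 \<longrightarrow> (\<forall>\<kappa>\<in>K. (\<Sum>p\<in>upairs 4. P (w (fst p)) (w (snd p)) \<kappa> * c p) = 0) \<longrightarrow> (\<forall>p\<in>upairs 4. c p = 0)) \<and>
    (\<forall>b. (\<forall>\<kappa>\<in>K. rat FC D2 (b \<kappa>)) \<longrightarrow> (\<exists>z. (\<forall>p\<in>upairs 4. rat FC (\<lambda>x. D2 x * q3 x) (z p)) \<and>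
       (\<forall>w y. D2 w * q3 w \<noteq> 0 \<longrightarrow> (\<forall>\<kappa>\<in>K. (\<Sum>p\<in>upairs 4. P (w (fst p)) (w (snd p)) \<kappa> * y p) = b \<kappa> w) \<longrightarrow> (\<forall>p\<in>upairs 4. y p = z p w))))"
    by (rule exE)
  define D where "D w = D2 w * q3 w" for w
  have D: "polyfun FC D" "D w\<^sub>0 \<noteq> 0" using D2 q3 unfolding D_def by (auto intro: polyfun_mult)
  have DD: "q0 w \<noteq> 0" "D2 w \<noteq> 0" if "D w \<noteq> 0" for w using that by (auto simp: D_def D2_def)
  have sq: "squares_independent w" if "D w \<noteq> 0" for w
    unfolding squares_independent_def
  proof (intro allI impI)
    fix c assume "\<forall>\<kappa>\<in>K. (\<Sum>p\<in>upairs 4. c p * P (w (fst p)) (w (snd p)) \<kappa>) = 0"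
    then have "\<forall>\<kappa>\<in>K. (\<Sum>p\<in>upairs 4. P (w (fst p)) (w (snd p)) \<kappa> * c p) = 0" by (simp only: mult.commute)
    with q3[THEN conjunct2, THEN conjunct2, THEN conjunct1, THEN spec[of _ w], THEN spec[of _ c]] that
    show "\<forall>p\<in>upairs 4. c p = 0" unfolding D_def by blast
  qed
  have "\<forall>\<kappa>\<in>K. rat FC D2 (\<lambda>w. P (\<eta> w) (\<eta> w) \<kappa>)"
    unfolding \<eta>_def by (intro ballI rat_P2(1) D2 rzq)
  with q3[THEN conjunct2, THEN conjunct2, THEN conjunct2, THEN spec[of _ "\<lambda>\<kappa> w. P (\<eta> w) (\<eta> w) \<kappa>"]]
  obtain g where g: "(\<forall>p\<in>upairs 4. rat FC (\<lambda>x. D2 x * q3 x) (g p)) \<and>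
       (\<forall>w y. D2 w * q3 w \<noteq> 0 \<longrightarrow> (\<forall>\<kappa>\<in>K. (\<Sum>p\<in>upairs 4. P (w (fst p)) (w (snd p)) \<kappa> * y p) = P (\<eta> w) (\<eta> w) \<kappa>) \<longrightarrow> (\<forall>p\<in>upairs 4. y p = g p w))"
    by (elim impE exE)
  have rD: "rat FC D f" if "rat FC D2 f" for f
    by (rule rat_refine[OF _ that, of q3]) (use q3 in \<open>auto simp: D_def\<close>)
  have rg: "rat FC D (g p)" if "p \<in> upairs 4" for p
    using g[THEN conjunct1] that unfolding D_def by blast
  have r\<alpha>: "rat FC D (\<lambda>w. \<alpha> w i p)" if "i < 4" "p \<in> upairs 4" for i p
    unfolding \<alpha>_def using rz[of "Inr (i, p)"] that by (intro rD) auto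
  \<comment> \<open>At the special frames a true solution exists and, being unique, equals the
    candidate.\<close>
  have main: "stab w (\<eta> w) (\<alpha> w)" "\<forall>m<5. \<phi> m (\<eta> w) = (if m = 4 then 1 else 0)"
    "\<forall>\<kappa>\<in>K. P (\<eta> w) (\<eta> w) \<kappa> = (\<Sum>q\<in>upairs 4. g q w * P (w (fst q)) (w (snd q)) \<kappa>)"
    if iso: "isotropic \<omega>" and w: "\<And>j. j < 4 \<Longrightarrow> w j = comb (u j) \<omega>" and Dw: "D w \<noteq> 0" for w \<omega> u
  proof -
    have "\<exists>t a g. stab w (comb t \<omega>) a \<and> (\<forall>m<5. \<phi> m (comb t \<omega>) = (if m = 4 then 1 else 0)) \<and>
      (\<forall>\<kappa>\<in>K. P (comb t \<omega>) (comb t \<omega>) \<kappa> = (\<Sum>q\<in>upairs 4. g q * P (w (fst q)) (w (snd q)) \<kappa>))"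
      by (rule secant_solution[OF iso w sq[OF Dw] su[OF DD(2)[OF Dw]]])
    then obtain t a g' where t: "stab w (comb t \<omega>) a" "\<forall>m<5. \<phi> m (comb t \<omega>) = (if m = 4 then 1 else 0)"
      "\<forall>\<kappa>\<in>K. P (comb t \<omega>) (comb t \<omega>) \<kappa> = (\<Sum>q\<in>upairs 4. g' q * P (w (fst q)) (w (snd q)) \<kappa>)"
      by (elim exE conjE)
    note zz = zu[OF DD(2)[OF Dw] t(1,2)]
    have "z (Inl q) w = X q (comb t \<omega>)" if "q \<in> Q" for q
      using zz[of "Inl q"] that by (simp add: unknowns_def InlI)
    then have \<eta>: "\<eta> w = comb t \<omega>" unfolding \<eta>_def using X_rep[of "comb t \<omega>"] by simp
    have \<alpha>: "\<alpha> w i p = a i p" if "i < 4" "p \<in> upairs 4" for i p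
      using zz[of "Inr (i, p)"] that by (simp add: unknowns_def \<alpha>_def InrI)
    show "stab w (\<eta> w) (\<alpha> w)"
      using t(1) unfolding stab_def \<eta> by (simp add: \<alpha>)
    show "\<forall>m<5. \<phi> m (\<eta> w) = (if m = 4 then 1 else 0)" using t(2) \<eta> by simp
    have "\<forall>\<kappa>\<in>K. (\<Sum>p\<in>upairs 4. P (w (fst p)) (w (snd p)) \<kappa> * g' p) = P (\<eta> w) (\<eta> w) \<kappa>"
      using t(3) unfolding \<eta> by (simp add: mult.commute)
    with g[THEN conjunct2, THEN spec[of _ w], THEN spec[of _ g']] Dw
    have "\<forall>p\<in>upairs 4. g' p = g p w" unfolding D_def by blast
    then show "\<forall>\<kappa>\<in>K. P (\<eta> w) (\<eta> w) \<kappa> = (\<Sum>q\<in>upairs 4. g q w * P (w (fst q)) (w (snd q)) \<kappa>)"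
      using t(3) unfolding \<eta> by simp
  qed
  \<comment> \<open>From here on each of the three conclusions is a rational identity, extended from
    the special frames by \<open>rat_zero\<close>.\<close>
  have "stab w (\<eta> w) (\<alpha> w)" if Dw: "D w \<noteq> 0" for w
    unfolding stab_def
  proof (intro allI impI ballI)
    fix i \<kappa> assume i: "i < (4::nat)" and \<kappa>: "\<kappa> \<in> K"
    have "P (\<eta> w) (w i) \<kappa> - (\<Sum>p\<in>upairs 4. \<alpha> w i p * P (w (fst p)) (w (snd p)) \<kappa>) = 0"
    proof (rule rat_zero[OF D(1) _ Dw, of "\<lambda>w. P (\<eta> w) (w i) \<kappa> - (\<Sum>p\<in>upairs 4. \<alpha> w i p * P (w (fst p)) (w (snd p)) \<kappa>)"])
      have "rat FC D (\<lambda>w. P (\<eta> w) (w i) \<kappa>)" unfolding \<eta>_def by (intro rD rat_P2(2) D2 rzq i \<kappa>)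
      moreover have "rat FC D (\<lambda>w. P (w (fst p)) (w (snd p)) \<kappa>)" if "p \<in> upairs 4" for p
        using that \<kappa> by (intro rat_polyfun polyfun_P) (auto simp: upairs_def)
      ultimately show "rat FC D (\<lambda>w. P (\<eta> w) (w i) \<kappa> - (\<Sum>p\<in>upairs 4. \<alpha> w i p * P (w (fst p)) (w (snd p)) \<kappa>))"
        by (intro rat_diff rat_sum rat_mult D r\<alpha> i)
      fix w :: "nat \<Rightarrow> 'e" and \<omega> u assume *: "isotropic \<omega>" "\<And>j. j < 4 \<Longrightarrow> w j = comb (u j) \<omega>" "D w \<noteq> 0"
      from main(1)[OF *] i \<kappa>
      show "P (\<eta> w) (w i) \<kappa> - (\<Sum>p\<in>upairs 4. \<alpha> w i p * P (w (fst p)) (w (snd p)) \<kappa>) = 0"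
        by (simp add: stab_def)
    qed
    then show "P (\<eta> w) (w i) \<kappa> = (\<Sum>p\<in>upairs 4. \<alpha> w i p * P (w (fst p)) (w (snd p)) \<kappa>)" by simp
  qed
  moreover have "\<phi> m (\<eta> w) = (if m = 4 then 1 else 0)" if Dw: "D w \<noteq> 0" and m: "m < 5" for w m
  proof -
    have "\<phi> m (\<eta> w) - (if m = 4 then 1 else 0) = 0"
    proof (rule rat_zero[OF D(1) _ Dw, of "\<lambda>w. \<phi> m (\<eta> w) - (if m = 4 then 1 else 0)"])
      show "rat FC D (\<lambda>w. \<phi> m (\<eta> w) - (if m = 4 then 1 else 0))"
        unfolding \<eta>_def linear_sum_scale[OF \<phi>_linear]
        by (intro rat_diff rat_sum rat_mult D rD rzq rat_const)
      fix w :: "nat \<Rightarrow> 'e" and \<omega> u assume *: "isotropic \<omega>" "\<And>j. j < 4 \<Longrightarrow> w j = comb (u j) \<omega>" "D w \<noteq> 0"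
      from main(2)[OF *] m show "\<phi> m (\<eta> w) - (if m = 4 then 1 else 0) = 0" by simp
    qed
    then show ?thesis by simp
  qed
  moreover have "P (\<eta> w) (\<eta> w) \<kappa> = (\<Sum>q\<in>upairs 4. g q w * P (w (fst q)) (w (snd q)) \<kappa>)"
    if Dw: "D w \<noteq> 0" and \<kappa>: "\<kappa> \<in> K" for w \<kappa>
  proof -
    have "P (\<eta> w) (\<eta> w) \<kappa> - (\<Sum>q\<in>upairs 4. g q w * P (w (fst q)) (w (snd q)) \<kappa>) = 0"
    proof (rule rat_zero[OF D(1) _ Dw, of "\<lambda>w. P (\<eta> w) (\<eta> w) \<kappa> - (\<Sum>q\<in>upairs 4. g q w * P (w (fst q)) (w (snd q)) \<kappa>)"])
      have "rat FC D (\<lambda>w. P (\<eta> w) (\<eta> w) \<kappa>)" unfolding \<eta>_def by (intro rD rat_P2(1) D2 rzq \<kappa>)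
      moreover have "rat FC D (\<lambda>w. P (w (fst p)) (w (snd p)) \<kappa>)" if "p \<in> upairs 4" for p
        using that \<kappa> by (intro rat_polyfun polyfun_P) (auto simp: upairs_def)
      ultimately show "rat FC D (\<lambda>w. P (\<eta> w) (\<eta> w) \<kappa> - (\<Sum>q\<in>upairs 4. g q w * P (w (fst q)) (w (snd q)) \<kappa>))"
        by (intro rat_diff rat_sum rat_mult D rg)
      fix w :: "nat \<Rightarrow> 'e" and \<omega> u assume *: "isotropic \<omega>" "\<And>j. j < 4 \<Longrightarrow> w j = comb (u j) \<omega>" "D w \<noteq> 0"
      from main(3)[OF *] \<kappa>
      show "P (\<eta> w) (\<eta> w) \<kappa> - (\<Sum>q\<in>upairs 4. g q w * P (w (fst q)) (w (snd q)) \<kappa>) = 0" by simp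
    qed
    then show ?thesis by simp
  qed
  ultimately show ?thesis
    using D nondeg[OF DD(1)] su[OF DD(2)] sq r\<alpha> rg
    by (intro exI[of _ D] exI[of _ \<eta>] exI[of _ \<alpha>] exI[of _ "\<lambda>w p. g p w"]) simp
qed

end

section \<open>Multiplication matrices\<close>

context secant_web_dual
begin

definition stab_frame :: "(nat \<Rightarrow> 'e) \<Rightarrow> 'e \<Rightarrow> nat \<Rightarrow> 'e" where
  "stab_frame w \<eta> i = (if i = 4 then \<eta> else w i)"

definition stab_data :: "(nat \<Rightarrow> 'e) \<Rightarrow> 'e \<Rightarrow> (nat \<Rightarrow> nat \<times> nat \<Rightarrow> complex) \<Rightarrow> (nat \<times> nat \<Rightarrow> complex) \<Rightarrow> bool" where
  "stab_data w \<eta> \<alpha> \<gamma> \<longleftrightarrow> nondeg w \<and> stab_unique w \<and> squares_independent w \<and> stab w \<eta> \<alpha> \<and>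
    (\<forall>m<5. \<phi> m \<eta> = (if m = 4 then 1 else 0)) \<and>
    (\<forall>\<kappa>\<in>K. P \<eta> \<eta> \<kappa> = (\<Sum>q\<in>upairs 4. \<gamma> q * P (w (fst q)) (w (snd q)) \<kappa>))"

lemma sum_5_split: "(\<Sum>i<(5::nat). f i) = (\<Sum>i<4. f i) + (f 4 :: 'z::comm_monoid_add)"
proof -
  have "{..<5} = insert 4 {..<4::nat}" by auto
  then show ?thesis by (simp add: add.commute)
qed

lemma comb_diff: "comb x v - comb y v = comb (\<lambda>i. x i - y i) v"
  by (simp add: comb_def scale_left_diff_distrib sum_subtractf)

lemma comb_unit: "i < 5 \<Longrightarrow> comb (\<lambda>k. if k = i then 1 else 0) v = v i"
  by (simp add: comb_def if_distrib[of "\<lambda>x. s x _"] cong: if_cong)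

lemma comb_comb: "comb x (\<lambda>i. comb (T i) v) = comb (\<lambda>l. \<Sum>i<5. x i * T i l) v"
proof -
  have "comb x (\<lambda>i. comb (T i) v) = (\<Sum>i<5. \<Sum>l<5. s (x i * T i l) (v l))"
    by (simp add: comb_def scale_sum_right)
  also have "\<dots> = comb (\<lambda>l. \<Sum>i<5. x i * T i l) v"
    by (subst sum.swap) (simp add: comb_def scale_sum_left)
  finally show ?thesis .
qed

lemma comb_cong: "(\<And>i. i < 5 \<Longrightarrow> x i = y i) \<Longrightarrow> (\<And>i. i < 5 \<Longrightarrow> v i = v' i) \<Longrightarrow> comb x v = comb y v'"
  by (simp add: comb_def)

lemma \<phi>_comb: "\<phi> m (comb x v) = (\<Sum>i<5. x i * \<phi> m (v i))"
  unfolding comb_def by (rule linear_sum_scale[OF \<phi>_linear])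

lemma stab_frame_independent:
  assumes "stab_data w \<eta> \<alpha> \<gamma>" "comb x (stab_frame w \<eta>) = 0" "i < 5"
  shows "x i = 0"
proof -
  have z: "\<phi> m (comb x (stab_frame w \<eta>)) = 0" for m
    unfolding assms(2) using linear_sum_scale[OF \<phi>_linear, of m "\<lambda>_. 0" "\<lambda>_. 0" "{}"] by simp
  have *: "(\<Sum>j<4. \<phi> m (w j) * x j) + x 4 * \<phi> m \<eta> = 0" for m
    using z[of m] by (simp add: \<phi>_comb sum_5_split stab_frame_def mult.commute)
  have "\<forall>m\<in>{..<4}. (\<Sum>j<4. \<phi> m (w j) * x j) = 0"
  proof
    fix m :: nat assume "m \<in> {..<4}"
    then have "\<phi> m \<eta> = 0" using assms(1) by (simp add: stab_data_def)
    then show "(\<Sum>j<4. \<phi> m (w j) * x j) = 0" using *[of m] by simp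
  qed
  moreover have "nondeg w" using assms(1) by (simp add: stab_data_def)
  ultimately have x: "\<forall>j\<in>{..<4}. x j = 0" unfolding nondeg_def by (elim allE) (erule mp)
  moreover have "\<phi> 4 \<eta> = 1" using assms(1) by (simp add: stab_data_def)
  ultimately have "x 4 = 0" using *[of 4] by simp
  then show ?thesis using x assms(3) by (cases "i = 4") auto
qed

text \<open>Coefficient of the frame product \<open>p\<close> in the square of
  \<open>comb x (stab_frame w \<eta>)\<close>, once the products that involve \<open>\<eta>\<close>
  are rewritten with \<open>\<alpha>\<close> and \<open>\<gamma>\<close>. Isotropic vectors thus
  become the common zeros of ten quadratic polynomials in \<open>x\<close>.\<close>

definition iso_coeff :: "(nat \<Rightarrow> nat \<times> nat \<Rightarrow> complex) \<Rightarrow> (nat \<times> nat \<Rightarrow> complex) \<Rightarrow> (nat \<Rightarrow> complex) \<Rightarrow> nat \<times> nat \<Rightarrow> complex" where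
  "iso_coeff \<alpha> \<gamma> x p = x 4 * x 4 * \<gamma> p + 2 * x 4 * (\<Sum>i<4. x i * \<alpha> i p) +
    (if fst p = snd p then 1 else 2) * x (fst p) * x (snd p)"

lemma P_stab_frame:
  assumes "stab_data w \<eta> \<alpha> \<gamma>" "\<kappa> \<in> K"
  shows "P (comb x (stab_frame w \<eta>)) (comb x (stab_frame w \<eta>)) \<kappa> =
    (\<Sum>p\<in>upairs 4. iso_coeff \<alpha> \<gamma> x p * P (w (fst p)) (w (snd p)) \<kappa>)"
proof -
  let ?v = "stab_frame w \<eta>" and ?Q = "\<lambda>p. P (w (fst p)) (w (snd p)) \<kappa>"
  define S where "S p = (\<Sum>i<4. x i * \<alpha> i p)" for p
  have st: "P \<eta> (w i) \<kappa> = (\<Sum>p\<in>upairs 4. \<alpha> i p * ?Q p)" if "i < 4" for i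
    using assms that by (simp add: stab_data_def stab_def)
  have g: "P \<eta> \<eta> \<kappa> = (\<Sum>p\<in>upairs 4. \<gamma> p * ?Q p)"
    using assms by (simp add: stab_data_def)
  have "P (comb x ?v) (comb x ?v) \<kappa> = (\<Sum>i<5. x i * (\<Sum>l<5. x l * P (?v i) (?v l) \<kappa>))"
    unfolding comb_def P_sum1[OF assms(2)] by (simp add: P_sum2[OF assms(2)])
  also have "\<dots> = (\<Sum>i<4. x i * (\<Sum>l<4. x l * P (w i) (w l) \<kappa>)) + 2 * x 4 * (\<Sum>i<4. x i * P \<eta> (w i) \<kappa>) + x 4 * x 4 * P \<eta> \<eta> \<kappa>"
    by (simp add: sum_5_split stab_frame_def P_sym[of "w i" \<eta> for i] distrib_left sum.distrib sum_distrib_left algebra_simps)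
  also have "(\<Sum>i<4. x i * (\<Sum>l<4. x l * P (w i) (w l) \<kappa>)) =
      (\<Sum>p\<in>upairs 4. (if fst p = snd p then 1 else 2) * x (fst p) * x (snd p) * ?Q p)"
    using sum_symmetric[of "\<lambda>i l. P (w i) (w l) \<kappa>" x, OF P_sym] by (simp add: sum_distrib_left mult.assoc)
  also have "(\<Sum>i<4. x i * P \<eta> (w i) \<kappa>) = (\<Sum>p\<in>upairs 4. S p * ?Q p)"
  proof -
    have "(\<Sum>i<4. x i * P \<eta> (w i) \<kappa>) = (\<Sum>i<4. \<Sum>p\<in>upairs 4. x i * \<alpha> i p * ?Q p)"
      by (intro sum.cong refl) (simp add: st sum_distrib_left mult.assoc)
    also have "\<dots> = (\<Sum>p\<in>upairs 4. S p * ?Q p)"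
      by (subst sum.swap) (simp add: S_def sum_distrib_right)
    finally show ?thesis .
  qed
  finally show ?thesis
    unfolding g iso_coeff_def S_def[symmetric] distrib_right sum.distrib
    by (simp add: sum_distrib_left mult.assoc add_ac)
qed

lemma iso_coeff_zero_iff:
  assumes "stab_data w \<eta> \<alpha> \<gamma>"
  shows "(\<forall>\<kappa>\<in>K. P (comb x (stab_frame w \<eta>)) (comb x (stab_frame w \<eta>)) \<kappa> = 0) \<longleftrightarrow>
    (\<forall>p\<in>upairs 4. iso_coeff \<alpha> \<gamma> x p = 0)"
proof
  assume "\<forall>\<kappa>\<in>K. P (comb x (stab_frame w \<eta>)) (comb x (stab_frame w \<eta>)) \<kappa> = 0"
  then have "\<forall>\<kappa>\<in>K. (\<Sum>p\<in>upairs 4. iso_coeff \<alpha> \<gamma> x p * P (w (fst p)) (w (snd p)) \<kappa>) = 0"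
    by (simp add: P_stab_frame[OF assms])
  moreover have "squares_independent w" using assms by (simp add: stab_data_def)
  ultimately show "\<forall>p\<in>upairs 4. iso_coeff \<alpha> \<gamma> x p = 0"
    unfolding squares_independent_def by (elim allE[of _ "iso_coeff \<alpha> \<gamma> x"]) (erule mp)
qed (simp add: P_stab_frame[OF assms])

text \<open>If \<open>x 4\<close> vanishes, the equation of index \<open>(j, j)\<close> reads
  \<open>x j * x j = 0\<close>. So there are no solutions at infinity, and the chart
  \<open>x 4 = 1\<close> loses none.\<close>

lemma iso_coeff_top_nonzero:
  assumes "\<forall>p\<in>upairs 4. iso_coeff \<alpha> \<gamma> x p = 0" "i < 5" "x i \<noteq> 0"
  shows "x 4 \<noteq> 0"
proof
  assume x4: "x 4 = 0"
  have "x j = 0" if "j < 4" for j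
  proof -
    have "(j, j) \<in> upairs 4" using that by (simp add: upairs_def)
    then have "iso_coeff \<alpha> \<gamma> x (j, j) = 0" using assms(1) by blast
    then show ?thesis by (simp add: iso_coeff_def x4)
  qed
  then show False using assms(2,3) x4 by (cases "i = 4") auto
qed

text \<open>On the affine chart \<open>x 4 = 1\<close>, an isotropic vector satisfies \<open>x j * x k = (linear in x)\<close>;
  these are the matrices of multiplication by \<open>x j\<close>.\<close>

definition mult_mat :: "(nat \<Rightarrow> nat \<times> nat \<Rightarrow> complex) \<Rightarrow> (nat \<times> nat \<Rightarrow> complex) \<Rightarrow> nat \<Rightarrow> nat \<Rightarrow> nat \<Rightarrow> complex" where
  "mult_mat \<alpha> \<gamma> j r c = (if r = 4 then if c = j then 1 else 0
     else if c = 4 then - \<gamma> (min j r, max j r) / (if j = r then 1 else 2)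
     else - 2 * \<alpha> c (min j r, max j r) / (if j = r then 1 else 2))"

lemma mult_mat_4: "j < 4 \<Longrightarrow> (\<Sum>c<5. mult_mat \<alpha> \<gamma> j 4 c * x c) = x j"
  by (simp add: mult_mat_def if_distrib[of "\<lambda>y. y * _"] cong: if_cong)

text \<open>Homogeneous form of the multiplication rule: \<open>x 4\<close> times row
  \<open>r\<close> differs from \<open>x j * x r\<close> only by a multiple of a quadric. The weight
  1 or 2 counts how often the product occurs in the square.\<close>

lemma mult_mat_iso:
  assumes "j < 4" "r < 4"
  shows "(if j = r then 1 else 2) * (x 4 * (\<Sum>c<5. mult_mat \<alpha> \<gamma> j r c * x c)) =
    (if j = r then 1 else 2) * (x j * x r) - iso_coeff \<alpha> \<gamma> x (min j r, max j r)"
proof -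
  have "(if j = r then 1 else 2) * (\<Sum>c<5. mult_mat \<alpha> \<gamma> j r c * x c) =
      - \<gamma> (min j r, max j r) * x 4 - 2 * (\<Sum>i<4. x i * \<alpha> i (min j r, max j r))"
    using assms by (auto simp: sum_5_split mult_mat_def sum_distrib_left sum_negf mult_ac distrib_left)
  then have "x 4 * ((if j = r then 1 else 2) * (\<Sum>c<5. mult_mat \<alpha> \<gamma> j r c * x c)) =
      x 4 * (- \<gamma> (min j r, max j r) * x 4 - 2 * (\<Sum>i<4. x i * \<alpha> i (min j r, max j r)))"
    by (rule arg_cong)
  moreover have "iso_coeff \<alpha> \<gamma> x (min j r, max j r) = x 4 * x 4 * \<gamma> (min j r, max j r)
      + 2 * x 4 * (\<Sum>i<4. x i * \<alpha> i (min j r, max j r)) + (if j = r then 1 else 2) * (x j * x r)"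
    by (simp add: iso_coeff_def min_def max_def)
  ultimately show ?thesis by (simp only: mult.left_commute[of _ "x 4"]) (simp add: algebra_simps)
qed

text \<open>A solution in the chart is an eigenvector of multiplication by each coordinate, and the
  eigenvalue is the value of that coordinate.\<close>

lemma mult_mat_eigen:
  assumes "\<forall>p\<in>upairs 4. iso_coeff \<alpha> \<gamma> x p = 0" "x 4 \<noteq> 0" "j < 4" "r < 5"
  shows "(\<Sum>c<5. mult_mat \<alpha> \<gamma> j r c * x c) = (x j / x 4) * x r"
proof (cases "r = 4")
  case True
  then show ?thesis using assms mult_mat_4[of j \<alpha> \<gamma> x] by simp
next
  case False
  then have r: "r < 4" using assms(4) by simp
  then have "(min j r, max j r) \<in> upairs 4" using assms(3) by (auto simp: upairs_def)
  then have "x 4 * (\<Sum>c<5. mult_mat \<alpha> \<gamma> j r c * x c) = x j * x r"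
    using mult_mat_iso[OF assms(3) r, of x \<alpha> \<gamma>] assms(1) by (auto split: if_splits)
  then show ?thesis using assms(2) by (simp add: field_simps)
qed

text \<open>Row 4 forces \<open>x j = \<mu> j * x 4\<close>; the other rows then turn into the
  vanishing of the quadrics.\<close>

lemma iso_coeff_if_eigen:
  assumes "\<And>j r. j < 4 \<Longrightarrow> r < 5 \<Longrightarrow> (\<Sum>c<5. mult_mat \<alpha> \<gamma> j r c * x c) = \<mu> j * x r"
    and "p \<in> upairs 4"
  shows "iso_coeff \<alpha> \<gamma> x p = 0"
proof -
  obtain j r where p: "p = (j, r)" "j \<le> r" "r < 4" using assms(2) by (cases p) (auto simp: upairs_def)
  have "x j = \<mu> j * x 4" using assms(1)[of j 4] mult_mat_4[of j \<alpha> \<gamma> x] p by simp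
  then have "x 4 * (\<Sum>c<5. mult_mat \<alpha> \<gamma> j r c * x c) = x j * x r"
    using assms(1)[of j r] p by simp
  then show ?thesis using mult_mat_iso[of j r x \<alpha> \<gamma>] p by (simp add: min_def max_def)
qed

lemma stab_solution_unique:
  assumes "stab_unique w" "stab w y a" "stab w y' a'" "\<And>m. m < 5 \<Longrightarrow> \<phi> m y = \<phi> m y'"
  shows "y = y'"
proof -
  \<comment> \<open>The difference \<open>y - y'\<close> is written as a \<open>comb\<close> so that
    \<open>P_sum1\<close> and \<open>\<phi>_comb\<close> apply to it.\<close>
  define t :: "nat \<Rightarrow> complex" where "t i = (if i = 0 then 1 else if i = 1 then - 1 else 0)" for i
  define v where "v i = (if i = 0 then y else y')" for i :: nat
  have c: "comb t v = y - y'"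
    by (simp add: comb_def sum_lessThan_5 t_def v_def del: One_nat_def)
  have "stab w (comb t v) (\<lambda>i p. a i p - a' i p)"
    unfolding stab_def
  proof (intro allI impI ballI)
    fix i \<kappa> assume i: "i < (4::nat)" and \<kappa>: "\<kappa> \<in> K"
    have "P (comb t v) (w i) \<kappa> = P y (w i) \<kappa> - P y' (w i) \<kappa>"
      unfolding comb_def P_sum1[OF \<kappa>] by (simp add: sum_lessThan_5 t_def v_def del: One_nat_def)
    then show "P (comb t v) (w i) \<kappa> = (\<Sum>p\<in>upairs 4. (a i p - a' i p) * P (w (fst p)) (w (snd p)) \<kappa>)"
      using assms(2,3) i \<kappa> by (simp add: stab_def left_diff_distrib sum_subtractf)
  qed
  moreover have "\<forall>m<5. \<phi> m (comb t v) = 0"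
    using assms(4) by (simp add: \<phi>_comb sum_lessThan_5 t_def v_def del: One_nat_def)
  ultimately have "comb t v = 0" using assms(1) unfolding stab_unique_def by blast
  then show ?thesis using c by simp
qed

text \<open>Uniqueness in the stabilizer places \<open>\<eta>\<close> in the span of
  \<open>\<omega>\<close>. So \<open>stab_frame w \<eta>\<close> and \<open>\<omega>\<close> are two
  bases of the same space, with \<open>T\<close> and \<open>x\<close> as transition
  matrices.\<close>

lemma secant_frame:
  assumes "stab_data w \<eta> \<alpha> \<gamma>" "isotropic \<omega>" "\<And>j. j < 4 \<Longrightarrow> w j = comb (u j) \<omega>"
  shows "\<exists>T x. (\<forall>i<5. stab_frame w \<eta> i = comb (T i) \<omega>) \<and> (\<forall>i<5. \<omega> i = comb (x i) (stab_frame w \<eta>)) \<and>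
    (\<forall>i<5. \<forall>c<5. (\<Sum>l<5. T i l * x l c) = (if i = c then 1 else 0))"
proof -
  let ?v = "stab_frame w \<eta>"
  have d: "stab_unique w" "squares_independent w" "stab w \<eta> \<alpha>" "\<And>m. m < 5 \<Longrightarrow> \<phi> m \<eta> = (if m = 4 then 1 else 0)"
    using assms(1) by (simp_all add: stab_data_def)
  have "\<exists>t a g. stab w (comb t \<omega>) a \<and> (\<forall>m<5. \<phi> m (comb t \<omega>) = (if m = 4 then 1 else 0)) \<and>
      (\<forall>\<kappa>\<in>K. P (comb t \<omega>) (comb t \<omega>) \<kappa> = (\<Sum>q\<in>upairs 4. g q * P (w (fst q)) (w (snd q)) \<kappa>))"
    by (rule secant_solution[OF assms(2) assms(3) d(2) d(1)])
  then obtain t a where t: "stab w (comb t \<omega>) a" "\<forall>m<5. \<phi> m (comb t \<omega>) = (if m = 4 then 1 else 0)"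
    by (elim exE conjE)
  have \<eta>: "\<eta> = comb t \<omega>"
    by (rule stab_solution_unique[OF d(1) d(3) t(1)]) (simp add: d(4) t(2))
  define T where "T i = (if i = 4 then t else u i)" for i
  have T: "?v i = comb (T i) \<omega>" if "i < 5" for i
    using that assms(3)[of i] \<eta> by (auto simp: stab_frame_def T_def)
  have X_comb: "X q (comb z v) = (\<Sum>i<5. z i * X q (v i))" if "q \<in> Q" for q z v
    unfolding comb_def by (rule linear_sum_scale[OF X_linear[OF that]])
  have ind: "\<forall>c. (\<forall>q\<in>Q. (\<Sum>i\<in>{..<5}. c i * X q (?v i)) = 0) \<longrightarrow> (\<forall>i\<in>{..<5}. c i = 0)"
  proof (intro allI impI)
    fix c assume "\<forall>q\<in>Q. (\<Sum>i<5. c i * X q (?v i)) = 0"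
    moreover have "X q 0 = 0" if "q \<in> Q" for q
      using linear_sum_scale[OF X_linear[OF that], of "\<lambda>_. 0" "\<lambda>_. 0" "{}"] by simp
    ultimately have c: "comb c ?v = 0" by (intro X_cong) (simp add: X_comb)
    show "\<forall>i\<in>{..<5}. c i = 0"
      using stab_frame_independent[OF assms(1) c] by simp
  qed
  have "\<exists>B. \<forall>l\<in>{..<5}. \<forall>q\<in>Q. X q (\<omega> l) = (\<Sum>j\<in>{..<5}. B l j * X q (?v j))"
    by (rule family_basis_change(1)[of "{..<5}" "{..<5}" Q "\<lambda>j q. X q (?v j)" T "\<lambda>l q. X q (\<omega> l)", OF finite_lessThan finite_lessThan refl _ ind])
      (simp add: T X_comb)
  then obtain x where x: "\<forall>l\<in>{..<5}. \<forall>q\<in>Q. X q (\<omega> l) = (\<Sum>j\<in>{..<5}. x l j * X q (?v j))"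
    by (rule exE)
  have \<omega>: "\<omega> l = comb (x l) ?v" if "l < 5" for l
    using x that by (intro X_cong) (simp add: X_comb)
  have "(\<Sum>l<5. T i l * x l c) = (if c = i then 1 else 0)" if i: "i < 5" and c: "c < 5" for i c
  proof -
    have "comb (\<lambda>c. \<Sum>l<5. T i l * x l c) ?v = comb (T i) (\<lambda>l. comb (x l) ?v)"
      by (rule comb_comb[symmetric])
    also have "\<dots> = comb (T i) \<omega>" by (intro comb_cong) (simp_all add: \<omega>)
    also have "\<dots> = comb (\<lambda>k. if k = i then 1 else 0) ?v" using T[OF i] comb_unit[OF i, of ?v] by simp
    finally have "comb (\<lambda>c. (\<Sum>l<5. T i l * x l c) - (if c = i then 1 else 0)) ?v = 0"
      by (simp add: comb_diff[symmetric])
    from stab_frame_independent[OF assms(1) this c] show ?thesis by simp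
  qed
  then show ?thesis using T \<omega>
    by (intro exI[of _ T] exI[of _ x]) auto
qed

lemma secant_eigen:
  assumes "stab_data w \<eta> \<alpha> \<gamma>" "isotropic \<omega>" "i < 5" "\<omega> i = comb x (stab_frame w \<eta>)" "\<omega> i \<noteq> 0" "j < 4" "r < 5"
  shows "(\<Sum>c<5. mult_mat \<alpha> \<gamma> j r c * x c) = (x j / x 4) * x r"
proof -
  have "\<forall>\<kappa>\<in>K. P (comb x (stab_frame w \<eta>)) (comb x (stab_frame w \<eta>)) \<kappa> = 0"
    using assms(2,3) unfolding assms(4)[symmetric] isotropic_def by blast
  then have iso: "\<forall>p\<in>upairs 4. iso_coeff \<alpha> \<gamma> x p = 0" using iso_coeff_zero_iff[OF assms(1)] by blast
  have "\<exists>i<5. x i \<noteq> 0"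
  proof (rule ccontr)
    assume "\<not> (\<exists>i<5. x i \<noteq> 0)"
    then have "comb x (stab_frame w \<eta>) = 0" by (simp add: comb_def)
    then show False using assms(4,5) by simp
  qed
  then have "x 4 \<noteq> 0" using iso_coeff_top_nonzero[OF iso] by blast
  then show ?thesis by (rule mult_mat_eigen[OF iso _ assms(6,7)])
qed

text \<open>The coordinate vectors of the five \<open>\<omega> i\<close> form a basis of common
  eigenvectors, so the matrices are simultaneously diagonal.\<close>

lemma secant_commute:
  assumes d: "stab_data w \<eta> \<alpha> \<gamma>" and iso: "isotropic \<omega>" and w: "\<And>j. j < 4 \<Longrightarrow> w j = comb (u j) \<omega>"
    and jk: "j < 4" "k < 4" and rc: "r < 5" "c < 5"
  shows "(\<Sum>m<5. mult_mat \<alpha> \<gamma> j r m * mult_mat \<alpha> \<gamma> k m c) = (\<Sum>m<5. mult_mat \<alpha> \<gamma> k r m * mult_mat \<alpha> \<gamma> j m c)"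
proof -
  let ?v = "stab_frame w \<eta>" and ?N = "mult_mat \<alpha> \<gamma>"
  have "\<exists>T x. (\<forall>i<5. ?v i = comb (T i) \<omega>) \<and> (\<forall>i<5. \<omega> i = comb (x i) ?v) \<and>
    (\<forall>i<5. \<forall>c<5. (\<Sum>l<5. T i l * x l c) = (if i = c then 1 else 0))"
    by (rule secant_frame[OF d iso w])
  then obtain T x where T: "\<forall>i<5. \<forall>c<5. (\<Sum>l<5. T i l * x l c) = (if i = c then 1 else 0)"
    and x: "\<forall>i<5. \<omega> i = comb (x i) ?v"
    by (elim exE conjE)
  have sq: "squares_independent w" using d by (simp add: stab_data_def)
  have PI: "products_independent \<omega>" by (rule products_from_squares(1)[OF iso w sq])
  have nz: "\<omega> i \<noteq> 0" if i: "i < 5" for i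
  proof
    assume "\<omega> i = 0"
    then have "comb (\<lambda>k. if k = i then 1 else 0) \<omega> = 0" using comb_unit[OF i, of \<omega>] by simp
    from independent_if_products_independent[OF iso PI this i] show False by simp
  qed
  have eig: "(\<Sum>c<5. ?N j r c * x i c) = (x i j / x i 4) * x i r" if "i < 5" "j < 4" "r < 5" for i j r
    using secant_eigen[OF d iso that(1) _ nz[OF that(1)] that(2,3)] x that(1) by blast
  have NN: "(\<Sum>c<5. (\<Sum>m<5. ?N j r m * ?N k m c) * x i c) = (x i j / x i 4) * (x i k / x i 4) * x i r"
    if "i < 5" "j < 4" "k < 4" for i j k
  proof -
    have "(\<Sum>c<5. (\<Sum>m<5. ?N j r m * ?N k m c) * x i c) = (\<Sum>c<5. \<Sum>m<5. ?N j r m * (?N k m c * x i c))"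
      by (simp add: sum_distrib_right mult.assoc)
    also have "\<dots> = (\<Sum>m<5. ?N j r m * (\<Sum>c<5. ?N k m c * x i c))"
      by (subst sum.swap) (simp add: sum_distrib_left)
    also have "\<dots> = (\<Sum>m<5. (x i k / x i 4) * (?N j r m * x i m))"
      by (intro sum.cong refl) (simp add: eig that)
    also have "\<dots> = (x i k / x i 4) * ((x i j / x i 4) * x i r)"
      unfolding sum_distrib_left[symmetric] by (simp add: eig that rc)
    finally show ?thesis by simp
  qed
  \<comment> \<open>\<open>M\<close> is row \<open>r\<close> of the commutator. It annihilates every
    \<open>x i\<close>, and \<open>T\<close> writes the unit vectors as combinations of the
    \<open>x i\<close>.\<close>
  define M where "M c = (\<Sum>m<5. ?N j r m * ?N k m c) - (\<Sum>m<5. ?N k r m * ?N j m c)" for c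
  have Mx: "(\<Sum>c<5. M c * x i c) = 0" if "i < 5" for i
    unfolding M_def left_diff_distrib sum_subtractf
    using NN[OF that jk] NN[OF that jk(2) jk(1)] by simp
  have "M c = (\<Sum>c'<5. if c' = c then M c' else 0)" using rc by simp
  also have "\<dots> = (\<Sum>c'<5. M c' * (\<Sum>l<5. T c l * x l c'))"
    using T rc by (intro sum.cong) auto
  also have "\<dots> = (\<Sum>c'<5. \<Sum>l<5. T c l * (M c' * x l c'))"
    by (simp add: sum_distrib_left mult.left_commute)
  also have "\<dots> = (\<Sum>l<5. T c l * (\<Sum>c'<5. M c' * x l c'))"
    by (subst sum.swap) (simp add: sum_distrib_left)
  also have "\<dots> = 0" using Mx by simp
  finally show ?thesis by (simp add: M_def)
qed

end

section \<open>Recovering the decomposition from common eigenvectors\<close>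

context secant_web_dual
begin

text \<open>The weights 1, 2, 3, 4 separate the five eigenlines at the base point, where the
  eigenvalues are -1, -2, -3, -4 and 0.\<close>

definition mult_sum :: "(nat \<Rightarrow> nat \<times> nat \<Rightarrow> complex) \<Rightarrow> (nat \<times> nat \<Rightarrow> complex) \<Rightarrow> nat \<Rightarrow> nat \<Rightarrow> complex" where
  "mult_sum \<alpha> \<gamma> r c = (\<Sum>j<4. of_nat (Suc j) * mult_mat \<alpha> \<gamma> j r c)"

lemma rat_mult_mat:
  assumes D: "polyfun FC D" and \<alpha>: "\<And>i p. i < 4 \<Longrightarrow> p \<in> upairs 4 \<Longrightarrow> rat FC D (\<lambda>w. \<alpha> w i p)"
    and \<gamma>: "\<And>p. p \<in> upairs 4 \<Longrightarrow> rat FC D (\<lambda>w. \<gamma> w p)" and "j < 4" "r < 5" "c < 5"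
  shows "rat FC D (\<lambda>w. mult_mat (\<alpha> w) (\<gamma> w) j r c)"
proof (cases "r = 4")
  case True
  then show ?thesis by (simp add: mult_mat_def rat_const)
next
  case False
  then have p: "(min j r, max j r) \<in> upairs 4" using assms by (auto simp: upairs_def)
  have "rat FC D (\<lambda>w. (- 1 / (if j = r then 1 else 2)) * \<gamma> w (min j r, max j r))"
    by (intro rat_mult rat_const \<gamma> p)
  moreover have "rat FC D (\<lambda>w. (- 2 / (if j = r then 1 else 2)) * \<alpha> w c (min j r, max j r))" if "c \<noteq> 4"
    using that assms(6) by (intro rat_mult rat_const \<alpha> p) auto
  ultimately show ?thesis using False by (cases "c = 4") (auto simp: mult_mat_def)
qed

text \<open>At the base point \<open>\<eta>\<close> is the fifth bivector, and the other four are
  \<open>w\<^sub>0 i - \<eta>\<close>, with affine coordinate -1 in position \<open>i\<close> and 0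
  elsewhere.\<close>

lemma base_distinct_roots:
  assumes d: "stab_data w\<^sub>0 \<eta> \<alpha> \<gamma>"
  shows "card {z. poly (char_poly (Matrix.mat 5 5 (\<lambda>(r, c). mult_sum \<alpha> \<gamma> r c))) z = 0} = 5"
proof -
  let ?v = "stab_frame w\<^sub>0 \<eta>"
  define u where "u j i = ((if i = j then 1 else 0) + (if i = 4 then 1 else (0::complex)))" for i j :: nat
  have w: "w\<^sub>0 j = comb (u j) \<omega>\<^sub>0" if "j < 4" for j unfolding u_def by (rule w\<^sub>0_comb[OF that])
  have "\<exists>T x. (\<forall>i<5. ?v i = comb (T i) \<omega>\<^sub>0) \<and> (\<forall>i<5. \<omega>\<^sub>0 i = comb (x i) ?v) \<and>
    (\<forall>i<5. \<forall>c<5. (\<Sum>l<5. T i l * x l c) = (if i = c then 1 else 0))"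
    by (rule secant_frame[OF d isotropic_base w])
  then obtain T where T: "\<forall>i<5. ?v i = comb (T i) \<omega>\<^sub>0" by (elim exE conjE)
  \<comment> \<open>Both vectors lie in the span of the base bivectors, where the five forms
    separate points.\<close>
  have eta: "\<eta> = \<omega>\<^sub>0 4"
  proof -
    define t where "t i = T 4 i - (if i = 4 then 1 else 0)" for i
    have t: "comb t \<omega>\<^sub>0 = \<eta> - \<omega>\<^sub>0 4"
      using T[THEN spec[of _ 4]] comb_unit[of 4 \<omega>\<^sub>0] unfolding t_def comb_diff[symmetric] by (simp add: stab_frame_def)
    have 1: "\<phi> m (comb t \<omega>\<^sub>0) = 0" if "m < 5" for m
    proof -
      have "\<phi> m (comb t \<omega>\<^sub>0) = \<phi> m \<eta> - \<phi> m (\<omega>\<^sub>0 4)"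
      proof -
        interpret f: Vector_Spaces.linear s "(*)" "\<phi> m" by (rule \<phi>_linear)
        show ?thesis unfolding t by (rule f.diff)
      qed
      then show ?thesis using d \<phi>_\<omega>\<^sub>0[OF that] that by (simp add: stab_data_def)
    qed
    have "t m = 0" if "m < 5" for m by (rule \<phi>_comb_base[OF that 1])
    then have "comb t \<omega>\<^sub>0 = 0" by (simp add: comb_def)
    then show ?thesis using t by simp
  qed
  define x where "x i c = (if i = 4 then (if c = 4 then 1 else 0) else (if c = i then 1 else 0) - (if c = 4 then 1 else (0::complex)))" for i c :: nat
  have x: "\<omega>\<^sub>0 i = comb (x i) ?v" if "i < 5" for i
  proof (cases "i = 4")
    case True
    moreover have "x 4 = (\<lambda>c. if c = 4 then 1 else 0)" by (simp add: x_def fun_eq_iff)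
    ultimately show ?thesis using comb_unit[of 4 ?v] by (simp add: stab_frame_def eta)
  next
    case False
    then have "comb (x i) ?v = comb (\<lambda>c. if c = i then 1 else 0) ?v - comb (\<lambda>c. if c = 4 then 1 else 0) ?v"
      unfolding comb_diff by (intro comb_cong) (simp_all add: x_def)
    also have "\<dots> = \<omega>\<^sub>0 i" using False that comb_unit[of i ?v] comb_unit[of 4 ?v]
      by (simp add: stab_frame_def eta w\<^sub>0_def)
    finally show ?thesis by simp
  qed
  have nz: "\<omega>\<^sub>0 i \<noteq> 0" if i: "i < 5" for i
  proof
    assume "\<omega>\<^sub>0 i = 0"
    then have "comb (\<lambda>k. if k = i then 1 else 0) \<omega>\<^sub>0 = 0" using comb_unit[OF i, of \<omega>\<^sub>0] by simp
    from base_independent[OF this i] show False by simp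
  qed
  define \<mu> where "\<mu> i = (if i = 4 then 0 else - of_nat (Suc i) :: complex)" for i :: nat
  show ?thesis
  proof (rule card_roots_char_poly[of \<mu> 5 _ x])
    show "inj_on \<mu> {..<5}"
    proof (rule inj_onI)
      fix i k assume "\<mu> i = \<mu> k"
      then show "i = k" unfolding \<mu>_def by (auto split: if_splits simp del: of_nat_Suc)
    qed
    show "\<exists>r<5. x i r \<noteq> 0" if "i < 5" for i
      by (intro exI[of _ 4]) (auto simp: x_def)
    fix i r :: nat assume i: "i < 5" and r: "r < 5"
    have "(\<Sum>c<5. mult_sum \<alpha> \<gamma> r c * x i c) = (\<Sum>c<5. \<Sum>j<4. of_nat (Suc j) * (mult_mat \<alpha> \<gamma> j r c * x i c))"
      by (simp add: mult_sum_def sum_distrib_right mult.assoc)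
    also have "\<dots> = (\<Sum>j<4. of_nat (Suc j) * (\<Sum>c<5. mult_mat \<alpha> \<gamma> j r c * x i c))"
      by (subst sum.swap) (simp add: sum_distrib_left)
    also have "\<dots> = (\<Sum>j<4. of_nat (Suc j) * ((x i j / x i 4) * x i r))"
      by (intro sum.cong refl, subst secant_eigen[OF d isotropic_base i x[OF i] nz[OF i] _ r]) auto
    also have "\<dots> = (\<Sum>j<4. if j = i then \<mu> i * x i r else 0)"
      by (intro sum.cong refl) (auto simp: x_def \<mu>_def)
    also have "\<dots> = \<mu> i * x i r" using i by (auto simp: \<mu>_def)
    finally show "(\<Sum>c<5. mult_sum \<alpha> \<gamma> r c * x i c) = \<mu> i * x i r" .
  qed
qed

text \<open>Distinct eigenvalues make the eigenspaces of \<open>mult_sum\<close> one-dimensional.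
  Matrices that commute with it preserve them, so its five eigenvectors are common to all
  \<open>mult_mat\<close> and give isotropic vectors. Being independent, these span the same space
  as \<open>stab_frame w \<eta>\<close>, which contains the frame.\<close>

lemma decomposition_exists:
  assumes d: "stab_data w \<eta> \<alpha> \<gamma>"
    and comm: "\<And>j k r c. j < 4 \<Longrightarrow> k < 4 \<Longrightarrow> r < 5 \<Longrightarrow> c < 5 \<Longrightarrow>
      (\<Sum>m<5. mult_mat \<alpha> \<gamma> j r m * mult_mat \<alpha> \<gamma> k m c) = (\<Sum>m<5. mult_mat \<alpha> \<gamma> k r m * mult_mat \<alpha> \<gamma> j m c)"
    and card: "card {z. poly (char_poly (Matrix.mat 5 5 (\<lambda>(r, c). mult_sum \<alpha> \<gamma> r c))) z = 0} = 5"
  shows "\<exists>\<omega> u. isotropic \<omega> \<and> (\<forall>j<4. w j = comb (u j) \<omega>)"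
proof -
  let ?v = "stab_frame w \<eta>" and ?N = "mult_mat \<alpha> \<gamma>"
  obtain \<mu> :: "nat \<Rightarrow> complex" and x where \<mu>: "inj_on \<mu> {..<5}"
    and eig: "\<And>i r. i < 5 \<Longrightarrow> r < 5 \<Longrightarrow> (\<Sum>c<5. mult_sum \<alpha> \<gamma> r c * x i c) = \<mu> i * x i r"
    and nz: "\<And>i. i < 5 \<Longrightarrow> \<exists>r<5. x i r \<noteq> (0::complex)"
  proof (rule eigenvectors_if_distinct_roots[OF card])
    fix \<mu> :: "nat \<Rightarrow> complex" and x
    assume "inj_on \<mu> {..<5}" "\<And>i r. i < 5 \<Longrightarrow> r < 5 \<Longrightarrow> (\<Sum>c<5. mult_sum \<alpha> \<gamma> r c * x i c) = \<mu> i * x i r"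
      "\<And>i. i < 5 \<Longrightarrow> \<exists>r<5. x i r \<noteq> 0"
    then show thesis by (rule that)
  qed
  have ind: "\<forall>i\<in>{..<5}. e i = 0" if e: "\<And>r. r < 5 \<Longrightarrow> (\<Sum>i<5. e i * x i r) = 0" for e
  proof (rule eigenvector_family_independent[OF finite_lessThan \<mu>, of 5 "mult_sum \<alpha> \<gamma>" x])
    show "(\<Sum>c<5. mult_sum \<alpha> \<gamma> r c * x i c) = \<mu> i * x i r" if "i \<in> {..<5}" "r < 5" for i r
      using that by (intro eig) auto
    show "\<exists>r<5. x i r \<noteq> 0" if "i \<in> {..<5}" for i using that by (intro nz) auto
    show "(\<Sum>i<5. e i * x i r) = 0" if "r < 5" for r using that by (rule e)
  qed
  have "\<exists>B. (\<forall>i\<in>{..<5}. \<forall>i'\<in>{..<5}. (\<Sum>j\<in>{..<5}. x j i * B j i') = (if i = i' then 1 else 0)) \<and>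
    (\<forall>j\<in>{..<5}. \<forall>j'\<in>{..<5}. (\<Sum>i\<in>{..<5}. B j i * x j' i) = (if j = j' then 1 else 0))"
  proof (rule square_inverse[of "{..<5}" "{..<5}" "\<lambda>r i. x i r"])
    show "\<forall>c. (\<forall>i\<in>{..<5}. (\<Sum>j<5. x j i * c j) = 0) \<longrightarrow> (\<forall>j\<in>{..<5}. c j = 0)"
    proof (intro allI impI)
      fix e assume e: "\<forall>i\<in>{..<5}. (\<Sum>j<5. x j i * e j) = 0"
      show "\<forall>j\<in>{..<5}. e j = 0"
        by (rule ind) (use e in \<open>simp add: mult.commute\<close>)
    qed
  qed simp_all
  then obtain B where B: "\<forall>i\<in>{..<5}. \<forall>i'\<in>{..<5}. (\<Sum>j\<in>{..<5}. x j i * B j i') = (if i = i' then 1 else 0)"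
    by (elim exE conjE)
  \<comment> \<open>\<open>B\<close> inverts the matrix of eigenvectors, so this is the expansion of
    \<open>y\<close> in the eigenbasis.\<close>
  have expand: "y r = (\<Sum>t<5. (\<Sum>c<5. B t c * y c) * x t r)" if r: "r < 5" for y r
  proof -
    have "(\<Sum>t<5. (\<Sum>c<5. B t c * y c) * x t r) = (\<Sum>t<5. \<Sum>c<5. y c * (x t r * B t c))"
      unfolding sum_distrib_right by (intro sum.cong refl) (simp add: mult_ac)
    also have "\<dots> = (\<Sum>c<5. y c * (\<Sum>t<5. x t r * B t c))"
      by (subst sum.swap) (simp add: sum_distrib_left)
    also have "\<dots> = (\<Sum>c<5. if c = r then y c else 0)"
      using B r by (intro sum.cong) auto
    also have "\<dots> = y r" using r by simp
    finally show ?thesis by simp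
  qed
  have joint: "\<exists>m. \<forall>r<5. (\<Sum>c<5. ?N j r c * x i c) = m * x i r" if i: "i < 5" and j: "j < 4" for i j
  proof -
    define y where "y r = (\<Sum>c<5. ?N j r c * x i c)" for r
    define e where "e t = (\<Sum>c<5. B t c * y c)" for t
    have y: "y r = (\<Sum>t<5. e t * x t r)" if "r < 5" for r unfolding e_def by (rule expand[OF that])
    \<comment> \<open>By commutation, \<open>y\<close> stays in the eigenspace of
      \<open>\<mu> i\<close>.\<close>
    have Ny: "(\<Sum>c<5. mult_sum \<alpha> \<gamma> r c * y c) = \<mu> i * y r" if r: "r < 5" for r
    proof -
      have "(\<Sum>c<5. mult_sum \<alpha> \<gamma> r c * y c) = (\<Sum>c<5. \<Sum>c'<5. mult_sum \<alpha> \<gamma> r c * ?N j c c' * x i c')"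
        by (simp add: y_def sum_distrib_left mult.assoc)
      also have "\<dots> = (\<Sum>c'<5. (\<Sum>c<5. mult_sum \<alpha> \<gamma> r c * ?N j c c') * x i c')"
        by (subst sum.swap) (simp add: sum_distrib_right)
      also have "\<dots> = (\<Sum>c'<5. (\<Sum>c<5. ?N j r c * mult_sum \<alpha> \<gamma> c c') * x i c')"
      proof (rule sum.cong[OF refl], rule arg_cong2[where f = "(*)", OF _ refl])
        fix c' :: nat assume c': "c' \<in> {..<5}"
        have "(\<Sum>c<5. mult_sum \<alpha> \<gamma> r c * ?N j c c') = (\<Sum>c<5. \<Sum>k<4. of_nat (Suc k) * (?N k r c * ?N j c c'))"
          by (simp add: mult_sum_def sum_distrib_right mult.assoc)
        also have "\<dots> = (\<Sum>k<4. of_nat (Suc k) * (\<Sum>c<5. ?N k r c * ?N j c c'))"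
          by (subst sum.swap) (simp add: sum_distrib_left)
        also have "\<dots> = (\<Sum>k<4. of_nat (Suc k) * (\<Sum>c<5. ?N j r c * ?N k c c'))"
          using c' comm[OF _ j r] by (intro sum.cong refl) simp
        also have "\<dots> = (\<Sum>k<4. \<Sum>c<5. ?N j r c * (of_nat (Suc k) * ?N k c c'))"
          by (simp add: sum_distrib_left mult.left_commute)
        also have "\<dots> = (\<Sum>c<5. ?N j r c * mult_sum \<alpha> \<gamma> c c')"
          by (subst sum.swap) (simp add: mult_sum_def sum_distrib_left)
        finally show "(\<Sum>c<5. mult_sum \<alpha> \<gamma> r c * ?N j c c') = (\<Sum>c<5. ?N j r c * mult_sum \<alpha> \<gamma> c c')" .
      qed
      also have "\<dots> = (\<Sum>c'<5. \<Sum>c<5. ?N j r c * (mult_sum \<alpha> \<gamma> c c' * x i c'))"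
        by (simp add: sum_distrib_right mult.assoc)
      also have "\<dots> = (\<Sum>c<5. ?N j r c * (\<Sum>c'<5. mult_sum \<alpha> \<gamma> c c' * x i c'))"
        by (subst sum.swap) (simp add: sum_distrib_left)
      also have "\<dots> = (\<Sum>c<5. \<mu> i * (?N j r c * x i c))"
        by (intro sum.cong refl) (simp add: eig[OF i])
      finally show ?thesis by (simp add: y_def sum_distrib_left)
    qed
    have "(\<Sum>t<5. (e t * (\<mu> t - \<mu> i)) * x t r) = 0" if r: "r < 5" for r
    proof -
      have "(\<Sum>c<5. mult_sum \<alpha> \<gamma> r c * y c) = (\<Sum>c<5. \<Sum>t<5. e t * (mult_sum \<alpha> \<gamma> r c * x t c))"
        by (intro sum.cong refl) (simp add: y sum_distrib_left mult.left_commute)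
      also have "\<dots> = (\<Sum>t<5. e t * (\<Sum>c<5. mult_sum \<alpha> \<gamma> r c * x t c))"
        by (subst sum.swap) (simp add: sum_distrib_left)
      also have "\<dots> = (\<Sum>t<5. e t * (\<mu> t * x t r))"
        by (intro sum.cong refl) (simp add: eig r)
      finally have "(\<Sum>t<5. e t * (\<mu> t * x t r)) = (\<Sum>t<5. \<mu> i * (e t * x t r))"
        using Ny[OF r] y[OF r] by (simp add: sum_distrib_left)
      moreover have "(\<Sum>t<5. (e t * (\<mu> t - \<mu> i)) * x t r) = (\<Sum>t<5. e t * (\<mu> t * x t r)) - (\<Sum>t<5. \<mu> i * (e t * x t r))"
        unfolding sum_subtractf[symmetric] by (intro sum.cong refl) (simp add: algebra_simps)
      ultimately show ?thesis by simp
    qed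
    from ind[OF this] have e: "e t * (\<mu> t - \<mu> i) = 0" if "t < 5" for t using that by simp
    have e0: "e t = 0" if "t < 5" "t \<noteq> i" for t
      using e[OF that(1)] \<mu> that i by (auto simp: inj_on_def)
    have "y r = e i * x i r" if r: "r < 5" for r
    proof -
      have "y r = (\<Sum>t<5. if t = i then e t * x t r else 0)"
        unfolding y[OF r] by (intro sum.cong refl) (auto simp: e0)
      then show ?thesis using i by simp
    qed
    then show ?thesis unfolding y_def by (intro exI[of _ "e i"]) simp
  qed
  define \<omega> where "\<omega> i = comb (x i) ?v" for i
  have "isotropic \<omega>"
    unfolding isotropic_def
  proof (intro allI impI)
    fix i :: nat assume i: "i < 5"
    have "\<forall>j\<in>{..<4}. \<exists>m. \<forall>r<5. (\<Sum>c<5. ?N j r c * x i c) = m * x i r" using joint[OF i] by simp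
    then have "\<exists>m. \<forall>j\<in>{..<4}. \<forall>r<5. (\<Sum>c<5. ?N j r c * x i c) = m j * x i r" by (rule bchoice)
    then obtain m where m: "\<forall>j\<in>{..<4}. \<forall>r<5. (\<Sum>c<5. ?N j r c * x i c) = m j * x i r" by (rule exE)
    have "iso_coeff \<alpha> \<gamma> (x i) p = 0" if "p \<in> upairs 4" for p
      by (rule iso_coeff_if_eigen[OF _ that, where \<mu> = m]) (use m in simp)
    then show "\<forall>\<kappa>\<in>K. P (\<omega> i) (\<omega> i) \<kappa> = 0"
      unfolding \<omega>_def iso_coeff_zero_iff[OF d] by blast
  qed
  moreover have "w j = comb (\<lambda>i. B i j) \<omega>" if j: "j < 4" for j
  proof -
    have "comb (\<lambda>i. B i j) \<omega> = comb (\<lambda>c. \<Sum>i<5. B i j * x i c) ?v"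
      unfolding \<omega>_def by (rule comb_comb)
    also have "\<dots> = comb (\<lambda>c. if c = j then 1 else 0) ?v"
      using B j by (intro comb_cong) (simp_all add: mult.commute[of "B _ _"])
    also have "\<dots> = w j" using comb_unit[of j ?v] j by (simp add: stab_frame_def)
    finally show ?thesis by simp
  qed
  ultimately show ?thesis by (intro exI[of _ \<omega>] exI[of _ "\<lambda>j i. B i j"]) simp
qed

definition spanned :: "(nat \<Rightarrow> 'e) \<Rightarrow> (nat \<Rightarrow> 'e) \<Rightarrow> bool" where
  "spanned w \<omega> \<longleftrightarrow> (\<exists>u. \<forall>j<4. w j = comb (u j) \<omega>)"

text \<open>\<open>G\<close> is the common denominator times the numerator of the discriminant. For
  uniqueness, every decomposition of \<open>w\<close> spans the same space as the stabilizer frame,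
  which depends on \<open>w\<close> alone.\<close>

theorem generic_decomposition:
  "\<exists>G. polyfun FC G \<and> G w\<^sub>0 \<noteq> 0 \<and> (\<forall>w. G w \<noteq> 0 \<longrightarrow>
    (\<exists>\<omega>. isotropic \<omega> \<and> products_independent \<omega> \<and> spanned w \<omega> \<and>
      (\<forall>\<omega>'. isotropic \<omega>' \<and> spanned w \<omega>' \<longrightarrow> (\<exists>T T'. (\<forall>i<5. \<omega>' i = comb (T i) \<omega>) \<and> (\<forall>i<5. \<omega> i = comb (T' i) \<omega>')))))"
proof -
  obtain D \<eta> \<alpha> \<gamma> where D: "polyfun FC D" "D w\<^sub>0 \<noteq> 0"
    and good: "\<forall>w. D w \<noteq> 0 \<longrightarrow> nondeg w \<and> stab_unique w \<and> squares_independent w"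
    and \<alpha>: "\<forall>i<4. \<forall>p\<in>upairs 4. rat FC D (\<lambda>w. \<alpha> w i p)" and \<gamma>: "\<forall>p\<in>upairs 4. rat FC D (\<lambda>w. \<gamma> w p)"
    and st: "\<forall>w. D w \<noteq> 0 \<longrightarrow> stab w (\<eta> w) (\<alpha> w) \<and> (\<forall>m<5. \<phi> m (\<eta> w) = (if m = 4 then 1 else 0)) \<and>
      (\<forall>\<kappa>\<in>K. P (\<eta> w) (\<eta> w) \<kappa> = (\<Sum>q\<in>upairs 4. \<gamma> w q * P (w (fst q)) (w (snd q)) \<kappa>))"
    using stabilizer_functions by (elim exE conjE)
  have data: "stab_data w (\<eta> w) (\<alpha> w) (\<gamma> w)" if "D w \<noteq> 0" for w
    using good[THEN spec[of _ w]] st[THEN spec[of _ w]] that unfolding stab_data_def by blast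
  have rN: "rat FC D (\<lambda>w. mult_mat (\<alpha> w) (\<gamma> w) j r c)" if "j < 4" "r < 5" "c < 5" for j r c
    using \<alpha> \<gamma> that by (intro rat_mult_mat D) auto
  \<comment> \<open>The entries of the commutator are rational in \<open>w\<close> and vanish at the
    special frames.\<close>
  have comm: "(\<Sum>m<5. mult_mat (\<alpha> w) (\<gamma> w) j r m * mult_mat (\<alpha> w) (\<gamma> w) k m c) =
      (\<Sum>m<5. mult_mat (\<alpha> w) (\<gamma> w) k r m * mult_mat (\<alpha> w) (\<gamma> w) j m c)"
    if Dw: "D w \<noteq> 0" and jk: "j < 4" "k < 4" and rc: "r < 5" "c < 5" for w j k r c
  proof -
    have "(\<Sum>m<5. mult_mat (\<alpha> w) (\<gamma> w) j r m * mult_mat (\<alpha> w) (\<gamma> w) k m c) -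
      (\<Sum>m<5. mult_mat (\<alpha> w) (\<gamma> w) k r m * mult_mat (\<alpha> w) (\<gamma> w) j m c) = 0"
    proof (rule rat_zero[OF D(1) _ Dw, of "\<lambda>w. (\<Sum>m<5. mult_mat (\<alpha> w) (\<gamma> w) j r m * mult_mat (\<alpha> w) (\<gamma> w) k m c) -
      (\<Sum>m<5. mult_mat (\<alpha> w) (\<gamma> w) k r m * mult_mat (\<alpha> w) (\<gamma> w) j m c)"])
      show "rat FC D (\<lambda>w. (\<Sum>m<5. mult_mat (\<alpha> w) (\<gamma> w) j r m * mult_mat (\<alpha> w) (\<gamma> w) k m c) -
        (\<Sum>m<5. mult_mat (\<alpha> w) (\<gamma> w) k r m * mult_mat (\<alpha> w) (\<gamma> w) j m c))"
        using jk rc by (intro rat_diff rat_sum rat_mult D(1) rN) auto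
      fix w :: "nat \<Rightarrow> 'e" and \<omega> u assume *: "isotropic \<omega>" "\<And>j. j < 4 \<Longrightarrow> w j = comb (u j) \<omega>" "D w \<noteq> 0"
      have "(\<Sum>m<5. mult_mat (\<alpha> w) (\<gamma> w) j r m * mult_mat (\<alpha> w) (\<gamma> w) k m c) =
        (\<Sum>m<5. mult_mat (\<alpha> w) (\<gamma> w) k r m * mult_mat (\<alpha> w) (\<gamma> w) j m c)"
        by (rule secant_commute[OF data[OF *(3)] *(1) *(2) jk rc])
      then show "(\<Sum>m<5. mult_mat (\<alpha> w) (\<gamma> w) j r m * mult_mat (\<alpha> w) (\<gamma> w) k m c) -
        (\<Sum>m<5. mult_mat (\<alpha> w) (\<gamma> w) k r m * mult_mat (\<alpha> w) (\<gamma> w) j m c) = 0" by simp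
    qed
    then show ?thesis by simp
  qed
  have rS: "rat FC D (\<lambda>w. mult_sum (\<alpha> w) (\<gamma> w) r c)" if "r < 5" "c < 5" for r c
    unfolding mult_sum_def using that by (intro rat_sum rat_mult rat_const D(1) rN) auto
  have "\<exists>h. rat FC D h \<and>
    (\<forall>w. h w \<noteq> 0 \<longleftrightarrow> card {z. poly (char_poly (Matrix.mat 5 5 (\<lambda>(r, c). mult_sum (\<alpha> w) (\<gamma> w) r c))) z = 0} = 5)"
    by (rule rat_discriminant[OF D(1)]) (rule rS)
  then obtain h where h: "rat FC D h"
    "\<forall>w. h w \<noteq> 0 \<longleftrightarrow> card {z. poly (char_poly (Matrix.mat 5 5 (\<lambda>(r, c). mult_sum (\<alpha> w) (\<gamma> w) r c))) z = 0} = 5"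
    by (elim exE conjE)
  obtain n p where p: "polyfun FC p" "\<And>w. D w \<noteq> 0 \<Longrightarrow> D w ^ n * h w = p w"
    using h(1) unfolding rat_def by metis
  have "h w\<^sub>0 \<noteq> 0" using h(2) base_distinct_roots[OF data[OF D(2)]] by blast
  then have p0: "p w\<^sub>0 \<noteq> 0" using p(2)[OF D(2)] D(2) by force
  define G where "G w = D w * p w" for w
  have "polyfun FC G" "G w\<^sub>0 \<noteq> 0"
    using D p(1) p0 unfolding G_def by (auto intro: polyfun_mult)
  moreover have "\<exists>\<omega>. isotropic \<omega> \<and> products_independent \<omega> \<and> spanned w \<omega> \<and>
      (\<forall>\<omega>'. isotropic \<omega>' \<and> spanned w \<omega>' \<longrightarrow> (\<exists>T T'. (\<forall>i<5. \<omega>' i = comb (T i) \<omega>) \<and> (\<forall>i<5. \<omega> i = comb (T' i) \<omega>')))"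
    if "G w \<noteq> 0" for w
  proof -
    have Dw: "D w \<noteq> 0" and "p w \<noteq> 0" using that by (auto simp: G_def)
    then have "h w \<noteq> 0" using p(2)[of w] by auto
    then have card: "card {z. poly (char_poly (Matrix.mat 5 5 (\<lambda>(r, c). mult_sum (\<alpha> w) (\<gamma> w) r c))) z = 0} = 5"
      using h(2) by blast
    let ?v = "stab_frame w (\<eta> w)"
    have "\<exists>\<omega> u. isotropic \<omega> \<and> (\<forall>j<4. w j = comb (u j) \<omega>)"
      by (rule decomposition_exists[OF data[OF Dw] comm[OF Dw] card])
    then obtain \<omega> u where iso: "isotropic \<omega>" and u: "\<forall>j<4. w j = comb (u j) \<omega>" by (elim exE conjE)
    have PI: "products_independent \<omega>"
      by (rule products_from_squares(1)[OF iso, of w u]) (use u good Dw in auto)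
    have both: "\<exists>T x. (\<forall>i<5. ?v i = comb (T i) \<omega>') \<and> (\<forall>i<5. \<omega>' i = comb (x i) ?v)"
      if io: "isotropic \<omega>'" and so: "spanned w \<omega>'" for \<omega>'
    proof -
      obtain u' where u': "\<forall>j<4. w j = comb (u' j) \<omega>'" using so unfolding spanned_def by (rule exE)
      have "\<exists>T x. (\<forall>i<5. ?v i = comb (T i) \<omega>') \<and> (\<forall>i<5. \<omega>' i = comb (x i) ?v) \<and>
        (\<forall>i<5. \<forall>c<5. (\<Sum>l<5. T i l * x l c) = (if i = c then 1 else 0))"
        by (rule secant_frame[OF data[OF Dw] io, of u']) (use u' in blast)
      then show ?thesis by (elim exE conjE) (intro exI conjI)
    qed
    have sp: "spanned w \<omega>" unfolding spanned_def by (rule exI[of _ u], rule u)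
    obtain T x where T: "\<forall>i<5. ?v i = comb (T i) \<omega>" and x: "\<forall>i<5. \<omega> i = comb (x i) ?v"
      using both[OF iso sp] by (elim exE conjE)
    have chain: "a = comb (\<lambda>l. \<Sum>i<5. z i * S i l) v'"
      if "a = comb z v" "\<forall>i<5. v i = comb (S i) v'" for a z v S v'
    proof -
      have "comb z v = comb z (\<lambda>i. comb (S i) v')" by (rule comb_cong) (simp_all add: that(2))
      then show ?thesis using that(1) comb_comb[of z S v'] by simp
    qed
    have "\<exists>T T'. (\<forall>i<5. \<omega>' i = comb (T i) \<omega>) \<and> (\<forall>i<5. \<omega> i = comb (T' i) \<omega>')"
      if iso': "isotropic \<omega>'" "spanned w \<omega>'" for \<omega>'
    proof -
      obtain T' x' where T': "\<forall>i<5. ?v i = comb (T' i) \<omega>'" and x': "\<forall>i<5. \<omega>' i = comb (x' i) ?v"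
        using both[OF iso'] by (elim exE conjE)
      have "\<forall>i<5. \<omega>' i = comb (\<lambda>l. \<Sum>k<5. x' i k * T k l) \<omega>" using chain[OF _ T] x' by blast
      moreover have "\<forall>i<5. \<omega> i = comb (\<lambda>l. \<Sum>k<5. x i k * T' k l) \<omega>'" using chain[OF _ T'] x by blast
      ultimately show ?thesis by (intro exI conjI)
    qed
    then show ?thesis by (intro exI[of _ \<omega>] conjI iso PI sp allI impI) (elim conjE)
  qed
  ultimately show ?thesis by (intro exI[of _ G] conjI allI impI)
qed

end

section \<open>The exterior square of a six-dimensional space\<close>

text \<open>Coefficient of the product of the basis vectors \<open>a\<close>, \<open>b\<close>,
  \<open>c\<close>, \<open>d\<close> in the exterior product of the bivectors with coordinates
  \<open>y\<close> and \<open>z\<close>. For \<open>y = z\<close> it is twice a Pfaffian of order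
  four, so its vanishing is a Pluecker relation.\<close>

definition pfaffian :: "(nat \<Rightarrow> nat \<Rightarrow> complex) \<Rightarrow> (nat \<Rightarrow> nat \<Rightarrow> complex) \<Rightarrow> nat \<times> nat \<times> nat \<times> nat \<Rightarrow> complex" where
  "pfaffian y z = (\<lambda>(a, b, c, d).
     y a b * z c d - y a c * z b d + y a d * z b c + z a b * y c d - z a c * y b d + z a d * y b c)"

definition quads :: "(nat \<times> nat \<times> nat \<times> nat) set" where
  "quads = {(a, b, c, d). a < b \<and> b < c \<and> c < d \<and> d < 6}"

definition base_wedge :: "nat \<Rightarrow> nat \<Rightarrow> nat \<Rightarrow> complex" where
  "base_wedge i a b = base_a i a * base_b i b - base_a i b * base_b i a"

text \<open>The Pfaffians over \<open>quads\<close> involve increasing index pairs only, so these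
  are the values that occur in them.\<close>

lemma base_wedge_values:
    "base_wedge 0 0 1 = 1"
    "base_wedge 0 0 2 = 0"
    "base_wedge 0 0 3 = 0"
    "base_wedge 0 0 4 = 0"
    "base_wedge 0 0 5 = 0"
    "base_wedge 0 1 2 = 0"
    "base_wedge 0 1 3 = 0"
    "base_wedge 0 1 4 = 0"
    "base_wedge 0 1 5 = 0"
    "base_wedge 0 2 3 = 0"
    "base_wedge 0 2 4 = 0"
    "base_wedge 0 2 5 = 0"
    "base_wedge 0 3 4 = 0"
    "base_wedge 0 3 5 = 0"
    "base_wedge 0 4 5 = 0"
    "base_wedge 1 0 1 = 0"
    "base_wedge 1 0 2 = 0"
    "base_wedge 1 0 3 = 0"
    "base_wedge 1 0 4 = 0"
    "base_wedge 1 0 5 = 0"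
    "base_wedge 1 1 2 = 0"
    "base_wedge 1 1 3 = 0"
    "base_wedge 1 1 4 = 0"
    "base_wedge 1 1 5 = 0"
    "base_wedge 1 2 3 = 1"
    "base_wedge 1 2 4 = 0"
    "base_wedge 1 2 5 = 0"
    "base_wedge 1 3 4 = 0"
    "base_wedge 1 3 5 = 0"
    "base_wedge 1 4 5 = 0"
    "base_wedge 2 0 1 = 0"
    "base_wedge 2 0 2 = 0"
    "base_wedge 2 0 3 = 0"
    "base_wedge 2 0 4 = 0"
    "base_wedge 2 0 5 = 0"
    "base_wedge 2 1 2 = 0"
    "base_wedge 2 1 3 = 0"
    "base_wedge 2 1 4 = 0"
    "base_wedge 2 1 5 = 0"
    "base_wedge 2 2 3 = 0"
    "base_wedge 2 2 4 = 0"
    "base_wedge 2 2 5 = 0"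
    "base_wedge 2 3 4 = 0"
    "base_wedge 2 3 5 = 0"
    "base_wedge 2 4 5 = 1"
    "base_wedge 3 0 1 = 1"
    "base_wedge 3 0 2 = 0"
    "base_wedge 3 0 3 = 1"
    "base_wedge 3 0 4 = 0"
    "base_wedge 3 0 5 = 1"
    "base_wedge 3 1 2 = -1"
    "base_wedge 3 1 3 = 0"
    "base_wedge 3 1 4 = -1"
    "base_wedge 3 1 5 = 0"
    "base_wedge 3 2 3 = 1"
    "base_wedge 3 2 4 = 0"
    "base_wedge 3 2 5 = 1"
    "base_wedge 3 3 4 = -1"
    "base_wedge 3 3 5 = 0"
    "base_wedge 3 4 5 = 1"
    "base_wedge 4 0 1 = 1"
    "base_wedge 4 0 2 = 0"
    "base_wedge 4 0 3 = -1"
    "base_wedge 4 0 4 = 1"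
    "base_wedge 4 0 5 = 0"
    "base_wedge 4 1 2 = -1"
    "base_wedge 4 1 3 = 0"
    "base_wedge 4 1 4 = 0"
    "base_wedge 4 1 5 = -1"
    "base_wedge 4 2 3 = -1"
    "base_wedge 4 2 4 = 1"
    "base_wedge 4 2 5 = 0"
    "base_wedge 4 3 4 = 0"
    "base_wedge 4 3 5 = 1"
    "base_wedge 4 4 5 = -1"
  by (simp_all add: base_wedge_def base_a_def base_b_def)

text \<open>Coordinates of the fourth exterior power are taken in an order that makes the system
  triangular, except that \<open>c (2, 3)\<close> and \<open>c (2, 4)\<close> come from an equality
  and a vanishing sum.\<close>

lemma base_products_independent:
  assumes "\<And>\<kappa>. \<kappa> \<in> quads \<Longrightarrow> (\<Sum>p\<in>pairs 5. c p * pfaffian (base_wedge (fst p)) (base_wedge (snd p)) \<kappa>) = 0"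
    and "p \<in> pairs 5"
  shows "c p = 0"
proof -
  note defs = sum_pairs_5 pfaffian_def base_wedge_values
  have q: "(a, b, c, d) \<in> quads" if "a < b" "b < c" "c < d" "d < 6" for a b c d
    using that by (simp add: quads_def)
  have c04: "c (0, 4) = 0" using assms(1)[OF q[of 0 1 2 4]]  by (simp add: defs del: One_nat_def)
  have c03: "c (0, 3) = 0" using assms(1)[OF q[of 0 1 2 5]]  by (simp add: defs del: One_nat_def)
  have c13: "c (1, 3) = 0" using assms(1)[OF q[of 0 2 3 5]]  by (simp add: defs del: One_nat_def)
  have c14: "c (1, 4) = 0" using assms(1)[OF q[of 0 2 3 4]]  by (simp add: defs del: One_nat_def)
  have c34: "c (3, 4) = 0" using assms(1)[OF q[of 0 1 3 4]] c03 by (simp add: defs del: One_nat_def)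
  have d1: "c (2, 3) = c (2, 4)" using assms(1)[OF q[of 0 3 4 5]] c34 by (simp add: defs del: One_nat_def)
  have d2: "c (2, 3) + c (2, 4) = 0" using assms(1)[OF q[of 1 2 4 5]] by (simp add: defs add_eq_0_iff del: One_nat_def)
  have c23: "c (2, 3) = 0" using d1 d2 by simp
  have c24: "c (2, 4) = 0" using d1 c23 by simp
  have c01: "c (0, 1) = 0" using assms(1)[OF q[of 0 1 2 3]] c03 c04 c13 c14 by (simp add: defs del: One_nat_def)
  have c02: "c (0, 2) = 0" using assms(1)[OF q[of 0 1 4 5]] c03 c04 c23 c24 by (simp add: defs del: One_nat_def)
  have c12: "c (1, 2) = 0" using assms(1)[OF q[of 2 3 4 5]] c13 c14 c23 c24 c34 by (simp add: defs del: One_nat_def)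
  have "p \<in> {(0, 1), (0, 2), (0, 3), (0, 4), (1, 2), (1, 3), (1, 4), (2, 3), (2, 4), (3, 4)}"
    using assms(2) by (simp add: pairs_5)
  then show ?thesis using c01 c02 c03 c04 c12 c13 c14 c23 c24 c34 by auto
qed

text \<open>The ten products span a subspace of codimension five in the fourth exterior power, of
  dimension fifteen. The five forms that cut it out, applied to the product of \<open>y\<close> with
  each of the four frame vectors, give twenty equations for the fifteen coordinates of
  \<open>y\<close>, and these leave exactly five coordinates free.\<close>

lemma base_stable:
  assumes skew: "\<And>a b. a < 6 \<Longrightarrow> b < 6 \<Longrightarrow> y a b = - y b a"
    and stab: "\<And>j. j < 4 \<Longrightarrow> \<exists>c. \<forall>\<kappa>\<in>quads. pfaffian y (\<lambda>a b. base_wedge j a b + base_wedge 4 a b) \<kappa> =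
        (\<Sum>p\<in>pairs 5. c p * pfaffian (base_wedge (fst p)) (base_wedge (snd p)) \<kappa>)"
  shows "\<exists>t. \<forall>a<6. \<forall>b<6. y a b = (\<Sum>i<5. t i * base_wedge i a b)"
proof -
  define w where "w j a b = base_wedge j a b + base_wedge 4 a b" for j a b
  have q: "a < b \<Longrightarrow> b < c \<Longrightarrow> c < d \<Longrightarrow> d < 6 \<Longrightarrow> (a, b, c, d) \<in> quads" for a b c d
    by (simp add: quads_def)
  have stab': "\<exists>c. \<forall>\<kappa>\<in>quads. pfaffian y (w j) \<kappa> =
        (\<Sum>p\<in>pairs 5. c p * pfaffian (base_wedge (fst p)) (base_wedge (snd p)) \<kappa>)" if "j < 4" for j
    using stab[OF that] unfolding w_def by blast
  note prods = sum_pairs_5 pfaffian_def base_wedge_values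
  note bp = pfaffian_def[of "base_wedge i" "base_wedge l" for i l]
  \<comment> \<open>Five linear forms that annihilate all products of the base bivectors.\<close>
  have ann0: "- pfaffian y (w j) (0, 1, 2, 4) + pfaffian y (w j) (0, 1, 2, 5) + pfaffian y (w j) (0, 1, 3, 4) + pfaffian y (w j) (0, 1, 3, 5) = 0" if j: "j < 4" for j
  proof -
    obtain c where c: "\<forall>\<kappa>\<in>quads. pfaffian y (w j) \<kappa> =
        (\<Sum>p\<in>pairs 5. c p * pfaffian (base_wedge (fst p)) (base_wedge (snd p)) \<kappa>)"
      using stab'[OF j] by blast
    have c': "pfaffian y (w j) (a, b, c', d) =
        (\<Sum>p\<in>pairs 5. c p * pfaffian (base_wedge (fst p)) (base_wedge (snd p)) (a, b, c', d))"
      if "a < b" "b < c'" "c' < d" "d < 6" for a b c' d using c q[OF that] by blast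
    show ?thesis
      by (simp add: c' sum_pairs_5 bp base_wedge_values del: One_nat_def)
  qed
  have ann1: "pfaffian y (w j) (0, 2, 4, 5) = 0" if j: "j < 4" for j
  proof -
    obtain c where c: "\<forall>\<kappa>\<in>quads. pfaffian y (w j) \<kappa> =
        (\<Sum>p\<in>pairs 5. c p * pfaffian (base_wedge (fst p)) (base_wedge (snd p)) \<kappa>)"
      using stab'[OF j] by blast
    have c': "pfaffian y (w j) (a, b, c', d) =
        (\<Sum>p\<in>pairs 5. c p * pfaffian (base_wedge (fst p)) (base_wedge (snd p)) (a, b, c', d))"
      if "a < b" "b < c'" "c' < d" "d < 6" for a b c' d using c q[OF that] by blast
    show ?thesis
      by (simp add: c' sum_pairs_5 bp base_wedge_values del: One_nat_def)
  qed
  have ann2: "pfaffian y (w j) (0, 1, 2, 5) + pfaffian y (w j) (0, 1, 3, 4) + pfaffian y (w j) (0, 2, 3, 5) + pfaffian y (w j) (1, 2, 3, 4) = 0" if j: "j < 4" for j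
  proof -
    obtain c where c: "\<forall>\<kappa>\<in>quads. pfaffian y (w j) \<kappa> =
        (\<Sum>p\<in>pairs 5. c p * pfaffian (base_wedge (fst p)) (base_wedge (snd p)) \<kappa>)"
      using stab'[OF j] by blast
    have c': "pfaffian y (w j) (a, b, c', d) =
        (\<Sum>p\<in>pairs 5. c p * pfaffian (base_wedge (fst p)) (base_wedge (snd p)) (a, b, c', d))"
      if "a < b" "b < c'" "c' < d" "d < 6" for a b c' d using c q[OF that] by blast
    show ?thesis
      by (simp add: c' sum_pairs_5 bp base_wedge_values del: One_nat_def)
  qed
  have ann3: "- pfaffian y (w j) (0, 1, 2, 5) - pfaffian y (w j) (0, 1, 3, 4) + pfaffian y (w j) (0, 2, 3, 4) + pfaffian y (w j) (1, 2, 3, 5) = 0" if j: "j < 4" for j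
  proof -
    obtain c where c: "\<forall>\<kappa>\<in>quads. pfaffian y (w j) \<kappa> =
        (\<Sum>p\<in>pairs 5. c p * pfaffian (base_wedge (fst p)) (base_wedge (snd p)) \<kappa>)"
      using stab'[OF j] by blast
    have c': "pfaffian y (w j) (a, b, c', d) =
        (\<Sum>p\<in>pairs 5. c p * pfaffian (base_wedge (fst p)) (base_wedge (snd p)) (a, b, c', d))"
      if "a < b" "b < c'" "c' < d" "d < 6" for a b c' d using c q[OF that] by blast
    show ?thesis
      by (simp add: c' sum_pairs_5 bp base_wedge_values del: One_nat_def)
  qed
  have ann4: "pfaffian y (w j) (0, 1, 2, 5) + pfaffian y (w j) (0, 1, 3, 4) + pfaffian y (w j) (1, 3, 4, 5) = 0" if j: "j < 4" for j
  proof -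
    obtain c where c: "\<forall>\<kappa>\<in>quads. pfaffian y (w j) \<kappa> =
        (\<Sum>p\<in>pairs 5. c p * pfaffian (base_wedge (fst p)) (base_wedge (snd p)) \<kappa>)"
      using stab'[OF j] by blast
    have c': "pfaffian y (w j) (a, b, c', d) =
        (\<Sum>p\<in>pairs 5. c p * pfaffian (base_wedge (fst p)) (base_wedge (snd p)) (a, b, c', d))"
      if "a < b" "b < c'" "c' < d" "d < 6" for a b c' d using c q[OF that] by blast
    show ?thesis
      by (simp add: c' sum_pairs_5 bp base_wedge_values del: One_nat_def)
  qed
  have sk: "y a b = - y b a" if "a < 6" "b < a" for a b using skew[of a b] that by simp
  note defs = pfaffian_def w_def base_wedge_values sk
  note ri = plus_complex.sel minus_complex.sel uminus_complex.sel times_complex.sel zero_complex.sel complex_Re_numeral complex_Im_numeral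
  \<comment> \<open>In a label \<open>e\<close> with two digits, the first is the annihilating form
    and the second the frame vector.\<close>
  have e00: "y 0 2 + y 0 3 + y 0 4 - y 0 5 - y 1 2 + y 1 3 + y 1 4 + y 1 5 - 2 * y 2 4 + 2 * y 2 5 + 2 * y 3 4 + 2 * y 3 5 = 0" using ann0[of 0] by (simp add: defs algebra_simps del: One_nat_def)
  have e01: "y 0 2 + y 0 3 + y 0 4 - y 0 5 - y 1 2 + y 1 3 + y 1 4 + y 1 5 - y 2 4 + y 2 5 + y 3 4 + y 3 5 = 0" using ann0[of 1] by (simp add: defs algebra_simps del: One_nat_def)
  have e02: "y 0 2 + y 0 3 + y 0 4 - y 0 5 - y 1 2 + y 1 3 + y 1 4 + y 1 5 - y 2 4 + y 2 5 + y 3 4 + y 3 5 = 0" using ann0[of 2] by (simp add: defs algebra_simps del: One_nat_def)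
  have e03: "2 * y 0 3 + 2 * y 0 4 - 2 * y 0 5 + 2 * y 1 3 - 2 * y 2 4 + 2 * y 2 5 + 2 * y 3 4 + 2 * y 3 5 = 0" using ann0[of 3] by (simp add: defs algebra_simps del: One_nat_def)
  have e10: "- y 0 2 + y 0 5 - y 2 5 = 0" using ann1[of 0] by (simp add: defs algebra_simps del: One_nat_def)
  have e11: "- y 0 2 + y 0 5 - y 2 5 = 0" using ann1[of 1] by (simp add: defs algebra_simps del: One_nat_def)
  have e12: "y 0 5 - y 2 5 = 0" using ann1[of 2] by (simp add: defs algebra_simps del: One_nat_def)
  have e13: "- y 0 4 + y 0 5 + y 2 4 - y 2 5 = 0" using ann1[of 3] by (simp add: defs algebra_simps del: One_nat_def)
  have e20: "2 * y 0 2 - 2 * y 0 5 + 3 * y 2 5 + y 3 4 = 0" using ann2[of 0] by (simp add: defs algebra_simps del: One_nat_def)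
  have e21: "2 * y 0 2 - y 0 5 + y 1 4 + 2 * y 2 5 = 0" using ann2[of 1] by (simp add: defs algebra_simps del: One_nat_def)
  have e22: "2 * y 0 2 - 2 * y 0 5 + 2 * y 2 5 = 0" using ann2[of 2] by (simp add: defs algebra_simps del: One_nat_def)
  have e23: "2 * y 0 2 - 2 * y 0 5 + 2 * y 2 5 = 0" using ann2[of 3] by (simp add: defs algebra_simps del: One_nat_def)
  have e30: "- y 0 2 - y 0 3 - y 0 4 + y 0 5 + y 1 2 - y 1 3 - y 1 4 - y 1 5 + y 2 4 - 2 * y 2 5 - 2 * y 3 4 - y 3 5 = 0" using ann3[of 0] by (simp add: defs algebra_simps del: One_nat_def)
  have e31: "- y 0 2 - y 0 3 + y 0 5 + y 1 2 - y 1 3 - y 1 4 + y 2 4 - y 2 5 - y 3 4 - y 3 5 = 0" using ann3[of 1] by (simp add: defs algebra_simps del: One_nat_def)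
  have e32: "- y 0 2 - y 0 3 - y 0 4 + y 0 5 + y 1 2 - y 1 3 - y 1 4 - y 1 5 + y 2 4 - y 2 5 - y 3 4 - y 3 5 = 0" using ann3[of 2] by (simp add: defs algebra_simps del: One_nat_def)
  have e33: "- 2 * y 0 2 - 2 * y 0 3 + 2 * y 0 5 - 2 * y 1 3 - 2 * y 2 5 - 2 * y 3 4 - 2 * y 3 5 = 0" using ann3[of 3] by (simp add: defs algebra_simps del: One_nat_def)
  have e40: "y 0 2 - y 0 5 + 2 * y 2 5 + y 3 4 = 0" using ann4[of 0] by (simp add: defs algebra_simps del: One_nat_def)
  have e41: "y 0 2 - y 0 5 + y 2 5 = 0" using ann4[of 1] by (simp add: defs algebra_simps del: One_nat_def)
  have e42: "y 0 2 - y 0 5 + y 1 3 + y 2 5 = 0" using ann4[of 2] by (simp add: defs algebra_simps del: One_nat_def)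
  have e43: "y 0 2 + y 0 3 - 2 * y 0 5 + y 1 2 + y 1 3 - y 1 4 - y 1 5 + 2 * y 2 5 + y 3 4 + y 3 5 = 0" using ann4[of 3] by (simp add: defs algebra_simps del: One_nat_def)
  \<comment> \<open>Linear arithmetic needs an ordered field, so each coordinate is solved for on
    real and imaginary parts.\<close>
  have S25: "y 2 5 = y 0 5" by (rule complex_eqI; (unfold ri)?; use arg_cong[OF e12, of Re, unfolded ri] arg_cong[OF e12, of Im, unfolded ri] in linarith)
  have S02: "y 0 2 = 0" by (rule complex_eqI; (unfold ri)?; use arg_cong[OF e10, of Re, unfolded ri] arg_cong[OF e10, of Im, unfolded ri] arg_cong[OF S25, of Re, unfolded ri] arg_cong[OF S25, of Im, unfolded ri] in linarith)
  have S13: "y 1 3 = 0" by (rule complex_eqI; (unfold ri)?; use arg_cong[OF e42, of Re, unfolded ri] arg_cong[OF e42, of Im, unfolded ri] arg_cong[OF S02, of Re, unfolded ri] arg_cong[OF S02, of Im, unfolded ri] arg_cong[OF S25, of Re, unfolded ri] arg_cong[OF S25, of Im, unfolded ri] in linarith)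
  have S24: "y 2 4 = y 0 4" by (rule complex_eqI; (unfold ri)?; use arg_cong[OF e13, of Re, unfolded ri] arg_cong[OF e13, of Im, unfolded ri] arg_cong[OF S25, of Re, unfolded ri] arg_cong[OF S25, of Im, unfolded ri] in linarith)
  have S34: "y 3 4 = - y 0 5" by (rule complex_eqI; (unfold ri)?; use arg_cong[OF e20, of Re, unfolded ri] arg_cong[OF e20, of Im, unfolded ri] arg_cong[OF S02, of Re, unfolded ri] arg_cong[OF S02, of Im, unfolded ri] arg_cong[OF S25, of Re, unfolded ri] arg_cong[OF S25, of Im, unfolded ri] in linarith)
  have S14: "y 1 4 = - y 0 5" by (rule complex_eqI; (unfold ri)?; use arg_cong[OF e21, of Re, unfolded ri] arg_cong[OF e21, of Im, unfolded ri] arg_cong[OF S02, of Re, unfolded ri] arg_cong[OF S02, of Im, unfolded ri] arg_cong[OF S25, of Re, unfolded ri] arg_cong[OF S25, of Im, unfolded ri] in linarith)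
  have S35: "y 3 5 = - y 0 3 + y 0 5" by (rule complex_eqI; (unfold ri)?; use arg_cong[OF e03, of Re, unfolded ri] arg_cong[OF e03, of Im, unfolded ri] arg_cong[OF S13, of Re, unfolded ri] arg_cong[OF S13, of Im, unfolded ri] arg_cong[OF S24, of Re, unfolded ri] arg_cong[OF S24, of Im, unfolded ri] arg_cong[OF S25, of Re, unfolded ri] arg_cong[OF S25, of Im, unfolded ri] arg_cong[OF S34, of Re, unfolded ri] arg_cong[OF S34, of Im, unfolded ri] in linarith)
  have S15: "y 1 5 = y 0 5 + y 1 2" by (rule complex_eqI; (unfold ri)?; use arg_cong[OF e01, of Re, unfolded ri] arg_cong[OF e01, of Im, unfolded ri] arg_cong[OF S02, of Re, unfolded ri] arg_cong[OF S02, of Im, unfolded ri] arg_cong[OF S13, of Re, unfolded ri] arg_cong[OF S13, of Im, unfolded ri] arg_cong[OF S14, of Re, unfolded ri] arg_cong[OF S14, of Im, unfolded ri] arg_cong[OF S24, of Re, unfolded ri] arg_cong[OF S24, of Im, unfolded ri] arg_cong[OF S25, of Re, unfolded ri] arg_cong[OF S25, of Im, unfolded ri] arg_cong[OF S34, of Re, unfolded ri] arg_cong[OF S34, of Im, unfolded ri] arg_cong[OF S35, of Re, unfolded ri] arg_cong[OF S35, of Im, unfolded ri] in linarith)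
  have S03: "y 0 3 = - y 0 4 + y 0 5" by (rule complex_eqI; (unfold ri)?; use arg_cong[OF e00, of Re, unfolded ri] arg_cong[OF e00, of Im, unfolded ri] arg_cong[OF S02, of Re, unfolded ri] arg_cong[OF S02, of Im, unfolded ri] arg_cong[OF S13, of Re, unfolded ri] arg_cong[OF S13, of Im, unfolded ri] arg_cong[OF S14, of Re, unfolded ri] arg_cong[OF S14, of Im, unfolded ri] arg_cong[OF S15, of Re, unfolded ri] arg_cong[OF S15, of Im, unfolded ri] arg_cong[OF S24, of Re, unfolded ri] arg_cong[OF S24, of Im, unfolded ri] arg_cong[OF S25, of Re, unfolded ri] arg_cong[OF S25, of Im, unfolded ri] arg_cong[OF S34, of Re, unfolded ri] arg_cong[OF S34, of Im, unfolded ri] arg_cong[OF S35, of Re, unfolded ri] arg_cong[OF S35, of Im, unfolded ri] in linarith)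
  have S12: "y 1 2 = - y 0 4 - y 0 5" by (rule complex_eqI; (unfold ri)?; use arg_cong[OF e31, of Re, unfolded ri] arg_cong[OF e31, of Im, unfolded ri] arg_cong[OF S02, of Re, unfolded ri] arg_cong[OF S02, of Im, unfolded ri] arg_cong[OF S03, of Re, unfolded ri] arg_cong[OF S03, of Im, unfolded ri] arg_cong[OF S13, of Re, unfolded ri] arg_cong[OF S13, of Im, unfolded ri] arg_cong[OF S14, of Re, unfolded ri] arg_cong[OF S14, of Im, unfolded ri] arg_cong[OF S24, of Re, unfolded ri] arg_cong[OF S24, of Im, unfolded ri] arg_cong[OF S25, of Re, unfolded ri] arg_cong[OF S25, of Im, unfolded ri] arg_cong[OF S34, of Re, unfolded ri] arg_cong[OF S34, of Im, unfolded ri] arg_cong[OF S35, of Re, unfolded ri] arg_cong[OF S35, of Im, unfolded ri] in linarith)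
  note S = S25 S02 S13 S24 S34 S14 S35 S15 S03 S12
  have diag: "y a a = 0" if "a < 6" for a using skew[OF that that] by simp
  \<comment> \<open>Coordinate \<open>(0, 5)\<close> occurs only in bivector 3 and
    \<open>(0, 4)\<close> only in bivector 4; the coordinates \<open>(0, 1)\<close>,
    \<open>(2, 3)\<close> and \<open>(4, 5)\<close> then determine the other three
    coefficients.\<close>
  define t where "t i = [y 0 1 - y 0 5 - y 0 4, y 2 3 - y 0 5 + y 0 4, y 4 5 - y 0 5 + y 0 4, y 0 5, y 0 4] ! i" for i
  have up: "y a b = (\<Sum>i<5. t i * base_wedge i a b)" if "a < b" "b < 6" for a b
  proof -
    have "b = 0 \<or> b = 1 \<or> b = 2 \<or> b = 3 \<or> b = 4 \<or> b = 5" "a = 0 \<or> a = 1 \<or> a = 2 \<or> a = 3 \<or> a = 4"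
      using that by auto
    then show ?thesis using that(1)
      by (elim disjE; hypsubst; simp add: S sum_lessThan_5 t_def base_wedge_values del: One_nat_def)
  qed
  have "y a b = (\<Sum>i<5. t i * base_wedge i a b)" if "a < 6" "b < 6" for a b
  proof (cases a b rule: linorder_cases)
    case greater
    have "base_wedge i a b = - base_wedge i b a" for i by (simp add: base_wedge_def)
    then have "(\<Sum>i<5. t i * base_wedge i a b) = - (\<Sum>i<5. t i * base_wedge i b a)"
      by (simp add: sum_negf)
    then show ?thesis using up[OF greater] sk[OF _ greater] that by simp
  qed (use that up diag in \<open>simp_all add: base_wedge_def\<close>)
  then show ?thesis by blast
qed

lemma finite_pairs_n: "finite (pairs n)"
  by (rule finite_subset[of _ "{..<n} \<times> {..<n}"]) (auto simp: pairs_def)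

lemma sum_pairs_Suc:
  "(\<Sum>p\<in>pairs (Suc n). g p) = (\<Sum>p\<in>pairs n. g p) + (\<Sum>i<n. g (i, n) :: 'z::comm_monoid_add)"
proof -
  have "pairs (Suc n) = pairs n \<union> (\<lambda>i. (i, n)) ` {..<n}"
    by (auto simp: pairs_def less_Suc_eq)
  moreover have "pairs n \<inter> (\<lambda>i. (i, n)) ` {..<n} = {}" by (auto simp: pairs_def)
  ultimately have "(\<Sum>p\<in>pairs (Suc n). g p) = (\<Sum>p\<in>pairs n. g p) + (\<Sum>p\<in>(\<lambda>i. (i, n)) ` {..<n}. g p)"
    by (simp add: sum.union_disjoint finite_pairs_n)
  then show ?thesis by (simp add: sum.reindex inj_on_def)
qed

lemma sum_square_split:
  fixes f :: "nat \<Rightarrow> nat \<Rightarrow> 'z::comm_monoid_add"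
  shows "(\<Sum>a<n. \<Sum>b<n. f a b) = (\<Sum>p\<in>pairs n. f (fst p) (snd p) + f (snd p) (fst p)) + (\<Sum>a<n. f a a)"
proof (induction n)
  case 0
  show ?case by (simp add: pairs_def)
next
  case (Suc n)
  show ?case by (simp add: sum_pairs_Suc sum.distrib Suc.IH[unfolded sum.distrib] add_ac)
qed

lemma (in vector_space) span_eq_if_independent_card:
  assumes "finite T" "independent S" "S \<subseteq> span T" "card S = card T"
  shows "span S = span T"
proof
  show "span S \<subseteq> span T" using assms(3) by (rule span_minimal) (rule subspace_span)
  show "span T \<subseteq> span S"
  proof (rule ccontr)
    assume "\<not> span T \<subseteq> span S"
    then obtain x where x: "x \<in> span T" "x \<notin> span S" by blast
    then have "independent (insert x S)" using assms(2) independent_insert by auto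
    moreover have "insert x S \<subseteq> span T" using x assms(3) by blast
    ultimately have "card (insert x S) \<le> card T" using independent_span_bound[OF assms(1)] by blast
    moreover have "finite S" using independent_span_bound[OF assms(1,2,3)] by blast
    moreover have "x \<notin> S" using x(2) span_base by blast
    ultimately show False using assms(4) by simp
  qed
qed

section \<open>Coordinates on the exterior square\<close>

locale exterior_coords =
  fixes sV :: "complex \<Rightarrow> 'v::ab_group_add \<Rightarrow> 'v" and sE :: "complex \<Rightarrow> 'e::ab_group_add \<Rightarrow> 'e"
    and wedge :: "'v \<Rightarrow> 'v \<Rightarrow> 'e" and e :: "nat \<Rightarrow> 'v" and \<xi> :: "nat \<Rightarrow> 'v \<Rightarrow> complex"
  assumes V: "vector_space sV" and E: "vector_space sE" and ext: "exterior_square sV sE wedge"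
    and \<xi>_linear: "\<And>a. Vector_Spaces.linear sV (*) (\<xi> a)"
    and \<xi>_e: "\<And>a b. a < 6 \<Longrightarrow> b < 6 \<Longrightarrow> \<xi> a (e b) = (if a = b then 1 else 0)"
    and \<xi>_rep: "\<And>v. v = (\<Sum>a<6. sV (\<xi> a v) (e a))"
begin

sublocale V: vector_space sV by (rule V)
sublocale E: vector_space sE by (rule E)

lemma wedge_linear2: "Vector_Spaces.linear sV sE (wedge v)"
  and wedge_linear1: "Vector_Spaces.linear sV sE (\<lambda>v. wedge v w)"
  and wedge_self: "wedge v v = 0"
  using ext by (auto simp: exterior_square_def alternating_bilinear_def)

lemma wedge_add1: "wedge (v + v') w = wedge v w + wedge v' w"
  and wedge_scale1: "wedge (sV c v) w = sE c (wedge v w)"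
  using wedge_linear1[of w] by (auto simp: Vector_Spaces.linear_iff)

lemma wedge_add2: "wedge v (w + w') = wedge v w + wedge v w'"
  and wedge_scale2: "wedge v (sV c w) = sE c (wedge v w)"
  using wedge_linear2[of v] by (auto simp: Vector_Spaces.linear_iff)

lemma wedge_skew: "wedge v w + wedge w v = 0"
  using wedge_self[of "v + w"] unfolding wedge_add1 wedge_add2 by (simp add: wedge_self add.commute)

lemma wedge_sum1: "wedge (\<Sum>a\<in>A. sV (c a) (f a)) w = (\<Sum>a\<in>A. sE (c a) (wedge (f a) w))"
proof -
  interpret Vector_Spaces.linear sV sE "\<lambda>v. wedge v w" by (rule wedge_linear1)
  show ?thesis by (simp add: sum scale)
qed

lemma wedge_sum2: "wedge v (\<Sum>a\<in>A. sV (c a) (f a)) = (\<Sum>a\<in>A. sE (c a) (wedge v (f a)))"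
proof -
  interpret Vector_Spaces.linear sV sE "wedge v" by (rule wedge_linear2)
  show ?thesis by (simp add: sum scale)
qed

lemma wedge_sums:
  "wedge (\<Sum>a\<in>A. sV (c a) (f a)) (\<Sum>b\<in>B. sV (d b) (g b)) = (\<Sum>a\<in>A. \<Sum>b\<in>B. sE (c a * d b) (wedge (f a) (g b)))"
  unfolding wedge_sum1 by (simp add: wedge_sum2 E.scale_sum_right)

text \<open>The linear form that the universal property attaches to the alternating form built from
  \<open>\<xi> a\<close> and \<open>\<xi> b\<close>. All index pairs are kept, so that
  \<open>X\<close> is skew in its indices.\<close>

definition X :: "nat \<Rightarrow> nat \<Rightarrow> 'e \<Rightarrow> complex" where
  "X a b = (SOME h. Vector_Spaces.linear sE (*) h \<and> (\<forall>v w. h (wedge v w) = \<xi> a v * \<xi> b w - \<xi> b v * \<xi> a w))"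

lemma X_linear: "Vector_Spaces.linear sE (*) (X a b)"
  and X_wedge: "X a b (wedge v w) = \<xi> a v * \<xi> b w - \<xi> b v * \<xi> a w"
proof -
  have "alternating_bilinear sV (*) (\<lambda>v w. \<xi> a v * \<xi> b w - \<xi> b v * \<xi> a w)"
    using \<xi>_linear[of a] \<xi>_linear[of b] unfolding alternating_bilinear_def Vector_Spaces.linear_iff
    by (auto simp: algebra_simps)
  then have "\<exists>h. Vector_Spaces.linear sE (*) h \<and> (\<forall>v w. h (wedge v w) = \<xi> a v * \<xi> b w - \<xi> b v * \<xi> a w)"
    using ext unfolding exterior_square_def by blast
  from someI_ex[OF this]
  show "Vector_Spaces.linear sE (*) (X a b)" "X a b (wedge v w) = \<xi> a v * \<xi> b w - \<xi> b v * \<xi> a w"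
    unfolding X_def by blast+
qed

lemma X_add: "X a b (y + z) = X a b y + X a b z"
  and X_scale: "X a b (sE c y) = c * X a b y"
  using X_linear[of a b] by (auto simp: Vector_Spaces.linear_iff)

lemma X_sum: "X a b (\<Sum>i\<in>I. sE (c i) (f i)) = (\<Sum>i\<in>I. c i * X a b (f i))"
proof -
  interpret Vector_Spaces.linear sE "(*)" "X a b" by (rule X_linear)
  show ?thesis by (simp add: sum scale)
qed

text \<open>The right-hand side is a linear endomorphism that fixes every \<open>wedge v w\<close>.
  By uniqueness in the universal property, with the exterior square itself as target, it is the
  identity.\<close>

lemma X_rep: "y = (\<Sum>p\<in>pairs 6. sE (X (fst p) (snd p) y) (wedge (e (fst p)) (e (snd p))))"
proof -
  define g where "g y = (\<Sum>p\<in>pairs 6. sE (X (fst p) (snd p) y) (wedge (e (fst p)) (e (snd p))))" for y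
  have "Vector_Spaces.linear sE sE g"
    unfolding Vector_Spaces.linear_iff g_def
    by (auto simp: E X_add X_scale E.scale_left_distrib sum.distrib E.scale_sum_right)
  moreover have "g (wedge v w) = wedge v w" for v w
  proof -
    have "wedge v w = (\<Sum>a<6. \<Sum>b<6. sE (\<xi> a v * \<xi> b w) (wedge (e a) (e b)))"
      using wedge_sums[of "\<lambda>a. \<xi> a v" e "{..<6}" "\<lambda>b. \<xi> b w" e "{..<6}"] \<xi>_rep[of v] \<xi>_rep[of w] by simp
    also have "\<dots> = (\<Sum>p\<in>pairs 6. sE (\<xi> (fst p) v * \<xi> (snd p) w) (wedge (e (fst p)) (e (snd p))) +
        sE (\<xi> (snd p) v * \<xi> (fst p) w) (wedge (e (snd p)) (e (fst p))))"
      by (subst sum_square_split) (simp add: wedge_self)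
    also have "\<dots> = g (wedge v w)"
      unfolding g_def
    proof (intro sum.cong refl)
      fix p
      have "wedge (e (snd p)) (e (fst p)) = - wedge (e (fst p)) (e (snd p))"
        using wedge_skew[of "e (fst p)" "e (snd p)"] by (simp add: eq_neg_iff_add_eq_0 add.commute)
      then show "sE (\<xi> (fst p) v * \<xi> (snd p) w) (wedge (e (fst p)) (e (snd p))) +
        sE (\<xi> (snd p) v * \<xi> (fst p) w) (wedge (e (snd p)) (e (fst p))) =
        sE (X (fst p) (snd p) (wedge v w)) (wedge (e (fst p)) (e (snd p)))"
        by (simp add: X_wedge E.scale_left_diff_distrib)
    qed
    finally show ?thesis by simp
  qed
  moreover have "Vector_Spaces.linear sE sE (\<lambda>y. y)" by (simp add: Vector_Spaces.linear_iff E)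
  moreover have "alternating_bilinear sV sE wedge" using ext by (simp add: exterior_square_def)
  ultimately have "g = (\<lambda>y. y)"
    using exterior_square_universal[OF ext, of sE wedge] by (metis (no_types, lifting))
  then show ?thesis unfolding g_def by metis
qed

lemma X_cong: "(\<And>a b. a < 6 \<Longrightarrow> b < 6 \<Longrightarrow> X a b y = X a b z) \<Longrightarrow> y = z"
proof -
  assume *: "\<And>a b. a < 6 \<Longrightarrow> b < 6 \<Longrightarrow> X a b y = X a b z"
  have "(\<Sum>p\<in>pairs 6. sE (X (fst p) (snd p) y) (wedge (e (fst p)) (e (snd p)))) =
    (\<Sum>p\<in>pairs 6. sE (X (fst p) (snd p) z) (wedge (e (fst p)) (e (snd p))))"
    by (intro sum.cong refl) (auto simp: pairs_def *)
  then show ?thesis using X_rep[of y] X_rep[of z] by simp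
qed

lemma X_skew: "X a b y = - X b a y"
proof -
  have "X a b y = (\<Sum>p\<in>pairs 6. X (fst p) (snd p) y * X a b (wedge (e (fst p)) (e (snd p))))"
    using arg_cong[OF X_rep[of y], of "X a b"] unfolding X_sum .
  moreover have "X b a y = (\<Sum>p\<in>pairs 6. X (fst p) (snd p) y * X b a (wedge (e (fst p)) (e (snd p))))"
    using arg_cong[OF X_rep[of y], of "X b a"] unfolding X_sum .
  moreover have "X a b (wedge v w) = - X b a (wedge v w)" for v w by (simp add: X_wedge)
  ultimately show ?thesis by (simp only: sum_negf[symmetric] mult_minus_right)
qed

definition P :: "'e \<Rightarrow> 'e \<Rightarrow> nat \<times> nat \<times> nat \<times> nat \<Rightarrow> complex" where
  "P y z \<kappa> = pfaffian (\<lambda>a b. X a b y) (\<lambda>a b. X a b z) \<kappa>"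

lemma P_wedge: "P (wedge v w) (wedge v w) \<kappa> = 0"
  by (cases \<kappa>) (simp add: P_def pfaffian_def X_wedge algebra_simps)

lemma P_linear: "Vector_Spaces.linear sE (*) (\<lambda>y. P y z \<kappa>)"
  unfolding Vector_Spaces.linear_iff
  by (cases \<kappa>) (auto simp: E P_def pfaffian_def X_add X_scale algebra_simps intro: vector_space.intro)

lemma P_sym: "P y z \<kappa> = P z y \<kappa>"
  by (cases \<kappa>) (simp add: P_def pfaffian_def)

text \<open>The quadratic equations are the Pluecker relations. If \<open>X a b y\<close> is
  nonzero, they express every coordinate of \<open>y\<close> through those in rows \<open>a\<close>
  and \<open>b\<close>, and these two rows are, up to a scalar, the factors of
  \<open>y\<close>.\<close>

lemma decomposable_if_isotropic:
  assumes iso: "\<forall>\<kappa>\<in>quads. P y y \<kappa> = 0" and y: "y \<noteq> 0"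
  shows "\<exists>v w. y = wedge v w"
proof -
  have diag: "X a a y = 0" for a using X_skew[of a a y] by simp
  \<comment> \<open>Half of \<open>P y y\<close>; skewness of \<open>X\<close> makes it change sign
    under adjacent transpositions.\<close>
  define q where "q a b c d = X a b y * X c d y - X a c y * X b d y + X a d y * X b c y" for a b c d
  have sw: "q a b c d = - q b a c d" "q a b c d = - q a c b d" "q a b c d = - q a b d c" for a b c d
    using X_skew[of b a y] X_skew[of c b y] X_skew[of d c y] by (simp_all add: q_def)
  have eq: "q a a c d = 0" for a c d by (simp add: q_def diag)
  have eq2: "q a b b d = 0" for a b d using sw(2)[of a b b d] by simp
  have eq3: "q a b c c = 0" for a b c using sw(3)[of a b c c] by simp
  \<comment> \<open>Only increasing indices belong to \<open>quads\<close>; the next facts sort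
    arbitrary ones by successive insertions.\<close>
  have sorted4: "q a b c d = 0" if "a \<le> b" "b \<le> c" "c \<le> d" "d < 6" for a b c d
  proof (cases "a = b \<or> b = c \<or> c = d")
    case True
    then show ?thesis using eq eq2 eq3 by auto
  next
    case False
    then have "P y y (a, b, c, d) = 0" using iso[THEN bspec[of _ _ "(a, b, c, d)"]] that
      by (simp add: quads_def)
    moreover have "P y y (a, b, c, d) = 2 * q a b c d" by (simp add: P_def pfaffian_def q_def)
    ultimately show ?thesis by simp
  qed
  have sorted3: "q a b c d = 0" if "b \<le> c" "c \<le> d" "a < 6" "d < 6" for a b c d
  proof -
    consider "a \<le> b" | "b \<le> a" "a \<le> c" | "c \<le> a" "a \<le> d" | "d \<le> a" by linarith
    then show ?thesis
    proof cases
      case 1 then show ?thesis using sorted4 that by simp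
    next
      case 2 then show ?thesis using sorted4[of b a c d] that sw(1)[of a b c d] by simp
    next
      case 3 then show ?thesis using sorted4[of b c a d] that sw(1)[of a b c d] sw(2)[of b a c d] by simp
    next
      case 4 then show ?thesis
        using sorted4[of b c d a] that sw(1)[of a b c d] sw(2)[of b a c d] sw(3)[of b c a d] by simp
    qed
  qed
  have sorted2: "q a b c d = 0" if "c \<le> d" "a < 6" "b < 6" "d < 6" for a b c d
  proof -
    consider "b \<le> c" | "c \<le> b" "b \<le> d" | "d \<le> b" by linarith
    then show ?thesis
    proof cases
      case 1 then show ?thesis using sorted3 that by simp
    next
      case 2 then show ?thesis using sorted3[of c b d a] that sw(2)[of a b c d] by simp
    next
      case 3 then show ?thesis
        using sorted3[of c d b a] that sw(2)[of a b c d] sw(3)[of a c b d] by simp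
    qed
  qed
  have pluecker: "q a b c d = 0" if "a < 6" "b < 6" "c < 6" "d < 6" for a b c d
    using sorted2[of c d a b] sorted2[of d c a b] sw(3)[of a b c d] that by (cases "c \<le> d") auto
  have "\<exists>a b. a < 6 \<and> b < 6 \<and> X a b y \<noteq> 0"
  proof (rule ccontr)
    assume "\<nexists>a b. a < 6 \<and> b < 6 \<and> X a b y \<noteq> 0"
    then have "\<And>p. p \<in> pairs 6 \<Longrightarrow> X (fst p) (snd p) y = 0" by (auto simp: pairs_def)
    then have "(\<Sum>p\<in>pairs 6. sE (X (fst p) (snd p) y) (wedge (e (fst p)) (e (snd p)))) = 0"
      by (intro sum.neutral) simp
    then show False using X_rep[of y] y by simp
  qed
  then obtain a b where ab: "a < 6" "b < 6" "X a b y \<noteq> 0" by blast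
  have all: "X a b y * X c d y = X a c y * X b d y - X a d y * X b c y" if "c < 6" "d < 6" for c d
    using pluecker[OF ab(1,2) that] by (simp add: q_def algebra_simps)
  \<comment> \<open>The contractions of \<open>y\<close> with the dual vectors \<open>a\<close> and
    \<open>b\<close>, the first divided by the pivot \<open>X a b y\<close>.\<close>
  let ?v = "\<Sum>c<6. sV (X a c y / X a b y) (e c)"
  let ?w = "\<Sum>d<6. sV (X b d y) (e d)"
  have xi: "\<xi> c (\<Sum>d<6. sV (f d) (e d)) = f c" if "c < 6" for c f
  proof -
    interpret f: Vector_Spaces.linear sV "(*)" "\<xi> c" by (rule \<xi>_linear)
    have "\<xi> c (\<Sum>d<6. sV (f d) (e d)) = (\<Sum>d<6. if d = c then f d else 0)"
      unfolding f.sum f.scale using that by (intro sum.cong) (auto simp: \<xi>_e)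
    then show ?thesis using that by simp
  qed
  have "y = wedge ?v ?w"
  proof (rule X_cong)
    fix c d :: nat assume cd: "c < 6" "d < 6"
    show "X c d y = X c d (wedge ?v ?w)"
      unfolding X_wedge xi[OF cd(1)] xi[OF cd(2)] using all[OF cd] ab(3) by (simp add: field_simps)
  qed
  then show ?thesis by blast
qed

definition base_bivector :: "nat \<Rightarrow> 'e" where
  "base_bivector i = wedge (\<Sum>a<6. sV (base_a i a) (e a)) (\<Sum>b<6. sV (base_b i b) (e b))"

lemma \<xi>_sum: "c < 6 \<Longrightarrow> \<xi> c (\<Sum>d<6. sV (f d) (e d)) = f c"
proof -
  assume c: "c < 6"
  interpret f: Vector_Spaces.linear sV "(*)" "\<xi> c" by (rule \<xi>_linear)
  have "\<xi> c (\<Sum>d<6. sV (f d) (e d)) = (\<Sum>d<6. if d = c then f d else 0)"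
    unfolding f.sum f.scale using c by (intro sum.cong) (auto simp: \<xi>_e)
  then show ?thesis using c by simp
qed

lemma X_base: "a < 6 \<Longrightarrow> b < 6 \<Longrightarrow> X a b (base_bivector i) = base_wedge i a b"
  by (simp add: base_bivector_def X_wedge \<xi>_sum base_wedge_def)

lemma P_base: "\<kappa> \<in> quads \<Longrightarrow> P (base_bivector i) (base_bivector l) \<kappa> = pfaffian (base_wedge i) (base_wedge l) \<kappa>"
  by (cases \<kappa>) (auto simp: P_def pfaffian_def quads_def X_base)

lemma P_base1: "\<kappa> \<in> quads \<Longrightarrow> P y (base_bivector j + base_bivector 4) \<kappa> =
    pfaffian (\<lambda>a b. X a b y) (\<lambda>a b. base_wedge j a b + base_wedge 4 a b) \<kappa>"
  by (cases \<kappa>) (auto simp: P_def pfaffian_def quads_def X_base X_add)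

lemma finite_quads: "finite quads"
  by (rule finite_subset[of _ "{..<6} \<times> {..<6} \<times> {..<6} \<times> {..<6}"]) (auto simp: quads_def)

sublocale secant_web sE P quads "\<lambda>p. X (fst p) (snd p)" "\<lambda>p. wedge (e (fst p)) (e (snd p))" "pairs 6" base_bivector
proof (rule secant_web.intro[OF E secant_web_axioms.intro])
  show "finite quads" by (rule finite_quads)
  show "finite (pairs 6)" by (rule finite_pairs_n)
  show "Vector_Spaces.linear sE (*) (\<lambda>y. P y z \<kappa>)" for \<kappa> z by (rule P_linear)
  show "P y z \<kappa> = P z y \<kappa>" for y z \<kappa> by (rule P_sym)
  show "Vector_Spaces.linear sE (*) (X (fst q) (snd q))" for q by (rule X_linear)
  show "X (fst q) (snd q) (wedge (e (fst q')) (e (snd q'))) = (if q = q' then 1 else 0)"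
    if "q \<in> pairs 6" "q' \<in> pairs 6" for q q'
    using that by (auto simp: X_wedge \<xi>_e pairs_def split: if_splits)
  show "y = (\<Sum>q\<in>pairs 6. sE (X (fst q) (snd q) y) (wedge (e (fst q)) (e (snd q))))" for y by (rule X_rep)
  show "P (base_bivector i) (base_bivector i) \<kappa> = 0" for i \<kappa>
    unfolding base_bivector_def by (rule P_wedge)
next
  fix c assume c: "\<And>\<kappa>. \<kappa> \<in> quads \<Longrightarrow>
    (\<Sum>p\<in>pairs 5. c p * P (base_bivector (fst p)) (base_bivector (snd p)) \<kappa>) = 0"
  have "(\<Sum>p\<in>pairs 5. c p * pfaffian (base_wedge (fst p)) (base_wedge (snd p)) \<kappa>) = 0" if "\<kappa> \<in> quads" for \<kappa>
    using c[OF that] by (simp add: P_base[OF that])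
  note c' = this
  show "\<forall>p\<in>pairs 5. c p = 0"
  proof
    fix p assume "p \<in> pairs 5"
    with c' show "c p = 0" by (rule base_products_independent[of c p])
  qed
next
  fix \<eta>
  assume st: "\<And>j. j < 4 \<Longrightarrow> \<exists>c. \<forall>\<kappa>\<in>quads. P \<eta> (base_bivector j + base_bivector 4) \<kappa> =
    (\<Sum>p\<in>pairs 5. c p * P (base_bivector (fst p)) (base_bivector (snd p)) \<kappa>)"
  have "\<exists>t. \<forall>a<6. \<forall>b<6. X a b \<eta> = (\<Sum>i<5. t i * base_wedge i a b)"
  proof (rule base_stable)
    show "X a b \<eta> = - X b a \<eta>" for a b by (rule X_skew)
    fix j :: nat assume "j < 4"
    then obtain c where "\<forall>\<kappa>\<in>quads. P \<eta> (base_bivector j + base_bivector 4) \<kappa> =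
      (\<Sum>p\<in>pairs 5. c p * P (base_bivector (fst p)) (base_bivector (snd p)) \<kappa>)" using st by blast
    then show "\<exists>c. \<forall>\<kappa>\<in>quads. pfaffian (\<lambda>a b. X a b \<eta>) (\<lambda>a b. base_wedge j a b + base_wedge 4 a b) \<kappa> =
        (\<Sum>p\<in>pairs 5. c p * pfaffian (base_wedge (fst p)) (base_wedge (snd p)) \<kappa>)"
      by (intro exI[of _ c]) (simp add: P_base P_base1)
  qed
  then obtain t where "\<forall>a<6. \<forall>b<6. X a b \<eta> = (\<Sum>i<5. t i * base_wedge i a b)" by blast
  then have "\<eta> = (\<Sum>i<5. sE (t i) (base_bivector i))"
    by (intro X_cong) (simp add: X_sum X_base)
  then show "\<exists>t. \<eta> = (\<Sum>i<5. sE (t i) (base_bivector i))" by blast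
next
  fix p and w :: "nat \<Rightarrow> 'e"
  assume p: "polyfun (frame_coords sE 4) p"
    and zero: "\<And>w (\<omega> :: nat \<Rightarrow> 'e) (u :: nat \<Rightarrow> nat \<Rightarrow> complex). (\<And>i. i < 5 \<Longrightarrow> \<forall>\<kappa>\<in>quads. P (\<omega> i) (\<omega> i) \<kappa> = 0) \<Longrightarrow>
      (\<And>j. j < 4 \<Longrightarrow> w j = (\<Sum>i<5. sE (u j i) (\<omega> i))) \<Longrightarrow> p w = 0"
  show "p w = 0"
  proof (rule polyfun_zero_if_zero_on_secants[OF E _ _ p, of "\<lambda>a b. wedge (e a) (e b)"])
    show "wedge (e a) (e b) + wedge (e b) (e a) = 0" for a b by (rule wedge_skew)
    show "\<exists>c. y = (\<Sum>a<6. \<Sum>b<6. sE (c a b) (wedge (e a) (e b)))" for y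
    proof (intro exI)
      let ?c = "\<lambda>a b. if a < b then X a b y else 0"
      have "(\<Sum>a<6. \<Sum>b<6. sE (?c a b) (wedge (e a) (e b))) =
          (\<Sum>p\<in>pairs 6. sE (X (fst p) (snd p) y) (wedge (e (fst p)) (e (snd p))))"
        unfolding sum_square_split by (simp add: pairs_def case_prod_unfold cong: sum.cong_simp)
      then show "y = (\<Sum>a<6. \<Sum>b<6. sE (?c a b) (wedge (e a) (e b)))"
        using X_rep[of y] by (rule trans[OF _ sym, rotated])
    qed
    fix w :: "nat \<Rightarrow> 'e" and u A B
    assume w: "\<And>j. j < 4 \<Longrightarrow> w j = (\<Sum>a<6. \<Sum>b<6. sE (\<Sum>i<(5::nat). u i j * A i a * B i b) (wedge (e a) (e b)))"
    define \<omega> where "\<omega> i = wedge (\<Sum>a<6. sV (A i a) (e a)) (\<Sum>b<6. sV (B i b) (e b))" for i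
    show "p w = 0"
    proof (rule zero[of \<omega> w "\<lambda>j i. u i j"])
      show "\<forall>\<kappa>\<in>quads. P (\<omega> i) (\<omega> i) \<kappa> = 0" for i by (simp add: \<omega>_def P_wedge)
      fix j :: nat assume j: "j < 4"
      have "(\<Sum>i<5. sE (u i j) (\<omega> i)) = (\<Sum>i<5. \<Sum>a<6. \<Sum>b<6. sE (u i j * A i a * B i b) (wedge (e a) (e b)))"
        by (simp add: \<omega>_def wedge_sums E.scale_sum_right mult.assoc)
      also have "\<dots> = (\<Sum>a<6. \<Sum>i<5. \<Sum>b<6. sE (u i j * A i a * B i b) (wedge (e a) (e b)))"
        by (rule sum.swap)
      also have "\<dots> = (\<Sum>a<6. \<Sum>b<6. \<Sum>i<5. sE (u i j * A i a * B i b) (wedge (e a) (e b)))"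
        by (intro sum.cong refl sum.swap)
      also have "\<dots> = w j" unfolding w[OF j] by (simp add: E.scale_sum_left)
      finally show "w j = (\<Sum>i<5. sE (u i j) (\<omega> i))" by simp
    qed
  qed
qed

end

section \<open>Four-dimensional and five-dimensional subspaces\<close>

context exterior_coords
begin

section \<open>Points of G(2, V) as lines of isotropic vectors\<close>

lemma pluecker_span:
  "pluecker_embedding sE wedge (module.span sV {v1, v2}) = module.span sE {wedge v1 v2}"
proof -
  have span2: "\<exists>c d. v = sV c v1 + sV d v2" if v: "v \<in> V.span {v1, v2}" for v
  proof -
    obtain c where "v - sV c v1 \<in> V.span {v2}" using V.span_breakdown_eq[of v v1 "{v2}"] v by blast
    then obtain d where "v - sV c v1 = sV d v2" by (auto simp: V.span_singleton)
    then have "v = sV c v1 + sV d v2" by (simp add: algebra_simps)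
    then show ?thesis by blast
  qed
  have "wedge v w \<in> E.span {wedge v1 v2}" if vw: "v \<in> V.span {v1, v2}" "w \<in> V.span {v1, v2}" for v w
  proof -
    obtain a b c d where vw: "v = sV a v1 + sV b v2" "w = sV c v1 + sV d v2"
      using span2[OF vw(1)] span2[OF vw(2)] by blast
    have "wedge v2 v1 = - wedge v1 v2" using wedge_skew[of v1 v2] by (simp add: eq_neg_iff_add_eq_0 add.commute)
    then have "wedge v w = sE (a * d - b * c) (wedge v1 v2)"
      by (simp add: vw wedge_add1 wedge_add2 wedge_scale1 wedge_scale2 wedge_self E.scale_left_diff_distrib mult.commute)
    then show ?thesis by (auto simp: E.span_singleton)
  qed
  then have "{wedge v w | v w. v \<in> V.span {v1, v2} \<and> w \<in> V.span {v1, v2}} \<subseteq> E.span {wedge v1 v2}" by blast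
  moreover have "{wedge v1 v2} \<subseteq> {wedge v w | v w. v \<in> V.span {v1, v2} \<and> w \<in> V.span {v1, v2}}"
    using V.span_base[of v1 "{v1, v2}"] V.span_base[of v2 "{v1, v2}"] by auto
  ultimately show ?thesis unfolding pluecker_embedding_def
    by (intro subset_antisym E.span_mono E.span_minimal E.subspace_span)
qed

text \<open>The forms \<open>X\<close> show that all 2 by 2 minors of the coordinates of
  \<open>v\<close> and \<open>w\<close> vanish, so a nonzero coordinate of \<open>v\<close> yields
  the factor of proportionality.\<close>

lemma wedge_eq_0_imp_dependent:
  assumes "wedge v w = 0" "v \<noteq> 0"
  shows "w \<in> module.span sV {v}"
proof -
  have "\<exists>a<6. \<xi> a v \<noteq> 0"
  proof (rule ccontr)
    assume "\<not> (\<exists>a<6. \<xi> a v \<noteq> 0)"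
    then have "(\<Sum>a<6. sV (\<xi> a v) (e a)) = 0" by simp
    then show False using \<xi>_rep[of v] assms(2) by simp
  qed
  then obtain a where a: "a < 6" "\<xi> a v \<noteq> 0" by blast
  have X0: "X a b 0 = 0" for b using X_scale[of a b 0 0] by simp
  have *: "\<xi> a v * \<xi> b w = \<xi> b v * \<xi> a w" for b
    using X_wedge[of a b v w] unfolding assms(1) X0 by simp
  define c where "c = \<xi> a w / \<xi> a v"
  have "\<xi> b w = c * \<xi> b v" for b
  proof -
    have "\<xi> b w = (\<xi> a v * \<xi> b w) / \<xi> a v" using a(2) by simp
    also have "\<dots> = (\<xi> b v * \<xi> a w) / \<xi> a v" by (simp only: *[of b])
    also have "\<dots> = c * \<xi> b v" by (simp add: c_def)
    finally show ?thesis .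
  qed
  then have "(\<Sum>b<6. sV (\<xi> b w) (e b)) = sV c (\<Sum>b<6. sV (\<xi> b v) (e b))"
    by (simp add: V.scale_sum_right)
  then have "w = sV c v" unfolding \<xi>_rep[symmetric] .
  then show ?thesis by (auto simp: V.span_singleton)
qed

text \<open>Nonzero isotropic vectors are exactly the nonzero decomposable ones; this moves the
  geometry of \<open>U5\<close> into the quadratic forms.\<close>

lemma G2_iff:
  "L \<in> G2 sV sE wedge \<longleftrightarrow> (\<exists>y. y \<noteq> 0 \<and> (\<forall>\<kappa>\<in>quads. P y y \<kappa> = 0) \<and> L = module.span sE {y})"
proof
  assume "L \<in> G2 sV sE wedge"
  then obtain B where B: "\<not> V.dependent B" "card B = 2" "L = pluecker_embedding sE wedge (V.span B)"
    by (auto simp: G2_def grassmannian_def)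
  obtain v1 v2 where v: "B = {v2, v1}" "v1 \<noteq> v2" using B(2) by (auto simp: card_2_iff)
  have "v1 \<noteq> 0" "v2 \<notin> V.span {v1}"
    using B(1) v V.independent_insert[of v2 "{v1}"] by auto
  then have "wedge v1 v2 \<noteq> 0" using wedge_eq_0_imp_dependent by blast
  moreover have "L = E.span {wedge v1 v2}" using B(3) pluecker_span[of v1 v2] v(1) by (simp add: insert_commute)
  ultimately show "\<exists>y. y \<noteq> 0 \<and> (\<forall>\<kappa>\<in>quads. P y y \<kappa> = 0) \<and> L = E.span {y}" using P_wedge by blast
next
  assume "\<exists>y. y \<noteq> 0 \<and> (\<forall>\<kappa>\<in>quads. P y y \<kappa> = 0) \<and> L = E.span {y}"
  then obtain y where y: "y \<noteq> 0" "\<forall>\<kappa>\<in>quads. P y y \<kappa> = 0" "L = E.span {y}" by blast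
  then obtain v w where vw: "y = wedge v w" using decomposable_if_isotropic by blast
  have v0: "v \<noteq> 0" using y(1) vw wedge_scale1[of 0 0 w] by auto
  have w: "w \<notin> V.span {v}"
  proof
    assume "w \<in> V.span {v}"
    then obtain c where "w = sV c v" by (auto simp: V.span_singleton)
    then show False using y(1) vw by (simp add: wedge_scale2 wedge_self)
  qed
  then have ne: "w \<noteq> v" using V.span_base[of v "{v}"] by auto
  have "\<not> V.dependent {w, v}" using V.independent_insert[of w "{v}"] v0 w by simp
  then have "V.span {v, w} \<in> grassmannian sV 2"
    unfolding grassmannian_def using ne by (intro CollectI exI[of _ "{w, v}"]) (auto simp: insert_commute)
  moreover have "L = pluecker_embedding sE wedge (V.span {v, w})" using pluecker_span[of v w] y(3) vw by simp
  ultimately show "L \<in> G2 sV sE wedge" unfolding G2_def by blast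
qed

lemma span_comb: "x \<in> module.span sE (\<omega> ` {..<5}) \<longleftrightarrow> (\<exists>t. x = comb t \<omega>)"
  unfolding comb_def by (rule E.span_family) simp

text \<open>The square of a combination with coefficients \<open>t\<close> is the sum of
  \<open>2 * t i * t l\<close> times the products with \<open>i < l\<close>. These products are
  independent, so an isotropic combination has at most one nonzero coefficient, and the span
  contains no point of the Grassmannian beyond the five.\<close>

lemma points_of_span:
  assumes iso: "isotropic \<omega>" and PI: "products_independent \<omega>"
  shows "proj_space sE (module.span sE (\<omega> ` {..<5})) \<inter> G2 sV sE wedge = (\<lambda>i. module.span sE {\<omega> i}) ` {..<5}"
    (is "?S = ?f ` _")
    and "inj_on (\<lambda>i. module.span sE {\<omega> i}) {..<5}"
    and "inj_on \<omega> {..<5} \<and> \<not> module.dependent sE (\<omega> ` {..<5})"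
proof -
  have fam: "\<forall>c. (\<Sum>i<5. sE (c i) (\<omega> i)) = 0 \<longrightarrow> (\<forall>i\<in>{..<5}. c i = 0)"
  proof (intro allI impI ballI)
    fix c and i :: nat assume "(\<Sum>i<5. sE (c i) (\<omega> i)) = 0" "i \<in> {..<5}"
    then show "c i = 0"
      by (intro independent_if_products_independent[OF iso PI, of c i]) (simp_all add: comb_def)
  qed
  show ind: "inj_on \<omega> {..<5} \<and> \<not> E.dependent (\<omega> ` {..<5})"
    unfolding E.independent_family_iff[OF finite_lessThan] by (rule fam)
  have nz: "\<omega> i \<noteq> 0" if "i < 5" for i
    using ind that E.dependent_zero[of "\<omega> ` {..<5}"] by (metis imageI lessThan_iff)
  show "inj_on (\<lambda>i. E.span {\<omega> i}) {..<5}"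
  proof (rule inj_onI, rule ccontr)
    fix i l assume il: "i \<in> {..<5}" "l \<in> {..<5}" "E.span {\<omega> i} = E.span {\<omega> l}" "i \<noteq> l"
    have "\<omega> i \<in> E.span {\<omega> l}" using il(3) E.span_base[of "\<omega> i" "{\<omega> i}"] by simp
    then have "\<omega> i \<in> E.span (\<omega> ` {..<5} - {\<omega> i})"
      using il ind E.span_mono[of "{\<omega> l}" "\<omega> ` {..<5} - {\<omega> i}"] by (auto simp: inj_on_def)
    then show False using ind il(1) unfolding E.dependent_def by blast
  qed
  show "?S = ?f ` {..<5}"
  proof
    show "?f ` {..<5} \<subseteq> ?S"
    proof
      fix L assume "L \<in> ?f ` {..<5}"
      then obtain i where i: "i < 5" "L = E.span {\<omega> i}" by auto
      have "E.span {\<omega> i} \<subseteq> E.span (\<omega> ` {..<5})" using i by (intro E.span_mono) auto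
      moreover have "E.span {\<omega> i} \<in> grassmannian sE 1"
        unfolding grassmannian_def using nz[OF i(1)] by (intro CollectI exI[of _ "{\<omega> i}"]) auto
      moreover have "E.span {\<omega> i} \<in> G2 sV sE wedge"
        unfolding G2_iff using nz[OF i(1)] iso i(1) by (intro exI[of _ "\<omega> i"]) (simp add: isotropic_def)
      ultimately show "L \<in> ?S" using i(2) by (simp add: proj_space_def)
    qed
    show "?S \<subseteq> ?f ` {..<5}"
    proof
      fix L assume L: "L \<in> ?S"
      then obtain y where y: "y \<noteq> 0" "\<forall>\<kappa>\<in>quads. P y y \<kappa> = 0" "L = E.span {y}" using G2_iff by blast
      have "y \<in> E.span (\<omega> ` {..<5})" using L y(3) E.span_base[of y "{y}"] by (auto simp: proj_space_def)
      then obtain t where t: "y = comb t \<omega>" using span_comb by blast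
      define d where "d p = t (fst p) * t (snd p) + t (snd p) * t (fst p)" for p
      have "\<forall>\<kappa>\<in>quads. (\<Sum>p\<in>pairs 5. d p * P (\<omega> (fst p)) (\<omega> (snd p)) \<kappa>) = 0"
      proof
        fix \<kappa> assume \<kappa>: "\<kappa> \<in> quads"
        then have "P (comb t \<omega>) (comb t \<omega>) \<kappa> = 0" using y(2) t by simp
        then show "(\<Sum>p\<in>pairs 5. d p * P (\<omega> (fst p)) (\<omega> (snd p)) \<kappa>) = 0"
          unfolding P_comb[OF iso \<kappa>] d_def .
      qed
      with PI[unfolded products_independent_def, THEN spec[of _ d]]
      have d: "\<forall>p\<in>pairs 5. d p = 0" by (rule mp)
      have tt: "t i * t l = 0" if "i < l" "l < 5" for i l
        using d[THEN bspec[of _ _ "(i, l)"]] that by (simp add: d_def pairs_def)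
      have "\<exists>i<5. t i \<noteq> 0"
      proof (rule ccontr)
        assume "\<not> (\<exists>i<5. t i \<noteq> 0)"
        then have "comb t \<omega> = 0" by (simp add: comb_def)
        then show False using y(1) t by simp
      qed
      then obtain i where i: "i < 5" "t i \<noteq> 0" by blast
      have "t l = 0" if "l < 5" "l \<noteq> i" for l
        using tt[of i l] tt[of l i] i that by (cases "i < l") auto
      then have "y = (\<Sum>l<5. if l = i then sE (t l) (\<omega> l) else 0)"
        unfolding t comb_def by (intro sum.cong) auto
      then have yi: "y = sE (t i) (\<omega> i)" using i(1) by simp
      have "E.span {y} = E.span {\<omega> i}"
      proof
        show "E.span {y} \<subseteq> E.span {\<omega> i}"
          by (rule E.span_minimal) (auto simp: yi intro: E.span_scale E.span_base)
        have "\<omega> i = sE (1 / t i) y" using i(2) by (simp add: yi)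
        then have "\<omega> i \<in> E.span {y}" using E.span_scale[OF E.span_base[of y "{y}"]] by simp
        then show "E.span {\<omega> i} \<subseteq> E.span {y}"
          by (intro E.span_minimal) auto
      qed
      then show "L \<in> ?f ` {..<5}" using y(3) i(1) by auto
    qed
  qed
qed

lemma span_in_U5:
  assumes iso: "isotropic \<omega>" and PI: "products_independent \<omega>"
  shows "module.span sE (\<omega> ` {..<5}) \<in> U5 sV sE wedge"
proof -
  let ?f = "\<lambda>i. E.span {\<omega> i}" and ?S = "proj_space sE (E.span (\<omega> ` {..<5})) \<inter> G2 sV sE wedge"
  note S = points_of_span[OF iso PI]
  have "E.span (\<omega> ` {..<5}) \<in> grassmannian sE 5"
    unfolding grassmannian_def using S(3) by (intro CollectI exI[of _ "\<omega> ` {..<5}"]) (auto simp: card_image)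
  moreover have "card ?S = 5" unfolding S(1) using S(2) by (simp add: card_image)
  moreover have "independent_points sE ?S"
    unfolding independent_points_def
  proof (intro exI conjI ballI)
    let ?r = "\<lambda>L. \<omega> (the_inv_into {..<5} ?f L)"
    have r: "?r (?f i) = \<omega> i" if "i < 5" for i using the_inv_into_f_f[OF S(2), of i] that by simp
    show "L = E.span {?r L}" if "L \<in> ?S" for L using that r unfolding S(1) by auto
    have "?r ` ?S = \<omega> ` {..<5}" unfolding S(1) image_image using r by (intro image_cong) auto
    then show "\<not> E.dependent (?r ` ?S)" using S(3) by simp
  qed
  ultimately show ?thesis by (simp add: U5_def)
qed

text \<open>Representatives of the five points are independent in a space of dimension five, hence
  span it, and each is a multiple of a decomposable vector.\<close>

lemma U5_imp_span:
  assumes "W \<in> U5 sV sE wedge"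
  shows "\<exists>\<omega>. isotropic \<omega> \<and> W = module.span sE (\<omega> ` {..<5})"
proof -
  let ?S = "proj_space sE W \<inter> G2 sV sE wedge"
  obtain r where r: "\<And>L. L \<in> ?S \<Longrightarrow> L = E.span {r L}" and ind: "\<not> E.dependent (r ` ?S)"
    using assms by (auto simp: U5_def independent_points_def)
  have card: "card ?S = 5" and W: "W \<in> grassmannian sE 5" using assms by (auto simp: U5_def)
  have fin: "finite ?S" using card by (metis card.infinite zero_neq_numeral)
  have "inj_on r ?S" by (rule inj_onI) (metis r)
  then have cr: "card (r ` ?S) = 5" using card by (simp add: card_image)
  have "\<exists>\<omega>. bij_betw \<omega> {0..<card (r ` ?S)} (r ` ?S)"
    by (rule ex_bij_betw_nat_finite) (use fin in simp)
  then obtain \<omega> where "bij_betw \<omega> {0..<5::nat} (r ` ?S)" unfolding cr by blast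
  then have \<omega>: "\<omega> ` {..<5} = r ` ?S" by (simp add: bij_betw_def lessThan_atLeast0)
  obtain B where B: "W = E.span B" "finite B" "card B = 5" using W by (auto simp: grassmannian_def)
  have "r L \<in> W" if "L \<in> ?S" for L
  proof -
    have "r L \<in> L" using r[OF that] E.span_base[of "r L" "{r L}"] by auto
    then show ?thesis using that by (auto simp: proj_space_def)
  qed
  then have "r ` ?S \<subseteq> E.span B" using B(1) by auto
  then have "E.span (r ` ?S) = E.span B"
    by (rule E.span_eq_if_independent_card[OF B(2) ind]) (simp add: cr B(3))
  moreover have "isotropic \<omega>"
    unfolding isotropic_def
  proof (intro allI impI ballI)
    fix i \<kappa> assume "i < (5::nat)" and \<kappa>: "\<kappa> \<in> quads"
    then have "\<omega> i \<in> r ` ?S" using \<omega> by auto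
    then obtain L where L: "L \<in> ?S" "\<omega> i = r L" by blast
    then obtain y where y: "\<forall>\<kappa>\<in>quads. P y y \<kappa> = 0" "L = E.span {y}" using G2_iff by blast
    have "r L \<in> E.span {y}" using r[OF L(1)] E.span_base[of "r L" "{r L}"] y(2) by auto
    then obtain c where "r L = sE c y" by (auto simp: E.span_singleton)
    then show "P (\<omega> i) (\<omega> i) \<kappa> = 0"
      using L(2) y(1) \<kappa> P_scale1[OF \<kappa>, of c y] by (simp add: P_sym[of y "sE c y"])
  qed
  ultimately show ?thesis using B(1) \<omega> by (intro exI[of _ \<omega>]) simp
qed

lemma span_subset_iff_comb:
  "E.span (w ` {..<4}) \<subseteq> E.span (\<omega> ` {..<5}) \<longleftrightarrow> (\<exists>u. \<forall>j<4. w j = comb (u j) \<omega>)"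
proof
  assume "E.span (w ` {..<4}) \<subseteq> E.span (\<omega> ` {..<5})"
  then have "\<exists>t. w j = comb t \<omega>" if "j < 4" for j
    using E.span_base[of "w j" "w ` {..<4}"] that span_comb[of "w j" \<omega>] by auto
  then show "\<exists>u. \<forall>j<4. w j = comb (u j) \<omega>" by (intro choice) simp
next
  assume "\<exists>u. \<forall>j<4. w j = comb (u j) \<omega>"
  then obtain u where u: "\<forall>j<4. w j = comb (u j) \<omega>" ..
  show "E.span (w ` {..<4}) \<subseteq> E.span (\<omega> ` {..<5})"
  proof (rule E.span_minimal[OF subsetI E.subspace_span])
    fix y assume "y \<in> w ` {..<4}"
    then obtain j where j: "j < 4" "y = w j" by auto
    show "y \<in> E.span (\<omega> ` {..<5})"
      unfolding span_comb j(2) by (rule exI[of _ "u j"]) (rule u[rule_format, OF j(1)])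
  qed
qed

lemma span_subset_if_comb:
  assumes "\<forall>i<5. \<omega>' i = comb (T i) \<omega>"
  shows "E.span (\<omega>' ` {..<5}) \<subseteq> E.span (\<omega> ` {..<5})"
proof (rule E.span_minimal[OF subsetI E.subspace_span])
  fix y assume "y \<in> \<omega>' ` {..<5}"
  then obtain j where j: "j < 5" "y = \<omega>' j" by auto
  show "y \<in> E.span (\<omega> ` {..<5})"
    unfolding span_comb j(2) by (rule exI[of _ "T j"]) (rule assms[rule_format, OF j(1)])
qed

lemma unique_U5_containing_span:
  assumes \<omega>: "isotropic \<omega>" "products_independent \<omega>" "\<exists>u. \<forall>j<4. w j = comb (u j) \<omega>"
    and uniq: "\<forall>\<omega>'. isotropic \<omega>' \<and> (\<exists>u. \<forall>j<4. w j = comb (u j) \<omega>') \<longrightarrow>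
      (\<exists>T T'. (\<forall>i<5. \<omega>' i = comb (T i) \<omega>) \<and> (\<forall>i<5. \<omega> i = comb (T' i) \<omega>'))"
  shows "\<exists>!W5. W5 \<in> U5 sV sE wedge \<and> E.span (w ` {..<4}) \<subseteq> W5"
proof (rule ex1I[of _ "E.span (\<omega> ` {..<5})"], rule conjI)
  show "E.span (\<omega> ` {..<5}) \<in> U5 sV sE wedge" by (rule span_in_U5[OF \<omega>(1,2)])
  show "E.span (w ` {..<4}) \<subseteq> E.span (\<omega> ` {..<5})" by (rule span_subset_iff_comb[THEN iffD2, OF \<omega>(3)])
next
  fix W5 assume W5: "W5 \<in> U5 sV sE wedge \<and> E.span (w ` {..<4}) \<subseteq> W5"
  from U5_imp_span[OF conjunct1[OF W5]]
  obtain \<omega>' where \<omega>': "isotropic \<omega>' \<and> W5 = E.span (\<omega>' ` {..<5})" ..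
  have "E.span (w ` {..<4}) \<subseteq> E.span (\<omega>' ` {..<5})"
    using conjunct2[OF W5] unfolding conjunct2[OF \<omega>'] .
  then have "isotropic \<omega>' \<and> (\<exists>u. \<forall>j<4. w j = comb (u j) \<omega>')"
    by (rule conjI[OF conjunct1[OF \<omega>'] span_subset_iff_comb[THEN iffD1]])
  from uniq[THEN spec, THEN mp, OF this]
  obtain T where "\<exists>T'. (\<forall>i<5. \<omega>' i = comb (T i) \<omega>) \<and> (\<forall>i<5. \<omega> i = comb (T' i) \<omega>')" ..
  then obtain T' where T: "(\<forall>i<5. \<omega>' i = comb (T i) \<omega>) \<and> (\<forall>i<5. \<omega> i = comb (T' i) \<omega>')" ..
  show "W5 = E.span (\<omega> ` {..<5})"
    unfolding conjunct2[OF \<omega>']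
    by (rule subset_antisym[OF span_subset_if_comb[OF conjunct1[OF T]] span_subset_if_comb[OF conjunct2[OF T]]])
qed

lemma generic_unique_U5:
  "\<exists>Om. zariski_open sE 4 Om \<and> Om \<noteq> {} \<and>
    (\<forall>W4\<in>Om. \<exists>!W5. W5 \<in> U5 sV sE wedge \<and> W4 \<subseteq> W5)"
proof (rule base_dual)
  fix \<phi> :: "nat \<Rightarrow> 'e \<Rightarrow> complex"
  assume \<phi>1: "\<And>m. Vector_Spaces.linear sE (*) (\<phi> m)"
    and \<phi>2: "\<And>m j. m < 5 \<Longrightarrow> j < 4 \<Longrightarrow> \<phi> m (w\<^sub>0 j) = (if m = j then 1 else 0)"
    and \<phi>3: "\<And>m. m < 5 \<Longrightarrow> \<phi> m (base_bivector 4) = (if m = 4 then 1 else 0)"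
  have dual: "secant_web_dual sE P quads (\<lambda>p. X (fst p) (snd p)) (\<lambda>p. wedge (e (fst p)) (e (snd p)))
    (pairs 6) base_bivector \<phi>"
    by (rule secant_web_dual.intro[OF secant_web_axioms secant_web_dual_axioms.intro]) (rule \<phi>1, rule \<phi>2, assumption+, rule \<phi>3, assumption)
  note main = secant_web_dual.generic_decomposition[OF dual, unfolded secant_web_dual.spanned_def[OF dual]]
  from main obtain G where G: "polyfun (frame_coords sE 4) G \<and> G w\<^sub>0 \<noteq> 0 \<and> (\<forall>w. G w \<noteq> 0 \<longrightarrow>
    (\<exists>\<omega>. isotropic \<omega> \<and> products_independent \<omega> \<and> (\<exists>u. \<forall>j<4. w j = comb (u j) \<omega>) \<and>
      (\<forall>\<omega>'. isotropic \<omega>' \<and> (\<exists>u. \<forall>j<4. w j = comb (u j) \<omega>') \<longrightarrow>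
        (\<exists>T T'. (\<forall>i<5. \<omega>' i = comb (T i) \<omega>) \<and> (\<forall>i<5. \<omega> i = comb (T' i) \<omega>')))))" ..
  note G1 = conjunct1[OF G] and G2 = conjunct1[OF conjunct2[OF G]] and G3 = conjunct2[OF conjunct2[OF G]]
  have "\<exists>Om. zariski_open sE 4 Om \<and> Om \<noteq> {} \<and> (\<forall>W\<in>Om. \<exists>w. G w \<noteq> 0 \<and> W = E.span (w ` {..<4}))"
  proof (rule zariski_open_frames[where \<phi> = \<phi>, OF E _ G1 G2])
    show "Vector_Spaces.linear sE (*) (\<phi> i)" for i by (rule \<phi>1)
    show "\<phi> i (w\<^sub>0 j) = (if i = j then 1 else 0)" if "i < 4" "j < 4" for i j
      by (rule \<phi>2) (use that in linarith)+
  qed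
  then obtain Om where Om: "zariski_open sE 4 Om \<and> Om \<noteq> {} \<and>
    (\<forall>W\<in>Om. \<exists>w. G w \<noteq> 0 \<and> W = E.span (w ` {..<4}))" ..
  have "\<exists>!W5. W5 \<in> U5 sV sE wedge \<and> W4 \<subseteq> W5" if "W4 \<in> Om" for W4
  proof -
    from bspec[OF conjunct2[OF conjunct2[OF Om]] that]
    obtain w where w: "G w \<noteq> 0 \<and> W4 = E.span (w ` {..<4})" ..
    from G3[THEN spec, THEN mp, OF conjunct1[OF w]]
    obtain \<omega> where \<omega>: "isotropic \<omega> \<and> products_independent \<omega> \<and> (\<exists>u. \<forall>j<4. w j = comb (u j) \<omega>) \<and>
      (\<forall>\<omega>'. isotropic \<omega>' \<and> (\<exists>u. \<forall>j<4. w j = comb (u j) \<omega>') \<longrightarrow>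
        (\<exists>T T'. (\<forall>i<5. \<omega>' i = comb (T i) \<omega>) \<and> (\<forall>i<5. \<omega> i = comb (T' i) \<omega>')))" ..
    show ?thesis
      unfolding conjunct2[OF w]
      by (rule unique_U5_containing_span[OF conjunct1[OF \<omega>] conjunct1[OF conjunct2[OF \<omega>]]
            conjunct1[OF conjunct2[OF conjunct2[OF \<omega>]]] conjunct2[OF conjunct2[OF conjunct2[OF \<omega>]]]])
  qed
  then have u: "\<forall>W4\<in>Om. \<exists>!W5. W5 \<in> U5 sV sE wedge \<and> W4 \<subseteq> W5" by (rule ballI)
  show ?thesis
    by (rule exI[of _ Om], rule conjI, rule conjunct1[OF Om], rule conjI,
        rule conjunct1[OF conjunct2[OF Om]], rule u)
qed

end

theorem proposition4p1:
  fixes scaleV :: "complex \<Rightarrow> 'v::ab_group_add \<Rightarrow> 'v"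
    and scaleE :: "complex \<Rightarrow> 'e::ab_group_add \<Rightarrow> 'e"
    and wedge :: "'v \<Rightarrow> 'v \<Rightarrow> 'e"
  assumes "vector_space scaleV"
    and "vector_space scaleE"
    and "vector_space.dim scaleV UNIV = 6"
    and "exterior_square scaleV scaleE wedge"
  shows "\<exists>Om. zariski_open scaleE 4 Om \<and> Om \<noteq> {} \<and>
           (\<forall>W4\<in>Om. \<exists>!W5. W5 \<in> U5 scaleV scaleE wedge \<and> W4 \<subseteq> W5)"
proof -
  interpret V: vector_space scaleV by (rule assms(1))
  interpret C: vector_space "(*) :: complex \<Rightarrow> complex \<Rightarrow> complex"
    by unfold_locales (auto simp: algebra_simps)
  interpret VC: vector_space_pair scaleV "(*) :: complex \<Rightarrow> complex \<Rightarrow> complex" ..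
  obtain B where B: "V.independent B" "UNIV \<subseteq> V.span B" "card B = 6"
    using V.basis_exists[of UNIV] assms(3) by metis
  have "finite B" using B(3) by (metis card.infinite zero_neq_numeral)
  then obtain e where "bij_betw e {0..<6::nat} B" using ex_bij_betw_nat_finite B(3) by metis
  then have e: "inj_on e {..<6}" "e ` {..<6} = B" by (auto simp: bij_betw_def lessThan_atLeast0)
  have "\<forall>a. \<exists>f. Vector_Spaces.linear scaleV (*) f \<and> (\<forall>y\<in>B. f y = (if y = e a then 1 else 0 :: complex))"
    by (intro allI VC.linear_independent_extend[OF B(1)])
  then have "\<exists>\<xi>. \<forall>a. Vector_Spaces.linear scaleV (*) (\<xi> a) \<and> (\<forall>y\<in>B. \<xi> a y = (if y = e a then 1 else 0 :: complex))"
    by (rule choice)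
  then obtain \<xi> where \<xi>': "\<forall>a. Vector_Spaces.linear scaleV (*) (\<xi> a) \<and> (\<forall>y\<in>B. \<xi> a y = (if y = e a then 1 else 0 :: complex))"
    by (rule exE)
  have \<xi>: "Vector_Spaces.linear scaleV (*) (\<xi> a)" for a by (rule \<xi>'[THEN spec, THEN conjunct1])
  have \<xi>e: "\<xi> a (e b) = (if a = b then 1 else 0)" if "a < 6" "b < 6" for a b
  proof -
    have "e b \<in> B" using e(2) that by auto
    then have "\<xi> a (e b) = (if e b = e a then 1 else 0)" using \<xi>'[THEN spec[of _ a]] by blast
    then show ?thesis using e(1) that by (auto simp: inj_on_def)
  qed
  have rep: "v = (\<Sum>a<6. scaleV (\<xi> a v) (e a))" for v
  proof -
    have "v \<in> V.span (e ` {..<6})" using B(2) e(2) by auto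
    then obtain c where c: "v = (\<Sum>a<6. scaleV (c a) (e a))" using V.span_family[of "{..<6}" v e] by auto
    have "\<xi> a v = c a" if "a < 6" for a
    proof -
      interpret f: Vector_Spaces.linear scaleV "(*)" "\<xi> a" by (rule \<xi>)
      have "\<xi> a v = (\<Sum>b<6. if b = a then c b else 0)"
        unfolding c f.sum f.scale using that by (intro sum.cong) (auto simp: \<xi>e)
      then show ?thesis using that by simp
    qed
    then show ?thesis using c by simp
  qed
  interpret exterior_coords scaleV scaleE wedge e \<xi>
    by (rule exterior_coords.intro[OF assms(1,2,4) \<xi> \<xi>e rep])
  show ?thesis by (rule generic_unique_U5)
qed

end
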